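(* Consider the discrete-time dual-queue status update system with freezing parameter $k\ge 1$, discrete phase-type service times $T_m\sim \mathrm{DPH}(\boldsymbol\alpha^{(m)},\boldsymbol B^{(m)})$ of order $N_m$ ($m=1,2$), and a fixed strict priority rule ($S_1$ priority or $S_2$ priority), as described in the context. Let $\{Y_h\}_{h\ge 0}$ be the associated absorbing Markov chain, with transient-to-transient transition matrix $\boldsymbol A$, initial probability (row) vector $\boldsymbol\sigma$ on the transient states, and column vector $\boldsymbol{c_s}$ of one-step transition probabilities from the transient states to the successful absorbing state $15$. Let $u_\Phi(h)=\lim_{n\to\infty}\Pr(\Phi_n=h)$ be the probability mass function of the steady-state Peak Age of Information. Then for all $h=1,2,\dots$ $$u_\Phi(h)=\frac{\boldsymbol\sigma\boldsymbol A^{h}\boldsymbol{c_s}}{\boldsymbol\sigma\boldsymbol A(\boldsymbol I-\boldsymbol A)^{-1}\boldsymbol{c_s}}.$$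
   Context: **Service times.** $\mathrm{DPH}(\boldsymbol\alpha,\boldsymbol B)$ of order $N$ is the law of the absorption time of a discrete-time Markov chain with transient phases $1,\dots,N$, initial probability row vector $\boldsymbol\alpha$ on the phases, sub-stochastic transient transition matrix $\boldsymbol B$, and absorption probability vector $\boldsymbol b=(\boldsymbol I-\boldsymbol B)\boldsymbol 1$. All phases are transient. The service times on server $S_m$ are distributed as $\mathrm{DPH}(\boldsymbol\alpha^{(m)},\boldsymbol B^{(m)})$ of order $N_m$, with $\boldsymbol b^{(m)}=(\boldsymbol I-\boldsymbol B^{(m)})\boldsymbol 1$, and all service times are independent. **System.** Time is slotted, $t=0,1,2,\dots$. Two non-preemptive servers $S_1,S_2$ send packets to a monitor; a packet generated at slot $g$ on a server immediately starts service there and is received at slot $g+T$, $T$ its service time, at which slot that server is available again. A new packet is generated at the earliest slot that is at least $k$ slots after the previous generation slot and at which at least one server is available. If exactly one server is available it is used; if both are available, $S_1$ is used under $S_1$ priority and $S_2$ under $S_2$ priority. A received packet is up to date if it was generated later than every other packet received so far (including packets received in the same slot), otherwise it is obsolete. Let $g_n$ and $r_n$ be the generation and reception slots of the $n$th up-to-date packet. The Age of Information is $\Delta(t)=t-g_{n-1}$ for $r_{n-1}\le t\le r_n-1$ (Cycle $n$), and the Peak Age of Information of Cycle $n$ is the largest value of $\Delta$ in the cycle, $\Phi_n=r_n-1-g_{n-1}$. The system is assumed to have a steady state: the recurrent chain $\{W_h\}$ (defined later in this context) has a unique stationary distribution, and the limits $u_\Phi(h)$ exist. **States of $\{Y_h\}$.**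 The chain starts at the generation of an arbitrary packet $P^*$. Here $i\in\{1,\dots,N_1\}$, $j\in\{1,\dots,N_2\}$ are the service phases on $S_1,S_2$ ($0$ means idle), $l\in\{0,\dots,k-1\}$ is the freezing clock, and $\tau_1,\tau_2$ are the generation instants of the packets on $S_1,S_2$; in classes 7–14, $P^*$ has been successfully received, and $P_1,P_2$ are the packets on $S_1,S_2$ (up to date/obsolete relative to $P^*$). - $(1,i,j,l)$: $P^*$ on $S_1$, $\tau_1>\tau_2$. - $(2,i,j,l)$: $P^*$ on $S_1$, $\tau_1<\tau_2$. - $(3,i,j,l)$: $P^*$ on $S_2$, $\tau_1>\tau_2$. - $(4,i,j,l)$: $P^*$ on $S_2$, $\tau_1<\tau_2$. - $(5,i,0,l)$: $P^*$ on $S_1$, $S_2$ idle. - $(6,0,j,l)$: $P^*$ on $S_2$, $S_1$ idle. - $(7,0,0,l)$: both idle. - $(8,i,j)$: $P_1,P_2$ up to date. - $(9,i,0,l)$: $P_1$ obsolete, $S_2$ idle. - $(10,0,j,l)$: $P_2$ obsolete, $S_1$ idle. - $(11,i,j,l)$: $P_1$ up to date, $P_2$ obsolete. - $(12,i,j,l)$: $P_2$ up to date, $P_1$ obsolete. - $(13,i,0,l)$: $P_1$ up to date, $S_2$ idle. - $(14,0,j,l)$: $P_2$ up to date, $S_1$ idle. - $15$: successful absorbing state; $16$: unsuccessful absorbing state. The number of transient states is $M=k(6N_1N_2+3(N_1+N_2)+1)+N_1N_2$. **Transitions of $\{Y_h\}$.** Write $B^{(m)}_{xy},b^{(m)}_x,\alpha^{(m)}_x$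 for entries. "$[<]$" means the transition applies when $l<k-1$, "$[=]$" when $l=k-1$. "To $F$ with weight $w$" means: $[<]$ to $(7,0,0,l+1)$ with probability $w$; $[=]$ under $S_1$ priority to $(13,i',0,0)$ with probability $w\,\alpha^{(1)}_{i'}$, under $S_2$ priority to $(14,0,j',0)$ with probability $w\,\alpha^{(2)}_{j'}$. "Stay in class $c$ with both busy" means: to $(c,i',j',\min(l+1,k-1))$ with probability $B^{(1)}_{ii'}B^{(2)}_{jj'}$. Primed indices range over all phases. Unlisted transitions have probability $0$. - From $(1,i,j,l)$: $[<]$ $(10,0,j',l+1)$: $b^{(1)}_iB^{(2)}_{jj'}$; $[=]$ $(11,i',j',0)$: $b^{(1)}_iB^{(2)}_{jj'}\alpha^{(1)}_{i'}$; to $F$ with weight $b^{(1)}_ib^{(2)}_j$; $[<]$ $(5,i',0,l+1)$: $b^{(2)}_jB^{(1)}_{ii'}$; $[=]$ $(2,i',j',0)$: $b^{(2)}_jB^{(1)}_{ii'}\alpha^{(2)}_{j'}$; stay in class 1 with both busy. - From $(2,i,j,l)$: $[<]$ $(14,0,j',l+1)$: $b^{(1)}_iB^{(2)}_{jj'}$; $[=]$ $(8,i',j')$: $b^{(1)}_iB^{(2)}_{jj'}\alpha^{(1)}_{i'}$; stay in class 2 with both busy; $16$: $b^{(2)}_j$. - From $(3,i,j,l)$: $[<]$ $(13,i',0,l+1)$: $b^{(2)}_jB^{(1)}_{ii'}$; $[=]$ $(8,i',j')$: $b^{(2)}_jB^{(1)}_{ii'}\alpha^{(2)}_{j'}$;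 stay in class 3 with both busy; $16$: $b^{(1)}_i$. - From $(4,i,j,l)$: $[<]$ $(6,0,j',l+1)$: $b^{(1)}_iB^{(2)}_{jj'}$; $[=]$ $(3,i',j',0)$: $b^{(1)}_iB^{(2)}_{jj'}\alpha^{(1)}_{i'}$; to $F$ with weight $b^{(1)}_ib^{(2)}_j$; $[<]$ $(9,i',0,l+1)$: $b^{(2)}_jB^{(1)}_{ii'}$; $[=]$ $(12,i',j',0)$: $b^{(2)}_jB^{(1)}_{ii'}\alpha^{(2)}_{j'}$; stay in class 4 with both busy. - From $(5,i,0,l)$: to $F$ with weight $b^{(1)}_i$; $[<]$ $(5,i',0,l+1)$: $B^{(1)}_{ii'}$; $[=]$ $(2,i',j',0)$: $B^{(1)}_{ii'}\alpha^{(2)}_{j'}$. - From $(6,0,j,l)$: to $F$ with weight $b^{(2)}_j$; $[<]$ $(6,0,j',l+1)$: $B^{(2)}_{jj'}$; $[=]$ $(3,i',j',0)$: $B^{(2)}_{jj'}\alpha^{(1)}_{i'}$. - From $(7,0,0,l)$: to $F$ with weight $1$. - From $(8,i,j)$: $15$: $b^{(1)}_i+b^{(2)}_j-b^{(1)}_ib^{(2)}_j$; $(8,i',j')$: $B^{(1)}_{ii'}B^{(2)}_{jj'}$. - From $(9,i,0,l)$: to $F$ with weight $b^{(1)}_i$; $[<]$ $(9,i',0,l+1)$: $B^{(1)}_{ii'}$; $[=]$ $(12,i',j',0)$: $B^{(1)}_{ii'}\alpha^{(2)}_{j'}$. - From $(10,0,j,l)$: to $F$ with weight $b^{(2)}_j$;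 $[<]$ $(10,0,j',l+1)$: $B^{(2)}_{jj'}$; $[=]$ $(11,i',j',0)$: $B^{(2)}_{jj'}\alpha^{(1)}_{i'}$. - From $(11,i,j,l)$: $15$: $b^{(1)}_i$; $[<]$ $(13,i',0,l+1)$: $b^{(2)}_jB^{(1)}_{ii'}$; $[=]$ $(8,i',j')$: $b^{(2)}_jB^{(1)}_{ii'}\alpha^{(2)}_{j'}$; stay in class 11 with both busy. - From $(12,i,j,l)$: $15$: $b^{(2)}_j$; $[<]$ $(14,0,j',l+1)$: $b^{(1)}_iB^{(2)}_{jj'}$; $[=]$ $(8,i',j')$: $b^{(1)}_iB^{(2)}_{jj'}\alpha^{(1)}_{i'}$; stay in class 12 with both busy. - From $(13,i,0,l)$: $15$: $b^{(1)}_i$; $[<]$ $(13,i',0,l+1)$: $B^{(1)}_{ii'}$; $[=]$ $(8,i',j')$: $B^{(1)}_{ii'}\alpha^{(2)}_{j'}$. - From $(14,0,j,l)$: $15$: $b^{(2)}_j$; $[<]$ $(14,0,j',l+1)$: $B^{(2)}_{jj'}$; $[=]$ $(8,i',j')$: $B^{(2)}_{jj'}\alpha^{(1)}_{i'}$. - $15$ and $16$ are absorbing. $\boldsymbol A$ is the $M\times M$ matrix of transition probabilities among transient states, and $\boldsymbol{c_s}$ the $M\times1$ vector of transition probabilities from transient states to state $15$. **Recurrent chain $\{W_h\}$.** States: $(1,0,0,l)_R$ (both idle), $(2,i,0,l)_R$ (only $S_1$ busy), $(3,0,j,l)_R$ (only $S_2$ busy), $(4,i,j,l)_R$ (both busy),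 with service phases $i\in\{1,\dots,N_1\}$, $j\in\{1,\dots,N_2\}$ and freezing clock $l\in\{0,\dots,k-1\}$. "To $F_R$ with weight $w$" means: $[<]$ to $(1,0,0,l+1)_R$ with probability $w$; $[=]$ under $S_1$ priority to $(2,i',0,0)_R$ with probability $w\alpha^{(1)}_{i'}$, under $S_2$ priority to $(3,0,j',0)_R$ with probability $w\alpha^{(2)}_{j'}$. Transitions (probabilities of several listed transitions to the same state are added): - From $(1,0,0,l)_R$: to $F_R$ with weight $1$. - From $(2,i,0,l)_R$: to $F_R$ with weight $b^{(1)}_i$; $[<]$ $(2,i',0,l+1)_R$: $B^{(1)}_{ii'}$; $[=]$ $(4,i',j',0)_R$: $B^{(1)}_{ii'}\alpha^{(2)}_{j'}$. - From $(3,0,j,l)_R$: to $F_R$ with weight $b^{(2)}_j$; $[<]$ $(3,0,j',l+1)_R$: $B^{(2)}_{jj'}$; $[=]$ $(4,i',j',0)_R$: $B^{(2)}_{jj'}\alpha^{(1)}_{i'}$. - From $(4,i,j,l)_R$: $[<]$ $(3,0,j',l+1)_R$: $b^{(1)}_iB^{(2)}_{jj'}$; $[=]$ $(4,i',j',0)_R$: $b^{(1)}_iB^{(2)}_{jj'}\alpha^{(1)}_{i'}$; to $F_R$ with weight $b^{(1)}_ib^{(2)}_j$; $[<]$ $(2,i',0,l+1)_R$: $b^{(2)}_jB^{(1)}_{ii'}$; $[=]$ $(4,i',j',0)_R$: $b^{(2)}_jB^{(1)}_{ii'}\alpha^{(2)}_{j'}$; $(4,i',j',\min(l+1,k-1))_R$: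 $B^{(1)}_{ii'}B^{(2)}_{jj'}$. Let $p(\cdot)_R$ be its stationary probabilities. **Initial vector $\boldsymbol\sigma$.** Put $$q(1,i',j',0)=\sum_{j}B^{(2)}_{jj'}\alpha^{(1)}_{i'}p(3,0,j,k-1)_R+\sum_{i,j}b^{(1)}_iB^{(2)}_{jj'}\alpha^{(1)}_{i'}p(4,i,j,k-1)_R,$$ $$q(4,i',j',0)=\sum_{i}B^{(1)}_{ii'}\alpha^{(2)}_{j'}p(2,i,0,k-1)_R+\sum_{i,j}b^{(2)}_jB^{(1)}_{ii'}\alpha^{(2)}_{j'}p(4,i,j,k-1)_R,$$ $$\omega=p(1,0,0,k-1)_R+\sum_i b^{(1)}_ip(2,i,0,k-1)_R+\sum_j b^{(2)}_jp(3,0,j,k-1)_R+\sum_{i,j}b^{(1)}_ib^{(2)}_jp(4,i,j,k-1)_R,$$ and, under $S_1$ priority, $q(5,i',0,0)=\alpha^{(1)}_{i'}\omega$; under $S_2$ priority, $q(6,0,j',0)=\alpha^{(2)}_{j'}\omega$. All other states have $q=0$. Then $\boldsymbol\sigma$ is $q$ divided by the sum of all its entries, and $\Pr(Y_0=s)=\boldsymbol\sigma_s$. *)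

theory Defs
  imports
    "HOL-Probability.Probability"
    "Jordan_Normal_Form.Matrix"
    "Jordan_Normal_Form.Gauss_Jordan_Elimination"
begin

section \<open>Discrete phase-type distributions\<close>

definition markov_chain ::
  "'w measure \<Rightarrow> (nat \<Rightarrow> 'w \<Rightarrow> 's) \<Rightarrow> 's set \<Rightarrow> ('s \<Rightarrow> real) \<Rightarrow> ('s \<Rightarrow> 's \<Rightarrow> real) \<Rightarrow> bool" where
  "markov_chain M X S \<nu> K \<longleftrightarrow> prob_space M
     \<and> (\<forall>t. X t \<in> measurable M (count_space S))
     \<and> (\<forall>n x. (\<forall>t\<le>n. x t \<in> S) \<longrightarrow>
          measure M {\<omega> \<in> space M. \<forall>t\<le>n. X t \<omega> = x t} = \<nu> (x 0) * (\<Prod>t<n. K (x t) (x (Suc t))))"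

text \<open>Phases are numbered from 0, to agree with matrix indices.\<close>

definition exit_vec :: "nat \<Rightarrow> real mat \<Rightarrow> real vec" where
  "exit_vec n B = (1\<^sub>m n - B) *\<^sub>v Matrix.vec n (\<lambda>_. 1)"

text \<open>A phase \<open>i\<close> is transient iff the expected number \<open>\<Sum>t. (B ^ t) i i\<close> of visits to \<open>i\<close>,
  starting in \<open>i\<close>, is finite.\<close>

definition dph_params :: "nat \<Rightarrow> real vec \<Rightarrow> real mat \<Rightarrow> bool" where
  "dph_params n \<alpha> B \<longleftrightarrow>
     \<alpha> \<in> carrier_vec n \<and> B \<in> carrier_mat n n
     \<and> (\<forall>i<n. vec_index \<alpha> i \<ge> 0) \<and> (\<Sum>i<n. vec_index \<alpha> i) = 1
     \<and> (\<forall>i<n. \<forall>j<n. B $$ (i, j) \<ge> 0) \<and> (\<forall>i<n. (\<Sum>j<n. B $$ (i, j)) \<le> 1)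
     \<and> (\<forall>i<n. summable (\<lambda>t. (B ^\<^sub>m t) $$ (i, i)))"

text \<open>\<open>Some i\<close> is the transient phase \<open>i\<close>, \<open>None\<close> is the absorbing state.\<close>

fun dph_start :: "real vec \<Rightarrow> nat option \<Rightarrow> real" where
  "dph_start \<alpha> (Some i) = vec_index \<alpha> i"
| "dph_start \<alpha> None = 0"

fun dph_step :: "nat \<Rightarrow> real mat \<Rightarrow> nat option \<Rightarrow> nat option \<Rightarrow> real" where
  "dph_step n B (Some i) (Some j) = B $$ (i, j)"
| "dph_step n B (Some i) None = vec_index (exit_vec n B) i"
| "dph_step n B None (Some j) = 0"
| "dph_step n B None None = 1"

text \<open>The path space \<open>nat \<Rightarrow> nat option\<close> carries every such chain, so fixing this type
  for the auxiliary probability space is no restriction.\<close>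

definition dph_distributed ::
  "'w measure \<Rightarrow> ('w \<Rightarrow> nat) \<Rightarrow> nat \<Rightarrow> real vec \<Rightarrow> real mat \<Rightarrow> bool" where
  "dph_distributed M T n \<alpha> B \<longleftrightarrow>
     (\<exists>(Q :: (nat \<Rightarrow> nat option) measure) X.
        markov_chain Q X (insert None (Some ` {..<n})) (dph_start \<alpha>) (dph_step n B)
        \<and> distr M (count_space UNIV) T = distr Q (count_space UNIV) (\<lambda>\<omega>. LEAST t. X t \<omega> = None))"


section \<open>Sample paths of the dual-queue system\<close>

text \<open>Packets are numbered \<open>0, 1, 2, \<dots>\<close> in order of generation; \<open>x m n\<close> is the service time
  which packet \<open>n\<close> requires if it is served by server \<open>m\<close>. The component \<open>free m\<close> of the state is
  the first slot at which server \<open>m\<close> is available. The system starts empty at slot 0.\<close>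

datatype server = S1 | S2

definition launch ::
  "server \<Rightarrow> (server \<Rightarrow> nat \<Rightarrow> nat) \<Rightarrow> nat \<Rightarrow> nat \<Rightarrow> (server \<Rightarrow> nat) \<Rightarrow> nat \<times> server \<times> (server \<Rightarrow> nat)"
  where
  "launch prio x n t free =
     (let m = (if free S1 \<le> t \<and> free S2 \<le> t then prio else if free S1 \<le> t then S1 else S2)
      in (t, m, free(m := t + x m n)))"

primrec history ::
  "nat \<Rightarrow> server \<Rightarrow> (server \<Rightarrow> nat \<Rightarrow> nat) \<Rightarrow> nat \<Rightarrow> nat \<times> server \<times> (server \<Rightarrow> nat)" where
  "history k prio x 0 = launch prio x 0 0 (\<lambda>_. 0)"
| "history k prio x (Suc n) =
     (case history k prio x n of (g, _, free) \<Rightarrow>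
        launch prio x (Suc n) (LEAST t. g + k \<le> t \<and> (\<exists>m. free m \<le> t)) free)"

definition gen_slot :: "nat \<Rightarrow> server \<Rightarrow> (server \<Rightarrow> nat \<Rightarrow> nat) \<Rightarrow> nat \<Rightarrow> nat" where
  "gen_slot k prio x n = fst (history k prio x n)"

definition server_of :: "nat \<Rightarrow> server \<Rightarrow> (server \<Rightarrow> nat \<Rightarrow> nat) \<Rightarrow> nat \<Rightarrow> server" where
  "server_of k prio x n = fst (snd (history k prio x n))"

definition rec_slot :: "nat \<Rightarrow> server \<Rightarrow> (server \<Rightarrow> nat \<Rightarrow> nat) \<Rightarrow> nat \<Rightarrow> nat" where
  "rec_slot k prio x n = gen_slot k prio x n + x (server_of k prio x n) n"

definition up_to_date :: "nat \<Rightarrow> server \<Rightarrow> (server \<Rightarrow> nat \<Rightarrow> nat) \<Rightarrow> nat \<Rightarrow> bool" where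
  "up_to_date k prio x n \<longleftrightarrow>
     (\<forall>i. i \<noteq> n \<and> rec_slot k prio x i \<le> rec_slot k prio x n
        \<longrightarrow> gen_slot k prio x i < gen_slot k prio x n)"

text \<open>For up-to-date packets the orders of generation and of reception coincide, so they may be
  enumerated by packet number. The enumeration starts at 0.\<close>

definition utd_gen :: "nat \<Rightarrow> server \<Rightarrow> (server \<Rightarrow> nat \<Rightarrow> nat) \<Rightarrow> nat \<Rightarrow> nat" where
  "utd_gen k prio x n = gen_slot k prio x (enumerate {i. up_to_date k prio x i} n)"

definition utd_rec :: "nat \<Rightarrow> server \<Rightarrow> (server \<Rightarrow> nat \<Rightarrow> nat) \<Rightarrow> nat \<Rightarrow> nat" where
  "utd_rec k prio x n = rec_slot k prio x (enumerate {i. up_to_date k prio x i} n)"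

text \<open>Cycle \<open>n\<close>, for \<open>n \<ge> 1\<close>, is the set of slots from \<open>utd_rec (n - 1)\<close> to \<open>utd_rec n - 1\<close>.\<close>

definition aoi :: "nat \<Rightarrow> server \<Rightarrow> (server \<Rightarrow> nat \<Rightarrow> nat) \<Rightarrow> nat \<Rightarrow> nat" where
  "aoi k prio x t =
     t - utd_gen k prio x (THE n. utd_rec k prio x n \<le> t \<and> t < utd_rec k prio x (Suc n))"

definition peak_aoi :: "nat \<Rightarrow> server \<Rightarrow> (server \<Rightarrow> nat \<Rightarrow> nat) \<Rightarrow> nat \<Rightarrow> nat" where
  "peak_aoi k prio x n = Max (aoi k prio x ` {utd_rec k prio x (n - 1) ..< utd_rec k prio x n})"

lemma peak_aoi_eq:
  assumes mono: "strict_mono (utd_rec k prio x)" and n: "n \<ge> 1"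
  shows "peak_aoi k prio x n = utd_rec k prio x n - 1 - utd_gen k prio x (n - 1)"
proof -
  let ?r = "utd_rec k prio x" and ?g = "utd_gen k prio x (n - 1)"
  have lt: "?r (n - 1) < ?r n"
    using mono n by (simp add: strict_mono_less)
  have aoi: "aoi k prio x t = t - ?g" if t: "?r (n - 1) \<le> t" "t < ?r n" for t
  proof -
    have "(THE i. ?r i \<le> t \<and> t < ?r (Suc i)) = n - 1"
    proof (rule the_equality)
      fix i assume i: "?r i \<le> t \<and> t < ?r (Suc i)"
      have "?r i < ?r n" "?r (n - 1) < ?r (Suc i)"
        using i t by linarith+
      then have "i < n" "n - 1 < Suc i"
        using mono by (simp_all add: strict_mono_less)
      then show "i = n - 1" by linarith
    qed (use t n in simp)
    then show ?thesis by (simp add: aoi_def)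
  qed
  show ?thesis
    unfolding peak_aoi_def
  proof (rule Max_eqI)
    fix y assume "y \<in> aoi k prio x ` {?r (n - 1)..<?r n}"
    then obtain t where "?r (n - 1) \<le> t" "t < ?r n" "y = t - ?g"
      using aoi by auto
    then show "y \<le> ?r n - 1 - ?g" by linarith
  next
    have "?r (n - 1) \<le> ?r n - 1" "?r n - 1 < ?r n" using lt by linarith+
    then show "?r n - 1 - ?g \<in> aoi k prio x ` {?r (n - 1)..<?r n}"
      using aoi[of "?r n - 1"] by (intro image_eqI[of _ _ "?r n - 1"]) auto
  qed simp
qed

definition peak_aoi_prob ::
  "'w measure \<Rightarrow> nat \<Rightarrow> server \<Rightarrow> (server \<Rightarrow> nat \<Rightarrow> 'w \<Rightarrow> nat) \<Rightarrow> nat \<Rightarrow> nat \<Rightarrow> real" where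
  "peak_aoi_prob M k prio T h n =
     measure M {\<omega> \<in> space M. peak_aoi k prio (\<lambda>m i. T m i \<omega>) n = h}"


section \<open>The Markov chains\<close>

text \<open>The constructor number is the class number. Phases of idle servers, and the freezing clock
  in class 8, which are constant in the tuple notation, are omitted: e.g. \<open>Y5 i l\<close> is the
  state (5, i, 0, l), and \<open>R3 j l\<close> is the state (3, 0, j, l) of the recurrent chain.\<close>

datatype ystate =
    Y1 nat nat nat | Y2 nat nat nat | Y3 nat nat nat | Y4 nat nat nat
  | Y5 nat nat | Y6 nat nat | Y7 nat | Y8 nat nat | Y9 nat nat | Y10 nat nat
  | Y11 nat nat nat | Y12 nat nat nat | Y13 nat nat | Y14 nat nat | Y15 | Y16

datatype rstate = R1 nat | R2 nat nat | R3 nat nat | R4 nat nat nat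

locale dual_queue =
  fixes k :: nat
    and prio :: server
    and N :: "server \<Rightarrow> nat"
    and \<alpha> :: "server \<Rightarrow> real vec"
    and B :: "server \<Rightarrow> real mat"
begin

abbreviation "a1 i \<equiv> vec_index (\<alpha> S1) i"
abbreviation "a2 j \<equiv> vec_index (\<alpha> S2) j"
abbreviation "B1 i i' \<equiv> B S1 $$ (i, i')"
abbreviation "B2 j j' \<equiv> B S2 $$ (j, j')"
abbreviation "b1 i \<equiv> vec_index (exit_vec (N S1) (B S1)) i"
abbreviation "b2 j \<equiv> vec_index (exit_vec (N S2) (B S2)) j"

text \<open>Indicators for the evolution \<open>l \<rightarrow> l'\<close> of the freezing clock: the clock is running; it has
  expired and is reset by a new packet; it runs or, both servers remaining busy, stays expired.\<close>

abbreviation "run l l' \<equiv> (of_bool (l < k - 1 \<and> l' = l + 1) :: real)"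
abbreviation "reset l l' \<equiv> (of_bool (l = k - 1 \<and> l' = 0) :: real)"
abbreviation "hold l l' \<equiv> (of_bool (l' = min (l + 1) (k - 1)) :: real)"

fun to_F :: "nat \<Rightarrow> real \<Rightarrow> ystate \<Rightarrow> real" where
  "to_F l w (Y7 l') = run l l' * w"
| "to_F l w (Y13 i' l') = of_bool (prio = S1) * reset l l' * (w * a1 i')"
| "to_F l w (Y14 j' l') = of_bool (prio = S2) * reset l l' * (w * a2 j')"
| "to_F l w _ = 0"

primrec y_step :: "ystate \<Rightarrow> ystate \<Rightarrow> real" where
  "y_step (Y1 i j l) = (\<lambda>s. to_F l (b1 i * b2 j) s + (case s of
      Y10 j' l' \<Rightarrow> run l l' * (b1 i * B2 j j')
    | Y11 i' j' l' \<Rightarrow> reset l l' * (b1 i * B2 j j' * a1 i')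
    | Y5 i' l' \<Rightarrow> run l l' * (b2 j * B1 i i')
    | Y2 i' j' l' \<Rightarrow> reset l l' * (b2 j * B1 i i' * a2 j')
    | Y1 i' j' l' \<Rightarrow> hold l l' * (B1 i i' * B2 j j')
    | _ \<Rightarrow> 0))"
| "y_step (Y2 i j l) = (\<lambda>s. case s of
      Y14 j' l' \<Rightarrow> run l l' * (b1 i * B2 j j')
    | Y8 i' j' \<Rightarrow> of_bool (l = k - 1) * (b1 i * B2 j j' * a1 i')
    | Y2 i' j' l' \<Rightarrow> hold l l' * (B1 i i' * B2 j j')
    | Y16 \<Rightarrow> b2 j
    | _ \<Rightarrow> 0)"
| "y_step (Y3 i j l) = (\<lambda>s. case s of
      Y13 i' l' \<Rightarrow> run l l' * (b2 j * B1 i i')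
    | Y8 i' j' \<Rightarrow> of_bool (l = k - 1) * (b2 j * B1 i i' * a2 j')
    | Y3 i' j' l' \<Rightarrow> hold l l' * (B1 i i' * B2 j j')
    | Y16 \<Rightarrow> b1 i
    | _ \<Rightarrow> 0)"
| "y_step (Y4 i j l) = (\<lambda>s. to_F l (b1 i * b2 j) s + (case s of
      Y6 j' l' \<Rightarrow> run l l' * (b1 i * B2 j j')
    | Y3 i' j' l' \<Rightarrow> reset l l' * (b1 i * B2 j j' * a1 i')
    | Y9 i' l' \<Rightarrow> run l l' * (b2 j * B1 i i')
    | Y12 i' j' l' \<Rightarrow> reset l l' * (b2 j * B1 i i' * a2 j')
    | Y4 i' j' l' \<Rightarrow> hold l l' * (B1 i i' * B2 j j')
    | _ \<Rightarrow> 0))"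
| "y_step (Y5 i l) = (\<lambda>s. to_F l (b1 i) s + (case s of
      Y5 i' l' \<Rightarrow> run l l' * B1 i i'
    | Y2 i' j' l' \<Rightarrow> reset l l' * (B1 i i' * a2 j')
    | _ \<Rightarrow> 0))"
| "y_step (Y6 j l) = (\<lambda>s. to_F l (b2 j) s + (case s of
      Y6 j' l' \<Rightarrow> run l l' * B2 j j'
    | Y3 i' j' l' \<Rightarrow> reset l l' * (B2 j j' * a1 i')
    | _ \<Rightarrow> 0))"
| "y_step (Y7 l) = to_F l 1"
| "y_step (Y8 i j) = (\<lambda>s. case s of
      Y15 \<Rightarrow> b1 i + b2 j - b1 i * b2 j
    | Y8 i' j' \<Rightarrow> B1 i i' * B2 j j'
    | _ \<Rightarrow> 0)"
| "y_step (Y9 i l) = (\<lambda>s. to_F l (b1 i) s + (case s of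
      Y9 i' l' \<Rightarrow> run l l' * B1 i i'
    | Y12 i' j' l' \<Rightarrow> reset l l' * (B1 i i' * a2 j')
    | _ \<Rightarrow> 0))"
| "y_step (Y10 j l) = (\<lambda>s. to_F l (b2 j) s + (case s of
      Y10 j' l' \<Rightarrow> run l l' * B2 j j'
    | Y11 i' j' l' \<Rightarrow> reset l l' * (B2 j j' * a1 i')
    | _ \<Rightarrow> 0))"
| "y_step (Y11 i j l) = (\<lambda>s. case s of
      Y15 \<Rightarrow> b1 i
    | Y13 i' l' \<Rightarrow> run l l' * (b2 j * B1 i i')
    | Y8 i' j' \<Rightarrow> of_bool (l = k - 1) * (b2 j * B1 i i' * a2 j')
    | Y11 i' j' l' \<Rightarrow> hold l l' * (B1 i i' * B2 j j')
    | _ \<Rightarrow> 0)"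
| "y_step (Y12 i j l) = (\<lambda>s. case s of
      Y15 \<Rightarrow> b2 j
    | Y14 j' l' \<Rightarrow> run l l' * (b1 i * B2 j j')
    | Y8 i' j' \<Rightarrow> of_bool (l = k - 1) * (b1 i * B2 j j' * a1 i')
    | Y12 i' j' l' \<Rightarrow> hold l l' * (B1 i i' * B2 j j')
    | _ \<Rightarrow> 0)"
| "y_step (Y13 i l) = (\<lambda>s. case s of
      Y15 \<Rightarrow> b1 i
    | Y13 i' l' \<Rightarrow> run l l' * B1 i i'
    | Y8 i' j' \<Rightarrow> of_bool (l = k - 1) * (B1 i i' * a2 j')
    | _ \<Rightarrow> 0)"
| "y_step (Y14 j l) = (\<lambda>s. case s of
      Y15 \<Rightarrow> b2 j
    | Y14 j' l' \<Rightarrow> run l l' * B2 j j'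
    | Y8 i' j' \<Rightarrow> of_bool (l = k - 1) * (B2 j j' * a1 i')
    | _ \<Rightarrow> 0)"
| "y_step Y15 = (\<lambda>s. of_bool (s = Y15))"
| "y_step Y16 = (\<lambda>s. of_bool (s = Y16))"

text \<open>The transient states, in the order in which they index vectors and matrices.\<close>

definition y_states :: "ystate list" where
  "y_states =
     [Y1 i j l. i \<leftarrow> [0..<N S1], j \<leftarrow> [0..<N S2], l \<leftarrow> [0..<k]] @
     [Y2 i j l. i \<leftarrow> [0..<N S1], j \<leftarrow> [0..<N S2], l \<leftarrow> [0..<k]] @
     [Y3 i j l. i \<leftarrow> [0..<N S1], j \<leftarrow> [0..<N S2], l \<leftarrow> [0..<k]] @
     [Y4 i j l. i \<leftarrow> [0..<N S1], j \<leftarrow> [0..<N S2], l \<leftarrow> [0..<k]] @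
     [Y5 i l. i \<leftarrow> [0..<N S1], l \<leftarrow> [0..<k]] @
     [Y6 j l. j \<leftarrow> [0..<N S2], l \<leftarrow> [0..<k]] @
     [Y7 l. l \<leftarrow> [0..<k]] @
     [Y8 i j. i \<leftarrow> [0..<N S1], j \<leftarrow> [0..<N S2]] @
     [Y9 i l. i \<leftarrow> [0..<N S1], l \<leftarrow> [0..<k]] @
     [Y10 j l. j \<leftarrow> [0..<N S2], l \<leftarrow> [0..<k]] @
     [Y11 i j l. i \<leftarrow> [0..<N S1], j \<leftarrow> [0..<N S2], l \<leftarrow> [0..<k]] @
     [Y12 i j l. i \<leftarrow> [0..<N S1], j \<leftarrow> [0..<N S2], l \<leftarrow> [0..<k]] @
     [Y13 i l. i \<leftarrow> [0..<N S1], l \<leftarrow> [0..<k]] @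
     [Y14 j l. j \<leftarrow> [0..<N S2], l \<leftarrow> [0..<k]]"

definition y_dim :: nat where
  "y_dim = k * (6 * N S1 * N S2 + 3 * (N S1 + N S2) + 1) + N S1 * N S2"

lemma length_y_states: "length y_states = y_dim"
  by (simp add: y_states_def y_dim_def length_concat comp_def sum_list_triv algebra_simps)

definition A_mat :: "real mat" where
  "A_mat = Matrix.mat y_dim y_dim (\<lambda>(r, c). y_step (y_states ! r) (y_states ! c))"

definition c_succ :: "real vec" where
  "c_succ = Matrix.vec y_dim (\<lambda>r. y_step (y_states ! r) Y15)"

fun to_F_R :: "nat \<Rightarrow> real \<Rightarrow> rstate \<Rightarrow> real" where
  "to_F_R l w (R1 l') = run l l' * w"
| "to_F_R l w (R2 i' l') = of_bool (prio = S1) * reset l l' * (w * a1 i')"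
| "to_F_R l w (R3 j' l') = of_bool (prio = S2) * reset l l' * (w * a2 j')"
| "to_F_R l w _ = 0"

primrec r_step :: "rstate \<Rightarrow> rstate \<Rightarrow> real" where
  "r_step (R1 l) = to_F_R l 1"
| "r_step (R2 i l) = (\<lambda>s. to_F_R l (b1 i) s + (case s of
      R2 i' l' \<Rightarrow> run l l' * B1 i i'
    | R4 i' j' l' \<Rightarrow> reset l l' * (B1 i i' * a2 j')
    | _ \<Rightarrow> 0))"
| "r_step (R3 j l) = (\<lambda>s. to_F_R l (b2 j) s + (case s of
      R3 j' l' \<Rightarrow> run l l' * B2 j j'
    | R4 i' j' l' \<Rightarrow> reset l l' * (B2 j j' * a1 i')
    | _ \<Rightarrow> 0))"
| "r_step (R4 i j l) = (\<lambda>s. to_F_R l (b1 i * b2 j) s + (case s of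
      R3 j' l' \<Rightarrow> run l l' * (b1 i * B2 j j')
    | R2 i' l' \<Rightarrow> run l l' * (b2 j * B1 i i')
    | R4 i' j' l' \<Rightarrow> reset l l' * (b1 i * B2 j j' * a1 i')
        + reset l l' * (b2 j * B1 i i' * a2 j')
        + hold l l' * (B1 i i' * B2 j j')
    | _ \<Rightarrow> 0))"

definition r_states :: "rstate set" where
  "r_states = {R1 l | l. l < k} \<union> {R2 i l | i l. i < N S1 \<and> l < k}
     \<union> {R3 j l | j l. j < N S2 \<and> l < k} \<union> {R4 i j l | i j l. i < N S1 \<and> j < N S2 \<and> l < k}"

definition stationary :: "rstate pmf \<Rightarrow> bool" where
  "stationary p \<longleftrightarrow> set_pmf p \<subseteq> r_states
     \<and> (\<forall>s\<in>r_states. pmf p s = (\<Sum>s'\<in>r_states. pmf p s' * r_step s' s))"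

definition \<omega>_idle :: "rstate pmf \<Rightarrow> real" where
  "\<omega>_idle p = pmf p (R1 (k - 1))
     + (\<Sum>i<N S1. b1 i * pmf p (R2 i (k - 1)))
     + (\<Sum>j<N S2. b2 j * pmf p (R3 j (k - 1)))
     + (\<Sum>i<N S1. \<Sum>j<N S2. b1 i * b2 j * pmf p (R4 i j (k - 1)))"

fun q_init :: "rstate pmf \<Rightarrow> ystate \<Rightarrow> real" where
  "q_init p (Y1 i' j' l) = of_bool (l = 0) *
     ((\<Sum>j<N S2. B2 j j' * a1 i' * pmf p (R3 j (k - 1)))
      + (\<Sum>i<N S1. \<Sum>j<N S2. b1 i * B2 j j' * a1 i' * pmf p (R4 i j (k - 1))))"
| "q_init p (Y4 i' j' l) = of_bool (l = 0) *
     ((\<Sum>i<N S1. B1 i i' * a2 j' * pmf p (R2 i (k - 1)))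
      + (\<Sum>i<N S1. \<Sum>j<N S2. b2 j * B1 i i' * a2 j' * pmf p (R4 i j (k - 1))))"
| "q_init p (Y5 i' l) = of_bool (prio = S1 \<and> l = 0) * (a1 i' * \<omega>_idle p)"
| "q_init p (Y6 j' l) = of_bool (prio = S2 \<and> l = 0) * (a2 j' * \<omega>_idle p)"
| "q_init p _ = 0"

definition sigma :: "rstate pmf \<Rightarrow> real vec" where
  "sigma p = Matrix.vec y_dim (\<lambda>r. q_init p (y_states ! r) / (\<Sum>c<y_dim. q_init p (y_states ! c)))"

end

end

theory Submission
  imports Defs "Jordan_Normal_Form.Determinant"
begin

text \<open>The quotient is a ratio of two rates per slot. If packet \<open>i\<close> is up to date,
  the cycle it opens has peak \<open>h\<close> exactly when the first reception of a later packet
  happens at slot \<open>gen x i + h + 1\<close> (\<open>peak_eq_iff\<close>). Let v be the long-run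
  rate at which up-to-date packets with this property are generated, and d the rate for all
  up-to-date packets. A fraction v / d of the cycles then has peak h, and as the probabilities
  converge by assumption, v / d is their limit.

  Both rates come from the stationary chain W. In a stationary slot, the probability that a packet
  is generated and starts Y in state y is the unnormalised weight \<open>q_init p y\<close>
  (\<open>sum_gam\<close>). From y, the packet succeeds with the first later reception in step h + 1
  with probability (A^h c)(y). Writing q for the row vector of these weights, v = q A^h c and d = q
  (I - A)^(-1) c, the sum of q A^h c over all h (\<open>gsuc_eq\<close>). Since q c = 0, the latter
  is also q A (I - A)^(-1) c, and the normalisation of q to sigma cancels in the quotient.

  The service phases are not random variables on the given probability space; only the laws of the
  service times are given. The proof therefore works with what can be seen, the completions of each
  slot. For a list of observed completions, the functional \<open>Z\<close> is the unnormalised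
  conditional expectation over the phases that a hidden chain would have. One slot moves a kernel
  from the weights to the test function (\<open>pair_nxt\<close>), and \<open>obs_law\<close> shows
  that \<open>Z\<close> computes true probabilities. With \<open>Aop_emb\<close> and
  \<open>csuc_emb\<close>, which match completions to transitions of Y, the probabilities of future
  success given the past become powers of A and of W (\<open>prob_succ_at\<close>,
  \<open>prob_launched\<close>).

  Uniqueness of the stationary distribution yields convergence of Cesaro averages
  (\<open>cesaro_unique_stationary\<close>), which is enough for expected counts
  (\<open>Z_mean\<close>). Peaks are indexed by cycles, though, and the number of up-to-date packets
  generated up to slot t is random. A weak law (\<open>weak_law_cesaro\<close>,
  \<open>hit_weak_law\<close>) shows that it is d t + o(t) in mean, so it may be replaced by the
  integer part of d t (\<open>peaks_mean\<close>, \<open>peak_limit\<close>). The weak law asks for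
  events settled within a bounded time; success is therefore truncated at H steps. The error is
  controlled by the packets with no later reception within H slots, whose rate tends to 0 as H
  grows.

  Nothing degenerates: \<open>Aop_fixpoint\<close> solves u = A u class by class and finds only u =
  0, hence I - A is invertible and A^t 1 tends to 0; packets are generated at a positive rate
  (\<open>qtot_pos\<close>); and of two consecutive packets at least one is up to date
  (\<open>utd_or_utd_Suc\<close>), so d is at least half that rate (\<open>qtot_le\<close>).\<close>

type_synonym serving = "(nat \<times> nat) option"
text \<open>\<open>Some (j, a)\<close> is packet \<open>j\<close> after \<open>a\<close> slots of
  service; a configuration lists the number of the next packet, the two servings and the freezing
  clock. It records what an observer of completions knows. Phases are kept out of it and enter
  through a \<open>wfun\<close>, a function of the two phases (\<open>None\<close> for idle) and the
  clock.\<close>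

type_synonym config = "nat \<times> serving \<times> serving \<times> nat"
type_synonym wfun = "nat option \<Rightarrow> nat option \<Rightarrow> nat \<Rightarrow> real"

section \<open>Observed configurations and hidden phases: one slot in dual form\<close>

context dual_queue
begin

abbreviation "aS m i \<equiv> vec_index (\<alpha> m) i"
abbreviation "BS m i j \<equiv> B m $$ (i, j)"
abbreviation "bS m i \<equiv> vec_index (exit_vec (N m) (B m)) i"

text \<open>The row vector alpha B^a: the mass in phase \<open>i\<close> of a service that has not
  ended after \<open>a\<close> slots.\<close>

primrec urow :: "server \<Rightarrow> nat \<Rightarrow> nat \<Rightarrow> real" where
  "urow m 0 i = aS m i"
| "urow m (Suc a) i' = (\<Sum>i<N m. urow m a i * BS m i i')"

text \<open>Integral of \<open>g\<close> over the hidden phase. The weights stay unnormalised: their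
  total is the probability that the service exceeds \<open>a\<close> slots, so no division by the
  probability of the past is needed.\<close>

definition ev :: "server \<Rightarrow> serving \<Rightarrow> (nat option \<Rightarrow> real) \<Rightarrow> real" where
  "ev m s g = (case s of None \<Rightarrow> g None | Some (j, a) \<Rightarrow> \<Sum>i<N m. urow m a i * g (Some i))"

definition adv :: "serving \<Rightarrow> bool \<Rightarrow> serving" where
  "adv s c = (if c then None else map_option (\<lambda>(j, a). (j, Suc a)) s)"

text \<open>Only a completion costs a factor; the loss of mass in a slot without completion is
  already contained in the next \<open>urow\<close>.\<close>

definition fac :: "server \<Rightarrow> serving \<Rightarrow> bool \<Rightarrow> real" where
  "fac m s c = (if c then (case s of None \<Rightarrow> 0 | Some (j, a) \<Rightarrow> \<Sum>i<N m. urow m a i * bS m i) else 1)"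

text \<open>One slot of a single server, restricted to the outcome \<open>c\<close>. An idle server
  cannot complete, hence the 0.\<close>

definition Tc :: "server \<Rightarrow> bool \<Rightarrow> (nat option \<Rightarrow> real) \<Rightarrow> nat option \<Rightarrow> real" where
  "Tc m c g p = (case p of None \<Rightarrow> if c then 0 else g None
     | Some i \<Rightarrow> if c then bS m i * g None else \<Sum>i'<N m. BS m i i' * g (Some i'))"

definition S1_first :: bool where
  "S1_first \<longleftrightarrow> prio = S1"

lemma prio_iff: "prio = S1 \<longleftrightarrow> S1_first" "prio = S2 \<longleftrightarrow> \<not> S1_first"
  using server.exhaust[of prio] by (auto simp only: S1_first_def server.distinct)

definition launch1 :: "'a option \<Rightarrow> 'b option \<Rightarrow> bool" where
  "launch1 p1 p2 \<longleftrightarrow> p1 = None \<and> (p2 \<noteq> None \<or> S1_first)"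

definition waits :: "nat \<Rightarrow> 'a option \<Rightarrow> 'b option \<Rightarrow> bool" where
  "waits l p1 p2 \<longleftrightarrow> l < k - 1 \<or> p1 \<noteq> None \<and> p2 \<noteq> None"

definition relaunch :: "nat \<Rightarrow> serving \<Rightarrow> serving \<Rightarrow> nat \<Rightarrow> config" where
  "relaunch n s1 s2 l =
     (if waits l s1 s2 then (n, s1, s2, min (l + 1) (k - 1))
      else if launch1 s1 s2 then (Suc n, Some (n, 0), s2, 0)
      else (Suc n, s1, Some (n, 0), 0))"

fun nxt :: "config \<Rightarrow> bool \<times> bool \<Rightarrow> config" where
  "nxt (n, s1, s2, l) (c1, c2) = relaunch n (adv s1 c1) (adv s2 c2) l"

fun pair :: "config \<Rightarrow> wfun \<Rightarrow> real" where
  "pair (n, s1, s2, l) f = ev S1 s1 (\<lambda>p1. ev S2 s2 (\<lambda>p2. f p1 p2 l))"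

fun facs :: "config \<Rightarrow> bool \<times> bool \<Rightarrow> real" where
  "facs (n, s1, s2, l) (c1, c2) = fac S1 s1 c1 * fac S2 s2 c2"

text \<open>The action of \<open>relaunch\<close> on test functions: the phase of a packet just
  launched is integrated over its initial distribution.\<close>

definition Lop :: "wfun \<Rightarrow> nat \<Rightarrow> nat option \<Rightarrow> nat option \<Rightarrow> real" where
  "Lop f l p1 p2 =
     (if waits l p1 p2 then f p1 p2 (min (l + 1) (k - 1))
      else if launch1 p1 p2 then \<Sum>i<N S1. a1 i * f (Some i) p2 0
      else \<Sum>j<N S2. a2 j * f p1 (Some j) 0)"

fun Kc :: "bool \<times> bool \<Rightarrow> wfun \<Rightarrow> wfun" where
  "Kc (c1, c2) f p1 p2 l = Tc S1 c1 (\<lambda>p1'. Tc S2 c2 (\<lambda>p2'. Lop f l p1' p2') p2) p1"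

text \<open>Adjointness: (alpha B^a) B g can be read as the next row vector against \<open>g\<close>
  or as the old one against B g; on completion the exit vector takes the place of B.\<close>

lemma ev_adv: "fac m s c * ev m (adv s c) g = ev m s (Tc m c g)"
proof (cases s)
  case (Some ja)
  obtain j a where s: "s = Some (j, a)" using Some by (cases ja) auto
  show ?thesis
  proof (cases c)
    case False
    have "(\<Sum>i<N m. (\<Sum>i'<N m. urow m a i' * BS m i' i) * g (Some i))
        = (\<Sum>i<N m. \<Sum>i'<N m. urow m a i' * BS m i' i * g (Some i))"
      by (simp add: sum_distrib_right)
    also have "\<dots> = (\<Sum>i'<N m. \<Sum>i<N m. urow m a i' * BS m i' i * g (Some i))"
      by (rule sum.swap)
    finally show ?thesis using False
      by (simp add: s fac_def ev_def adv_def Tc_def sum_distrib_left mult.assoc)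
  qed (simp add: s fac_def ev_def adv_def Tc_def sum_distrib_right mult.assoc)
qed (simp add: fac_def ev_def adv_def Tc_def)

lemma ev_mult: "ev m s (\<lambda>p. x * g p) = x * ev m s g"
  by (auto simp: ev_def sum_distrib_left mult.left_commute split: option.splits)

lemma ev_sum: "ev m s (\<lambda>p. \<Sum>x\<in>X. g x p) = (\<Sum>x\<in>X. ev m s (g x))"
  by (auto simp: ev_def sum_distrib_left intro: sum.swap split: option.splits)

lemma ev_Tc_swap: "ev m s (\<lambda>p. Tc m' c (\<lambda>p'. H p' p) q) = Tc m' c (\<lambda>p'. ev m s (H p')) q"
  by (auto simp: Tc_def ev_mult ev_sum split: option.splits) (simp add: ev_def split: option.splits)

lemma pair_relaunch:
  "pair (relaunch n s1 s2 l) f = ev S1 s1 (\<lambda>p1. ev S2 s2 (\<lambda>p2. Lop f l p1 p2))"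
proof -
  have new: "ev S1 (Some (n, 0)) h = (\<Sum>i<N S1. a1 i * h (Some i))"
    "ev S2 (Some (n, 0)) h = (\<Sum>i<N S2. a2 i * h (Some i))" for h n
    by (simp_all add: ev_def)
  show ?thesis
    by (cases s1; cases s2)
       (auto simp: relaunch_def Lop_def waits_def launch1_def ev_def new sum_distrib_left
          sum_distrib_right ac_simps intro: sum.swap split: if_splits)
qed

text \<open>The filtering step. On the left the observation \<open>c\<close> has updated the weights
  of the hidden phases; on the right it acts as a kernel on the test function. Every conditional
  probability below comes from iterating this.\<close>

lemma pair_nxt: "facs z c * pair (nxt z c) f = pair z (Kc c f)"
proof -
  obtain n s1 s2 l where z: "z = (n, s1, s2, l)" by (cases z)
  obtain c1 c2 where c: "c = (c1, c2)" by (cases c)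
  let ?L = "\<lambda>p1 p2. Lop f l p1 p2"
  have "facs z c * pair (nxt z c) f
      = fac S1 s1 c1 * ev S1 (adv s1 c1) (\<lambda>p1. fac S2 s2 c2 * ev S2 (adv s2 c2) (?L p1))"
    by (simp add: z c pair_relaunch ev_mult)
  also have "\<dots> = ev S1 s1 (Tc S1 c1 (\<lambda>p1. ev S2 s2 (Tc S2 c2 (?L p1))))"
    by (simp only: ev_adv)
  also have "\<dots> = pair z (Kc c f)"
    by (simp add: z c ev_Tc_swap)
  finally show ?thesis .
qed

section \<open>The chain Y relative to a tagged packet\<close>

section \<open>Y\<close>

text \<open>The class is read off by comparing packet numbers with that of the tagged packet
  \<open>i\<close>, which plays P*; a smaller number means generated earlier. The last branch means
  class 12 only where not both packets are older than \<open>i\<close>, which \<open>valid\<close>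
  guarantees.\<close>

definition yst :: "nat \<Rightarrow> serving \<Rightarrow> serving \<Rightarrow> nat option \<Rightarrow> nat option \<Rightarrow> nat \<Rightarrow> ystate" where
  "yst i s1 s2 p1 p2 l =
     (let j1 = fst (the s1); j2 = fst (the s2) in
      case (p1, p2) of
        (None, None) \<Rightarrow> Y7 l
      | (Some a, None) \<Rightarrow> if j1 = i then Y5 a l else if j1 < i then Y9 a l else Y13 a l
      | (None, Some b) \<Rightarrow> if j2 = i then Y6 b l else if j2 < i then Y10 b l else Y14 b l
      | (Some a, Some b) \<Rightarrow>
          if j1 = i then if j2 < i then Y1 a b l else Y2 a b l
          else if j2 = i then if j1 < i then Y4 a b l else Y3 a b l
          else if i < j1 then if i < j2 then Y8 a b else Y11 a b l
          else Y12 a b l)"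

definition ysum :: "(ystate \<Rightarrow> real) \<Rightarrow> real" where
  "ysum f = sum_list (map f y_states)"

lemma ysum_eq: "ysum f =
   (\<Sum>i<N S1. \<Sum>j<N S2. \<Sum>l<k. f (Y1 i j l)) + ((\<Sum>i<N S1. \<Sum>j<N S2. \<Sum>l<k. f (Y2 i j l))
   + ((\<Sum>i<N S1. \<Sum>j<N S2. \<Sum>l<k. f (Y3 i j l)) + ((\<Sum>i<N S1. \<Sum>j<N S2. \<Sum>l<k. f (Y4 i j l))
   + ((\<Sum>i<N S1. \<Sum>l<k. f (Y5 i l)) + ((\<Sum>j<N S2. \<Sum>l<k. f (Y6 j l)) + ((\<Sum>l<k. f (Y7 l))
   + ((\<Sum>i<N S1. \<Sum>j<N S2. f (Y8 i j)) + ((\<Sum>i<N S1. \<Sum>l<k. f (Y9 i l)) + ((\<Sum>j<N S2. \<Sum>l<k. f (Y10 j l))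
   + ((\<Sum>i<N S1. \<Sum>j<N S2. \<Sum>l<k. f (Y11 i j l)) + ((\<Sum>i<N S1. \<Sum>j<N S2. \<Sum>l<k. f (Y12 i j l))
   + ((\<Sum>i<N S1. \<Sum>l<k. f (Y13 i l)) + (\<Sum>j<N S2. \<Sum>l<k. f (Y14 j l))))))))))))))"
proof -
  have concat: "sum_list (map g (concat (map h xs))) = sum_list (map (\<lambda>x. sum_list (map g (h x))) xs)"
    for g :: "'a \<Rightarrow> real" and h :: "nat \<Rightarrow> 'a list" and xs
    by (induction xs) auto
  have upt: "sum_list (map g [0..<n]) = (\<Sum>i<n. g i)" for g :: "nat \<Rightarrow> real" and n
    by (simp add: interv_sum_list_conv_sum_set_nat lessThan_atLeast0)
  show ?thesis
    by (simp add: ysum_def y_states_def concat upt comp_def)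
qed

text \<open>A acting on column vectors, written as functions of the state, so that no indices are
  needed until the matrices of the theorem are reached.\<close>

definition Aop :: "(ystate \<Rightarrow> real) \<Rightarrow> ystate \<Rightarrow> real" where
  "Aop f y = ysum (\<lambda>y'. y_step y y' * f y')"

definition csuc :: "ystate \<Rightarrow> real" where
  "csuc y = y_step y Y15"

end

context dual_queue
begin

definition emb :: "nat \<Rightarrow> config \<Rightarrow> nat option \<Rightarrow> nat option \<Rightarrow> nat \<Rightarrow> ystate" where
  "emb i z = (case z of (n, s1, s2, l) \<Rightarrow> yst i s1 s2)"

definition newer :: "nat \<Rightarrow> serving \<Rightarrow> bool" where
  "newer i s \<longleftrightarrow> (case s of None \<Rightarrow> False | Some (j, a) \<Rightarrow> i < j)"

text \<open>The end of the life of P*: a later packet is received. Y is then absorbed, in 16 if P*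
  was still in service before that slot (\<open>inserv\<close>) and in 15 otherwise.\<close>

fun kill :: "nat \<Rightarrow> config \<Rightarrow> bool \<times> bool \<Rightarrow> bool" where
  "kill i (n, s1, s2, l) (c1, c2) \<longleftrightarrow> c1 \<and> newer i s1 \<or> c2 \<and> newer i s2"

definition serves :: "nat \<Rightarrow> serving \<Rightarrow> bool" where
  "serves i s \<longleftrightarrow> (case s of None \<Rightarrow> False | Some (j, a) \<Rightarrow> j = i)"

definition older :: "nat \<Rightarrow> serving \<Rightarrow> bool" where
  "older i s \<longleftrightarrow> (case s of None \<Rightarrow> False | Some (j, a) \<Rightarrow> j < i)"

fun inserv :: "nat \<Rightarrow> config \<Rightarrow> bool" where
  "inserv i (n, s1, s2, l) \<longleftrightarrow> serves i s1 \<or> serves i s2"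

fun valid :: "nat \<Rightarrow> config \<Rightarrow> bool" where
  "valid i (n, s1, s2, l) \<longleftrightarrow> l < k \<and> i < n \<and> \<not> (older i s1 \<and> older i s2)
     \<and> (\<forall>j a. s1 = Some (j, a) \<or> s2 = Some (j, a) \<longrightarrow> j < n)
     \<and> (\<forall>j a a'. s1 = Some (j, a) \<longrightarrow> s2 \<noteq> Some (j, a'))"

abbreviation matches :: "serving \<Rightarrow> nat option \<Rightarrow> bool" where
  "matches s p \<equiv> (s = None) = (p = None)"

lemma clock_sum:
  "(\<Sum>l'<k. of_bool (P \<and> l' = x) * h l') = (if P \<and> x < k then h x else (0 :: real))"
  "(\<Sum>l'<k. of_bool (l' = x) * h l') = (if x < k then h x else (0 :: real))"
proof -
  show *: "(\<Sum>l'<k. of_bool (l' = x) * h l') = (if x < k then h x else (0 :: real))" for x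
  proof -
    have "(\<Sum>l'<k. of_bool (l' = x) * h l') = (\<Sum>l'<k. if l' = x then h l' else 0)"
      by (rule sum.cong) auto
    then show ?thesis by simp
  qed
  show "(\<Sum>l'<k. of_bool (P \<and> l' = x) * h l') = (if P \<and> x < k then h x else (0 :: real))"
    using * by (cases P) simp_all
qed

lemma mult_of_bool_sum: "(\<Sum>x\<in>X. c * g x) = c * (\<Sum>x\<in>X. g x)" for c :: real
  by (simp add: sum_distrib_left)

text \<open>The four completion patterns of a slot, followed by the launch rule, reproduce row by
  row the transitions of Y among transient states; the patterns left out are those absorbed in 15 or
  16. The proof compares both lists for each position of the two packets relative to
  \<open>i\<close>, each priority and both clock cases.\<close>

lemma Aop_emb:
  assumes "valid i (n, s1, s2, l)" "matches s1 p1" "matches s2 p2"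
  shows "Aop f (emb i (n, s1, s2, l) p1 p2 l) =
    (\<Sum>c\<in>UNIV. if kill i (n, s1, s2, l) c then 0
       else Kc c (\<lambda>q1 q2 l'. f (emb i (nxt (n, s1, s2, l) c) q1 q2 l')) p1 p2 l)"
proof -
  have U: "(UNIV :: (bool \<times> bool) set) = {(True, True), (True, False), (False, True), (False, False)}"
    by auto
  have l: "l < k" using assms by simp
  note defs = U prio_iff emb_def yst_def adv_def Tc_def Lop_def waits_def launch1_def relaunch_def
    newer_def older_def Aop_def ysum_eq mult.assoc mult_of_bool_sum sum.distrib distrib_right clock_sum
  \<comment> \<open>The two clock cases, running and expired, each in both forms in which the
    simplifier meets them.\<close>
  have lk: thesis if "Suc l < k \<Longrightarrow> l < k - Suc 0 \<Longrightarrow> thesis" "\<not> Suc l < k \<Longrightarrow> k - Suc 0 = l \<Longrightarrow> thesis" for thesis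
    using that l by linarith
  note swap = sum.swap[where A = "{..<N S1}" and B = "{..<N S2}"]
  show ?thesis
  proof (cases s1)
    case None
    then have p1: "p1 = None" using assms by simp
    show ?thesis
    proof (cases s2)
      case None
      then have p2: "p2 = None" using assms by simp
      show ?thesis using l assms(1)
        by (cases rule: lk; cases S1_first)
           (simp_all add: defs \<open>s1 = None\<close> \<open>s2 = None\<close> p1 p2 del: sum_of_bool_mult_eq sum_mult_of_bool_eq)
    next
      case (Some q)
      then obtain j a b where s2: "s2 = Some (j, a)" and p2: "p2 = Some b"
        using assms by (cases q; cases p2) auto
      show ?thesis using l assms(1)
        by (cases rule: lk; cases S1_first; cases j i rule: linorder_cases)
           (simp_all add: defs \<open>s1 = None\<close> s2 p1 p2 del: sum_of_bool_mult_eq sum_mult_of_bool_eq,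
            simp_all add: sum_distrib_left ac_simps swap)
    qed
  next
    case (Some q)
    then obtain j a b where s1: "s1 = Some (j, a)" and p1: "p1 = Some b"
      using assms by (cases q; cases p1) auto
    show ?thesis
    proof (cases s2)
      case None
      then have p2: "p2 = None" using assms by simp
      show ?thesis using l assms(1)
        by (cases rule: lk; cases S1_first; cases j i rule: linorder_cases)
           (simp_all add: defs s1 \<open>s2 = None\<close> p1 p2 del: sum_of_bool_mult_eq sum_mult_of_bool_eq)
    next
      case (Some q)
      then obtain j' a' b' where s2: "s2 = Some (j', a')" and p2: "p2 = Some b'"
        using assms by (cases q; cases p2) auto
      show ?thesis using l assms(1)
        by (cases rule: lk; cases S1_first; cases j i rule: linorder_cases; cases j' i rule: linorder_cases)
           (simp_all add: defs s1 s2 p1 p2 del: sum_of_bool_mult_eq sum_mult_of_bool_eq,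
            simp_all add: sum_distrib_left ac_simps swap)
    qed
  qed
qed

text \<open>One slot of W that ends with a generation, followed by \<open>v\<close> at the starting
  state of Y for the new packet; slots without generation contribute 0. The starting class is 5 or 1
  for a launch on S1 and 6 or 4 for one on S2, according to whether the other server is idle or
  busy.\<close>

definition gam :: "(ystate \<Rightarrow> real) \<Rightarrow> wfun" where
  "gam v p1 p2 l = (\<Sum>(c1, c2)\<in>UNIV. Tc S1 c1 (\<lambda>q1. Tc S2 c2 (\<lambda>q2.
     if waits l q1 q2 then 0
     else if launch1 q1 q2 then \<Sum>i<N S1. a1 i * v (case q2 of None \<Rightarrow> Y5 i 0 | Some j \<Rightarrow> Y1 i j 0)
     else \<Sum>j<N S2. a2 j * v (case q1 of None \<Rightarrow> Y6 j 0 | Some i \<Rightarrow> Y4 i j 0)) p2) p1)"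

fun launches :: "config \<Rightarrow> bool \<times> bool \<Rightarrow> bool" where
  "launches (n, s1, s2, l) (c1, c2) \<longleftrightarrow> \<not> waits l (adv s1 c1) (adv s2 c2)"

fun bounded_idx :: "config \<Rightarrow> bool" where
  "bounded_idx (n, s1, s2, l) \<longleftrightarrow> (\<forall>j a. s1 = Some (j, a) \<or> s2 = Some (j, a) \<longrightarrow> j < n)"

lemma Tc_cong:
  assumes "\<And>q. (q = None) = (c \<or> p = None) \<Longrightarrow> g q = h q"
  shows "Tc m c g p = Tc m c h p"
  using assms by (auto simp: Tc_def split: option.splits)

text \<open>The new packet has number \<open>n\<close>, and by \<open>bounded_idx\<close> anything
  else in service is older, so \<open>emb n\<close> can only produce the four starting classes of
  \<open>gam\<close>.\<close>

lemma gam_emb: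
  assumes "bounded_idx (n, s1, s2, l)" "matches s1 p1" "matches s2 p2"
  shows "gam v p1 p2 l = (\<Sum>c\<in>UNIV. if launches (n, s1, s2, l) c
     then Kc c (\<lambda>q1 q2 l'. v (emb n (nxt (n, s1, s2, l) c) q1 q2 l')) p1 p2 l else 0)"
  unfolding gam_def
proof (rule sum.cong[OF refl], clarify)
  fix c1 c2
  have adv: "(adv s c = None) = (c \<or> s = None)" for s c by (simp add: adv_def)
  have idx: "fst (the (adv s1 c1)) < n" if "adv s1 c1 \<noteq> None"
    using assms(1) that by (cases s1) (auto simp: adv_def split: if_splits)
  have idx': "fst (the (adv s2 c2)) < n" if "adv s2 c2 \<noteq> None"
    using assms(1) that by (cases s2) (auto simp: adv_def split: if_splits)
  let ?W = "\<lambda>q1 q2. if waits l q1 q2 then 0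
     else if launch1 q1 q2 then \<Sum>i<N S1. a1 i * v (case q2 of None \<Rightarrow> Y5 i 0 | Some j \<Rightarrow> Y1 i j 0)
     else \<Sum>j<N S2. a2 j * v (case q1 of None \<Rightarrow> Y6 j 0 | Some i \<Rightarrow> Y4 i j 0)"
  let ?V = "\<lambda>q1 q2. if launches (n, s1, s2, l) (c1, c2)
     then Lop (\<lambda>q1 q2 l'. v (emb n (nxt (n, s1, s2, l) (c1, c2)) q1 q2 l')) l q1 q2 else 0"
  have "Tc S1 c1 (\<lambda>q1. Tc S2 c2 (?W q1) p2) p1 = Tc S1 c1 (\<lambda>q1. Tc S2 c2 (?V q1) p2) p1"
  proof (intro Tc_cong)
    fix q1 q2 :: "nat option" assume "(q1 = None) = (c1 \<or> p1 = None)" "(q2 = None) = (c2 \<or> p2 = None)"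
    then have q: "(adv s1 c1 = None) = (q1 = None)" "(adv s2 c2 = None) = (q2 = None)"
      using assms(2,3) by (auto simp: adv)
    show "?W q1 q2 = ?V q1 q2"
      using idx idx' q
      by (cases q1; cases q2)
         (auto simp: Lop_def waits_def launch1_def relaunch_def emb_def yst_def intro!: sum.cong)
  qed
  also have "\<dots> = (if launches (n, s1, s2, l) (c1, c2)
     then Kc (c1, c2) (\<lambda>q1 q2 l'. v (emb n (nxt (n, s1, s2, l) (c1, c2)) q1 q2 l')) p1 p2 l else 0)"
    by (cases "launches (n, s1, s2, l) (c1, c2)") (simp_all add: Tc_def split: option.splits)
  finally show "Tc S1 c1 (\<lambda>q1. Tc S2 c2 (?W q1) p2) p1 = \<dots>" .
qed

section \<open>The recurrent chain W\<close>

definition rst :: "nat option \<Rightarrow> nat option \<Rightarrow> nat \<Rightarrow> rstate" where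
  "rst p1 p2 l = (case (p1, p2) of (None, None) \<Rightarrow> R1 l | (Some i, None) \<Rightarrow> R2 i l
     | (None, Some j) \<Rightarrow> R3 j l | (Some i, Some j) \<Rightarrow> R4 i j l)"

text \<open>With no tagged packet no pattern is absorbed; the sum over all completion patterns is
  the transition operator of W (\<open>r_step_rst\<close>).\<close>

definition Rop :: "wfun \<Rightarrow> wfun" where
  "Rop f p1 p2 l = (\<Sum>c\<in>UNIV. Kc c f p1 p2 l)"

lemma r_states_eq: "r_states = R1 ` {..<k} \<union> (\<lambda>(i, l). R2 i l) ` ({..<N S1} \<times> {..<k})
    \<union> (\<lambda>(j, l). R3 j l) ` ({..<N S2} \<times> {..<k}) \<union> (\<lambda>(i, j, l). R4 i j l) ` ({..<N S1} \<times> {..<N S2} \<times> {..<k})"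
  unfolding r_states_def by (intro arg_cong2[of _ _ _ _ "(\<union>)"]) (auto simp: image_iff)

lemma finite_r_states [simp]: "finite r_states"
  by (simp add: r_states_eq)

lemma sum_r_states: "(\<Sum>w\<in>r_states. g w) = (\<Sum>l<k. g (R1 l)) + (\<Sum>i<N S1. \<Sum>l<k. g (R2 i l))
   + (\<Sum>j<N S2. \<Sum>l<k. g (R3 j l)) + (\<Sum>i<N S1. \<Sum>j<N S2. \<Sum>l<k. g (R4 i j l))"
  for g :: "rstate \<Rightarrow> real"
proof -
  have "sum g r_states = sum g (R1 ` {..<k}) + sum g ((\<lambda>(i, l). R2 i l) ` ({..<N S1} \<times> {..<k}))
    + sum g ((\<lambda>(j, l). R3 j l) ` ({..<N S2} \<times> {..<k})) + sum g ((\<lambda>(i, j, l). R4 i j l) ` ({..<N S1} \<times> {..<N S2} \<times> {..<k}))"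
    unfolding r_states_eq by (subst sum.union_disjoint; auto)+
  then show ?thesis
    by (simp add: sum.reindex inj_on_def sum.cartesian_product case_prod_unfold)
qed

lemma r_step_rst:
  assumes "l < k"
  shows "(\<Sum>w\<in>r_states. r_step (rst p1 p2 l) w * F w) = Rop (\<lambda>q1 q2 l'. F (rst q1 q2 l')) p1 p2 l"
proof -
  have U: "(UNIV :: (bool \<times> bool) set) = {(True, True), (True, False), (False, True), (False, False)}"
    by auto
  note defs = U prio_iff Rop_def Tc_def Lop_def waits_def launch1_def rst_def sum_r_states
    mult.assoc mult_of_bool_sum sum.distrib distrib_right clock_sum
  have lk: thesis if "Suc l < k \<Longrightarrow> l < k - Suc 0 \<Longrightarrow> thesis" "\<not> Suc l < k \<Longrightarrow> k - Suc 0 = l \<Longrightarrow> thesis" for thesis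
    using that assms by linarith
  note swap = sum.swap[where A = "{..<N S1}" and B = "{..<N S2}"]
  show ?thesis using assms
    by (cases rule: lk; cases S1_first; cases p1; cases p2)
       (simp_all add: defs del: sum_of_bool_mult_eq sum_mult_of_bool_eq,
        simp_all add: sum_distrib_left ac_simps swap)
qed

primrec at_rst :: "wfun \<Rightarrow> rstate \<Rightarrow> real" where
  "at_rst f (R1 l) = f None None l"
| "at_rst f (R2 i l) = f (Some i) None l"
| "at_rst f (R3 j l) = f None (Some j) l"
| "at_rst f (R4 i j l) = f (Some i) (Some j) l"

end

section \<open>Phase-type parameters and the exit to state 15\<close>

locale stable_queue = dual_queue +
  assumes k_ge: "1 \<le> k"
    and dph: "\<And>m. dph_params (N m) (\<alpha> m) (B m)"
begin

lemma alpha_nonneg: "i < N m \<Longrightarrow> 0 \<le> aS m i"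
  and alpha_sum: "(\<Sum>i<N m. aS m i) = 1"
  and B_nonneg: "i < N m \<Longrightarrow> j < N m \<Longrightarrow> 0 \<le> BS m i j"
  and B_summable: "i < N m \<Longrightarrow> summable (\<lambda>t. (B m ^\<^sub>m t) $$ (i, i))"
  and B_carrier: "B m \<in> carrier_mat (N m) (N m)"
  using dph[of m] by (auto simp: dph_params_def)

lemma b_eq: "i < N m \<Longrightarrow> bS m i = 1 - (\<Sum>j<N m. BS m i j)"
proof -
  assume i: "i < N m"
  have "bS m i = (\<Sum>j<N m. (if i = j then 1 else 0) - BS m i j)"
    using i B_carrier[of m] by (simp add: exit_vec_def scalar_prod_def lessThan_atLeast0)
  then show ?thesis using i by (simp add: sum_subtractf)
qed

lemma B_sum: "i < N m \<Longrightarrow> (\<Sum>j<N m. BS m i j) = 1 - bS m i"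
  by (simp add: b_eq)

lemma b_nonneg: "i < N m \<Longrightarrow> 0 \<le> bS m i" and b_le: "i < N m \<Longrightarrow> bS m i \<le> 1"
  using dph[of m] by (auto simp: b_eq dph_params_def intro!: sum_nonneg)

lemma Tc_nonneg:
  assumes "\<And>q. (\<And>i. q = Some i \<Longrightarrow> i < N m) \<Longrightarrow> 0 \<le> g q" "\<And>i. p = Some i \<Longrightarrow> i < N m"
  shows "0 \<le> Tc m c g p"
  using assms by (auto simp: Tc_def b_nonneg B_nonneg intro!: mult_nonneg_nonneg sum_nonneg split: option.splits)

lemma Tc_sum_1: 
  assumes "\<And>i. p = Some i \<Longrightarrow> i < N m"
  shows "Tc m False (\<lambda>_. x) p = x - Tc m True (\<lambda>_. x) p"
  using assms by (auto simp: Tc_def B_sum sum_distrib_left[symmetric] algebra_simps split: option.splits)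

lemma Lop_1: "Lop (\<lambda>_ _ _. 1) l = (\<lambda>_ _. 1)"
  by (intro ext) (simp add: Lop_def alpha_sum)

text \<open>Absorption in 15 needs a later packet to complete while P* is no longer in service. In
  class 8 three completion patterns do this, which explains the entry b1 + b2 - b1 b2.\<close>

lemma csuc_emb:
  assumes "valid i (n, s1, s2, l)" "matches s1 p1" "matches s2 p2"
    and "\<And>i. p1 = Some i \<Longrightarrow> i < N S1" "\<And>i. p2 = Some i \<Longrightarrow> i < N S2"
  shows "csuc (emb i (n, s1, s2, l) p1 p2 l) = (if inserv i (n, s1, s2, l) then 0
    else \<Sum>c\<in>UNIV. if kill i (n, s1, s2, l) c then Kc c (\<lambda>_ _ _. 1) p1 p2 l else 0)"
proof -
  have U: "(UNIV :: (bool \<times> bool) set) = {(True, True), (True, False), (False, True), (False, False)}"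
    by auto
  note defs = U csuc_def Lop_1 Tc_sum_1[OF assms(4)] Tc_sum_1[OF assms(5)] emb_def yst_def newer_def serves_def older_def
  show ?thesis
    using assms 
    apply (cases s1; cases p1; cases s2; cases p2)
    apply (auto simp: defs)
    apply (auto simp: Tc_def B_sum algebra_simps)
    done
qed

end

section \<open>The vector q as the flow of new packets\<close>

context dual_queue
begin

lemma Tc_0 [simp]: "Tc m c (\<lambda>_. 0) p = 0"
  by (simp add: Tc_def split: option.splits)

lemma gam_run: "l < k - 1 \<Longrightarrow> gam v p1 p2 l = 0"
  by (simp add: gam_def waits_def case_prod_unfold)

text \<open>The vector q is by construction \<open>p\<close> followed by one slot of W that ends
  with a generation. Testing it against an arbitrary \<open>v\<close> avoids describing q state by
  state.\<close>

lemma sum_gam: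
  assumes "1 \<le> k"
  shows "(\<Sum>w\<in>r_states. pmf p w * at_rst (gam v) w) = ysum (\<lambda>y. q_init p y * v y)"
proof -
  have U: "(UNIV :: (bool \<times> bool) set) = {(True, True), (True, False), (False, True), (False, False)}"
    by auto
  \<comment> \<open>With the clock running nothing is generated, so only its last value remains in
    the sum.\<close>
  have last: "(\<Sum>l<k. x l * gam v p1 p2 l) = x (k - 1) * gam v p1 p2 (k - 1)" for x p1 p2
  proof -
    have "(\<Sum>l<k. x l * gam v p1 p2 l) = (\<Sum>l<k. if l = k - 1 then x l * gam v p1 p2 l else 0)"
      by (rule sum.cong) (auto simp: gam_run)
    then show ?thesis using assms by simp
  qed
  have first: "(\<Sum>l'<k. of_bool (l' = 0) * h l') = h 0"
    "(\<Sum>l'<k. of_bool (P \<and> l' = 0) * h l') = (if P then h 0 else (0 :: real))" for h P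
    using clock_sum(1)[of P 0 h] clock_sum(2)[of 0 h] assms by simp_all
  note swap = sum.swap[where A = "{..<N S1}" and B = "{..<N S2}"]
  have g: "\<not> k - 1 < k - 1" by simp
  have L: "(\<Sum>w\<in>r_states. pmf p w * at_rst (gam v) w) =
      pmf p (R1 (k - 1)) * gam v None None (k - 1)
    + (\<Sum>i<N S1. pmf p (R2 i (k - 1)) * gam v (Some i) None (k - 1))
    + (\<Sum>j<N S2. pmf p (R3 j (k - 1)) * gam v None (Some j) (k - 1))
    + (\<Sum>i<N S1. \<Sum>j<N S2. pmf p (R4 i j (k - 1)) * gam v (Some i) (Some j) (k - 1))"
    by (simp add: sum_r_states last del: One_nat_def)
  have G1: "gam v None None (k - 1) = (if S1_first then \<Sum>i<N S1. a1 i * v (Y5 i 0) else \<Sum>j<N S2. a2 j * v (Y6 j 0))"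
    by (simp add: gam_def U Tc_def waits_def launch1_def)
  \<comment> \<open>The contribution of a slot after which both servers are idle; its total weight
    over W is \<open>\<omega>_idle p\<close>.\<close>
  let ?F = "gam v None None (k - 1)"
  have G2: "gam v (Some i) None (k - 1) = b1 i * ?F + (\<Sum>i'<N S1. B1 i i' * (\<Sum>j'<N S2. a2 j' * v (Y4 i' j' 0)))" for i
    by (simp add: gam_def U Tc_def waits_def launch1_def)
  have G3: "gam v None (Some j) (k - 1) = b2 j * ?F + (\<Sum>j'<N S2. B2 j j' * (\<Sum>i'<N S1. a1 i' * v (Y1 i' j' 0)))" for j
    by (simp add: gam_def U Tc_def waits_def launch1_def)
  have G4: "gam v (Some i) (Some j) (k - 1) = b1 i * b2 j * ?F
     + b1 i * (\<Sum>j'<N S2. B2 j j' * (\<Sum>i'<N S1. a1 i' * v (Y1 i' j' 0)))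
     + b2 j * (\<Sum>i'<N S1. B1 i i' * (\<Sum>j'<N S2. a2 j' * v (Y4 i' j' 0)))" for i j
    by (simp add: gam_def U Tc_def waits_def launch1_def sum_distrib_left ac_simps)
  have R: "ysum (\<lambda>y. q_init p y * v y) =
     (\<Sum>i<N S1. \<Sum>j<N S2. q_init p (Y1 i j 0) * v (Y1 i j 0))
   + (\<Sum>i<N S1. \<Sum>j<N S2. q_init p (Y4 i j 0) * v (Y4 i j 0)) + \<omega>_idle p * ?F"
    unfolding G1
    by (simp add: ysum_eq first prio_iff mult.assoc mult_of_bool_sum)
       (simp add: sum_distrib_left mult.left_commute)
  have W: "\<omega>_idle p * ?F = pmf p (R1 (k - 1)) * ?F + (\<Sum>i<N S1. pmf p (R2 i (k - 1)) * (b1 i * ?F))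
     + (\<Sum>j<N S2. pmf p (R3 j (k - 1)) * (b2 j * ?F))
     + (\<Sum>i<N S1. \<Sum>j<N S2. pmf p (R4 i j (k - 1)) * (b1 i * b2 j * ?F))"
    unfolding \<omega>_idle_def distrib_right sum_distrib_right by (simp add: mult_ac)
  have rot: "(\<Sum>i\<in>I. \<Sum>j\<in>J. \<Sum>x\<in>X. h i j x) = (\<Sum>x\<in>X. \<Sum>i\<in>I. \<Sum>j\<in>J. h i j x)"
    for I J X :: "nat set" and h :: "nat \<Rightarrow> nat \<Rightarrow> nat \<Rightarrow> real"
    by (simp add: sum.swap[of _ X])
  have rot4: "(\<Sum>i\<in>I. \<Sum>j\<in>J. \<Sum>x\<in>X. \<Sum>y\<in>Y. h i j x y) = (\<Sum>x\<in>X. \<Sum>y\<in>Y. \<Sum>i\<in>I. \<Sum>j\<in>J. h i j x y)"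
    for I J X Y :: "nat set" and h :: "nat \<Rightarrow> nat \<Rightarrow> nat \<Rightarrow> nat \<Rightarrow> real"
    by (rule trans[OF rot], rule sum.cong[OF refl], rule rot)
  have Y1: "(\<Sum>i'<N S1. \<Sum>j'<N S2. q_init p (Y1 i' j' 0) * v (Y1 i' j' 0)) =
     (\<Sum>j<N S2. pmf p (R3 j (k - 1)) * (\<Sum>j'<N S2. B2 j j' * (\<Sum>i'<N S1. a1 i' * v (Y1 i' j' 0))))
   + (\<Sum>i<N S1. \<Sum>j<N S2. pmf p (R4 i j (k - 1)) * (b1 i * (\<Sum>j'<N S2. B2 j j' * (\<Sum>i'<N S1. a1 i' * v (Y1 i' j' 0)))))"
    apply (simp add: distrib_right sum.distrib sum_distrib_left sum_distrib_right mult.assoc)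
    apply (rule arg_cong2[of _ _ _ _ "(+)"])
     apply (subst rot, rule sum.cong[OF refl], subst sum.swap, simp add: ac_simps)
    apply (rule trans[OF rot4], rule sum.cong[OF refl], rule sum.cong[OF refl], subst sum.swap, simp add: ac_simps)
    done
  have Y4: "(\<Sum>i'<N S1. \<Sum>j'<N S2. q_init p (Y4 i' j' 0) * v (Y4 i' j' 0)) =
     (\<Sum>i<N S1. pmf p (R2 i (k - 1)) * (\<Sum>i'<N S1. B1 i i' * (\<Sum>j'<N S2. a2 j' * v (Y4 i' j' 0))))
   + (\<Sum>i<N S1. \<Sum>j<N S2. pmf p (R4 i j (k - 1)) * (b2 j * (\<Sum>i'<N S1. B1 i i' * (\<Sum>j'<N S2. a2 j' * v (Y4 i' j' 0)))))"
    apply (simp add: distrib_right sum.distrib sum_distrib_left sum_distrib_right mult.assoc)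
    apply (rule arg_cong2[of _ _ _ _ "(+)"])
     apply (subst rot, rule sum.cong[OF refl], simp add: ac_simps)
    apply (rule trans[OF rot4], simp add: ac_simps)
    done
  show ?thesis
    unfolding L R G2 G3 G4 W Y1 Y4 by (simp only: distrib_left sum.distrib)
qed

end

section \<open>Transience of the phases\<close>

context stable_queue
begin

text \<open>The column vector B^t 1: the probability that a service in phase \<open>i\<close> lasts
  more than \<open>t\<close> further slots.\<close>

primrec surv :: "server \<Rightarrow> nat \<Rightarrow> nat \<Rightarrow> real" where
  "surv m 0 i = 1"
| "surv m (Suc t) i = (\<Sum>j<N m. BS m i j * surv m t j)"

lemma pow_left:
  assumes "i < N m" "j < N m"
  shows "(B m ^\<^sub>m Suc t) $$ (i, j) = (\<Sum>l<N m. BS m i l * (B m ^\<^sub>m t) $$ (l, j))"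
proof -
  have "B m ^\<^sub>m Suc t = B m * B m ^\<^sub>m t"
  proof (induction t)
    case (Suc t)
    have "B m ^\<^sub>m Suc (Suc t) = B m * B m ^\<^sub>m t * B m"
      using Suc by simp
    also have "\<dots> = B m * B m ^\<^sub>m Suc t"
      using B_carrier[of m] by (simp add: assoc_mult_mat[of _ "N m" "N m" _ "N m" _ "N m"] pow_carrier_mat)
    finally show ?case .
  qed (use B_carrier[of m] in simp)
  then show ?thesis
    using assms B_carrier[of m] pow_carrier_mat[OF B_carrier[of m], of t]
    by (simp add: scalar_prod_def lessThan_atLeast0)
qed

lemma pow_nonneg: "i < N m \<Longrightarrow> j < N m \<Longrightarrow> 0 \<le> (B m ^\<^sub>m t) $$ (i, j)"
proof (induction t arbitrary: i)
  case (Suc t)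
  then show ?case unfolding pow_left[OF Suc.prems]
    by (intro sum_nonneg mult_nonneg_nonneg B_nonneg) auto
qed (use B_carrier[of m] in \<open>simp add: one_mat_def\<close>)

lemma surv_eq: "i < N m \<Longrightarrow> surv m t i = (\<Sum>j<N m. (B m ^\<^sub>m t) $$ (i, j))"
proof (induction t arbitrary: i)
  case 0
  then show ?case using B_carrier[of m] by simp
next
  case (Suc t)
  have "surv m (Suc t) i = (\<Sum>l<N m. \<Sum>j<N m. BS m i l * (B m ^\<^sub>m t) $$ (l, j))"
    using Suc by (simp add: sum_distrib_left)
  also have "\<dots> = (\<Sum>j<N m. \<Sum>l<N m. BS m i l * (B m ^\<^sub>m t) $$ (l, j))"
    by (rule sum.swap)
  finally show ?case using Suc.prems by (simp add: pow_left del: pow_mat.simps)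
qed

text \<open>First-passage decomposition: \<open>passage j s i\<close> is the probability that the first visit to \<open>j\<close>,
  starting in \<open>i\<close>, happens at time \<open>s\<close>.\<close>

lemma pow_tendsto_0:
  assumes i: "i < N m" and j: "j < N m"
  shows "(\<lambda>t. (B m ^\<^sub>m t) $$ (i, j)) \<longlonglongrightarrow> 0"
proof -
  define passage where "passage = rec_nat (\<lambda>i. of_bool (i = j) :: real)
    (\<lambda>_ h i. if i = j then 0 else \<Sum>l<N m. BS m i l * h l)"
  have p0: "passage 0 i = of_bool (i = j)" for i by (simp add: passage_def)
  have pS: "passage (Suc s) i = (if i = j then 0 else \<Sum>l<N m. BS m i l * passage s l)" for s i
    by (simp add: passage_def)
  have nonneg: "0 \<le> passage s i" if "i < N m" for s i
    using that by (induction s arbitrary: i) (auto simp: p0 pS intro!: sum_nonneg mult_nonneg_nonneg B_nonneg)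
  have le1: "(\<Sum>s<n. passage s i) \<le> 1" if "i < N m" for n i
    using that
  proof (induction n arbitrary: i)
    case (Suc n)
    show ?case
    proof (cases "i = j")
      case False
      have "(\<Sum>s<Suc n. passage s i) = (\<Sum>s<n. \<Sum>l<N m. BS m i l * passage s l)"
        using False by (simp add: sum.lessThan_Suc_shift p0 pS del: sum.lessThan_Suc)
      also have "\<dots> = (\<Sum>l<N m. BS m i l * (\<Sum>s<n. passage s l))"
        by (simp add: sum_distrib_left) (rule sum.swap)
      also have "\<dots> \<le> (\<Sum>l<N m. BS m i l * 1)"
        using Suc B_nonneg by (intro sum_mono mult_left_mono) auto
      also have "\<dots> \<le> 1" using B_sum[OF Suc.prems] b_nonneg[OF Suc.prems] by simp
      finally show ?thesis .
    qed (simp add: sum.lessThan_Suc_shift p0 pS del: sum.lessThan_Suc)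
  qed simp
  have decomp: "(B m ^\<^sub>m t) $$ (i, j) = (\<Sum>s\<le>t. passage s i * (B m ^\<^sub>m (t - s)) $$ (j, j))" if "i < N m" for t i
    using that
  proof (induction t arbitrary: i)
    case 0
    then show ?case using j B_carrier[of m] by (simp add: p0 one_mat_def)
  next
    case (Suc t)
    show ?case
    proof (cases "i = j")
      case False
      have "(\<Sum>s\<le>Suc t. passage s i * (B m ^\<^sub>m (Suc t - s)) $$ (j, j))
          = (\<Sum>s\<le>t. \<Sum>l<N m. BS m i l * (passage s l * (B m ^\<^sub>m (t - s)) $$ (j, j)))"
        using False
        by (simp add: sum.atMost_Suc_shift p0 pS sum_distrib_right mult.assoc del: sum.atMost_Suc pow_mat.simps)
      also have "\<dots> = (\<Sum>l<N m. BS m i l * (\<Sum>s\<le>t. passage s l * (B m ^\<^sub>m (t - s)) $$ (j, j)))"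
        by (simp add: sum_distrib_left) (rule sum.swap)
      finally show ?thesis using Suc j by (simp add: pow_left del: pow_mat.simps)
    qed (simp add: sum.atMost_Suc_shift p0 pS del: sum.atMost_Suc pow_mat.simps)
  qed
  have "summable (\<lambda>s. norm (passage s i))"
    using nonneg[OF i] le1[OF i] by (intro bounded_imp_summable[of _ 1]) (auto simp: lessThan_Suc_atMost[symmetric] simp del: sum.lessThan_Suc)
  moreover have "summable (\<lambda>t. norm ((B m ^\<^sub>m t) $$ (j, j)))"
    using B_summable[OF j] pow_nonneg[OF j j] by simp
  \<comment> \<open>By \<open>decomp\<close> this convolution is the entry (i, j) of B^t. It is the
    Cauchy product of the first-passage probabilities, of sum at most 1, and the summable diagonal
    entries, so its terms tend to 0.\<close>
  ultimately have "summable (\<lambda>t. \<Sum>s\<le>t. passage s i * (B m ^\<^sub>m (t - s)) $$ (j, j))"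
    by (rule summable_Cauchy_product)
  then show ?thesis
    using summable_LIMSEQ_zero decomp[OF i] by simp
qed

lemma surv_tendsto_0: "i < N m \<Longrightarrow> (\<lambda>t. surv m t i) \<longlonglongrightarrow> 0"
  using tendsto_sum[of "{..<N m}" "\<lambda>j t. (B m ^\<^sub>m t) $$ (i, j)" "\<lambda>_. 0"] pow_tendsto_0
  by (simp add: surv_eq)

lemma surv_nonneg: "i < N m \<Longrightarrow> 0 \<le> surv m t i"
  by (auto simp: surv_eq intro!: sum_nonneg pow_nonneg)

lemma surv_le_1: "i < N m \<Longrightarrow> surv m t i \<le> 1"
proof (induction t arbitrary: i)
  case (Suc t)
  have "surv m (Suc t) i \<le> (\<Sum>j<N m. BS m i j * 1)"
    unfolding surv.simps using Suc B_nonneg by (intro sum_mono mult_left_mono) auto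
  then show ?case using B_sum[OF Suc.prems] b_nonneg[OF Suc.prems] by simp
qed simp

text \<open>Iterating the equation t times bounds |u| by a constant times the probability that both
  services survive t slots, which tends to 0.\<close>

lemma both_busy_fixpoint:
  assumes fixp: "\<And>i j. i < N S1 \<Longrightarrow> j < N S2 \<Longrightarrow> u i j = (\<Sum>i'<N S1. \<Sum>j'<N S2. B1 i i' * B2 j j' * u i' j')"
    and ij: "i < N S1" "j < N S2"
  shows "u i j = (0 :: real)"
proof -
  obtain C where C: "\<And>i j. i < N S1 \<Longrightarrow> j < N S2 \<Longrightarrow> \<bar>u i j\<bar> \<le> C"
  proof
    fix i j assume "i < N S1" "j < N S2"
    then have "\<bar>u i j\<bar> \<le> (\<Sum>j<N S2. \<bar>u i j\<bar>)" by (intro member_le_sum) auto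
    also have "\<dots> \<le> (\<Sum>i<N S1. \<Sum>j<N S2. \<bar>u i j\<bar>)"
      using \<open>i < N S1\<close> by (intro member_le_sum[of i _ "\<lambda>i. \<Sum>j<N S2. \<bar>u i j\<bar>"] sum_nonneg) auto
    finally show "\<bar>u i j\<bar> \<le> (\<Sum>i<N S1. \<Sum>j<N S2. \<bar>u i j\<bar>)" .
  qed
  have "\<bar>u i j\<bar> \<le> surv S1 t i * surv S2 t j * C" if "i < N S1" "j < N S2" for t i j
    using that
  proof (induction t arbitrary: i j)
    case (Suc t)
    have "\<bar>u i j\<bar> \<le> (\<Sum>i'<N S1. \<Sum>j'<N S2. \<bar>B1 i i' * B2 j j' * u i' j'\<bar>)"
      unfolding fixp[OF Suc.prems] by (rule order_trans[OF sum_abs]) (intro sum_mono sum_abs)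
    also have "\<dots> \<le> (\<Sum>i'<N S1. \<Sum>j'<N S2. B1 i i' * B2 j j' * (surv S1 t i' * surv S2 t j' * C))"
      using Suc B_nonneg by (intro sum_mono) (auto simp: abs_mult intro!: mult_mono)
    also have "\<dots> = surv S1 (Suc t) i * surv S2 (Suc t) j * C"
      unfolding surv.simps sum_product unfolding sum_distrib_right by (simp add: mult_ac)
    finally show ?case .
  qed (use C in simp)
  moreover have "(\<lambda>t. surv S1 t i * surv S2 t j * C) \<longlonglongrightarrow> 0 * 0 * C"
    using ij by (intro tendsto_intros surv_tendsto_0)
  ultimately have "\<bar>u i j\<bar> \<le> 0 * 0 * C"
    using ij by (intro LIMSEQ_le_const[of _ "0 * 0 * C"]) auto
  then show ?thesis by simp
qed

end

section \<open>Rows of A and enumeration of the transient states\<close>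

context dual_queue
begin

text \<open>The value of \<open>f\<close> after the transitions summarised as going to F with weight
  1.\<close>

definition idleF :: "(ystate \<Rightarrow> real) \<Rightarrow> nat \<Rightarrow> real" where
  "idleF f l = (if Suc l < k then f (Y7 (Suc l)) else if S1_first then \<Sum>i<N S1. a1 i * f (Y13 i 0)
     else \<Sum>j<N S2. a2 j * f (Y14 j 0))"

lemma Aop_eqs:
  assumes "l < k"
  shows "Aop f (Y1 i j l) = b1 i * b2 j * idleF f l + (if Suc l < k then b1 i * (\<Sum>j'<N S2. B2 j j' * f (Y10 j' (Suc l))) + b2 j * (\<Sum>i'<N S1. B1 i i' * f (Y5 i' (Suc l)))
       else b1 i * (\<Sum>i'<N S1. \<Sum>j'<N S2. B2 j j' * a1 i' * f (Y11 i' j' 0)) + b2 j * (\<Sum>i'<N S1. \<Sum>j'<N S2. B1 i i' * a2 j' * f (Y2 i' j' 0)))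
     + (\<Sum>i'<N S1. \<Sum>j'<N S2. B1 i i' * B2 j j' * f (Y1 i' j' (min (Suc l) (k - 1))))"
    and "Aop f (Y2 i j l) = (if Suc l < k then b1 i * (\<Sum>j'<N S2. B2 j j' * f (Y14 j' (Suc l)))
       else b1 i * (\<Sum>i'<N S1. \<Sum>j'<N S2. B2 j j' * a1 i' * f (Y8 i' j')))
     + (\<Sum>i'<N S1. \<Sum>j'<N S2. B1 i i' * B2 j j' * f (Y2 i' j' (min (Suc l) (k - 1))))"
    and "Aop f (Y3 i j l) = (if Suc l < k then b2 j * (\<Sum>i'<N S1. B1 i i' * f (Y13 i' (Suc l)))
       else b2 j * (\<Sum>i'<N S1. \<Sum>j'<N S2. B1 i i' * a2 j' * f (Y8 i' j')))
     + (\<Sum>i'<N S1. \<Sum>j'<N S2. B1 i i' * B2 j j' * f (Y3 i' j' (min (Suc l) (k - 1))))"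
    and "Aop f (Y4 i j l) = b1 i * b2 j * idleF f l + (if Suc l < k then b1 i * (\<Sum>j'<N S2. B2 j j' * f (Y6 j' (Suc l))) + b2 j * (\<Sum>i'<N S1. B1 i i' * f (Y9 i' (Suc l)))
       else b1 i * (\<Sum>i'<N S1. \<Sum>j'<N S2. B2 j j' * a1 i' * f (Y3 i' j' 0)) + b2 j * (\<Sum>i'<N S1. \<Sum>j'<N S2. B1 i i' * a2 j' * f (Y12 i' j' 0)))
     + (\<Sum>i'<N S1. \<Sum>j'<N S2. B1 i i' * B2 j j' * f (Y4 i' j' (min (Suc l) (k - 1))))"
    and "Aop f (Y5 i l) = b1 i * idleF f l + (if Suc l < k then (\<Sum>i'<N S1. B1 i i' * f (Y5 i' (Suc l)))
       else (\<Sum>i'<N S1. \<Sum>j'<N S2. B1 i i' * a2 j' * f (Y2 i' j' 0)))"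
    and "Aop f (Y6 j l) = b2 j * idleF f l + (if Suc l < k then (\<Sum>j'<N S2. B2 j j' * f (Y6 j' (Suc l)))
       else (\<Sum>i'<N S1. \<Sum>j'<N S2. B2 j j' * a1 i' * f (Y3 i' j' 0)))"
    and "Aop f (Y7 l) = idleF f l"
    and "Aop f (Y8 i j) = (\<Sum>i'<N S1. \<Sum>j'<N S2. B1 i i' * B2 j j' * f (Y8 i' j'))"
    and "Aop f (Y9 i l) = b1 i * idleF f l + (if Suc l < k then (\<Sum>i'<N S1. B1 i i' * f (Y9 i' (Suc l)))
       else (\<Sum>i'<N S1. \<Sum>j'<N S2. B1 i i' * a2 j' * f (Y12 i' j' 0)))"
    and "Aop f (Y10 j l) = b2 j * idleF f l + (if Suc l < k then (\<Sum>j'<N S2. B2 j j' * f (Y10 j' (Suc l)))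
       else (\<Sum>i'<N S1. \<Sum>j'<N S2. B2 j j' * a1 i' * f (Y11 i' j' 0)))"
    and "Aop f (Y11 i j l) = (if Suc l < k then b2 j * (\<Sum>i'<N S1. B1 i i' * f (Y13 i' (Suc l)))
       else b2 j * (\<Sum>i'<N S1. \<Sum>j'<N S2. B1 i i' * a2 j' * f (Y8 i' j')))
     + (\<Sum>i'<N S1. \<Sum>j'<N S2. B1 i i' * B2 j j' * f (Y11 i' j' (min (Suc l) (k - 1))))"
    and "Aop f (Y12 i j l) = (if Suc l < k then b1 i * (\<Sum>j'<N S2. B2 j j' * f (Y14 j' (Suc l)))
       else b1 i * (\<Sum>i'<N S1. \<Sum>j'<N S2. B2 j j' * a1 i' * f (Y8 i' j')))
     + (\<Sum>i'<N S1. \<Sum>j'<N S2. B1 i i' * B2 j j' * f (Y12 i' j' (min (Suc l) (k - 1))))"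
    and "Aop f (Y13 i l) = (if Suc l < k then (\<Sum>i'<N S1. B1 i i' * f (Y13 i' (Suc l)))
       else (\<Sum>i'<N S1. \<Sum>j'<N S2. B1 i i' * a2 j' * f (Y8 i' j')))"
    and "Aop f (Y14 j l) = (if Suc l < k then (\<Sum>j'<N S2. B2 j j' * f (Y14 j' (Suc l)))
       else (\<Sum>i'<N S1. \<Sum>j'<N S2. B2 j j' * a1 i' * f (Y8 i' j')))"
proof -
  have lk: thesis if "Suc l < k \<Longrightarrow> l < k - Suc 0 \<Longrightarrow> thesis" "\<not> Suc l < k \<Longrightarrow> k - Suc 0 = l \<Longrightarrow> thesis" for thesis
    using that assms by linarith
  note defs = idleF_def prio_iff Aop_def ysum_eq mult.assoc mult_of_bool_sum sum.distrib distrib_right clock_sum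
  show "Aop f (Y1 i j l) = b1 i * b2 j * idleF f l + (if Suc l < k then b1 i * (\<Sum>j'<N S2. B2 j j' * f (Y10 j' (Suc l))) + b2 j * (\<Sum>i'<N S1. B1 i i' * f (Y5 i' (Suc l)))
       else b1 i * (\<Sum>i'<N S1. \<Sum>j'<N S2. B2 j j' * a1 i' * f (Y11 i' j' 0)) + b2 j * (\<Sum>i'<N S1. \<Sum>j'<N S2. B1 i i' * a2 j' * f (Y2 i' j' 0)))
     + (\<Sum>i'<N S1. \<Sum>j'<N S2. B1 i i' * B2 j j' * f (Y1 i' j' (min (Suc l) (k - 1))))"
    using assms by (cases rule: lk; cases S1_first)
      (simp_all add: defs del: sum_of_bool_mult_eq sum_mult_of_bool_eq)
  show "Aop f (Y2 i j l) = (if Suc l < k then b1 i * (\<Sum>j'<N S2. B2 j j' * f (Y14 j' (Suc l)))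
       else b1 i * (\<Sum>i'<N S1. \<Sum>j'<N S2. B2 j j' * a1 i' * f (Y8 i' j')))
     + (\<Sum>i'<N S1. \<Sum>j'<N S2. B1 i i' * B2 j j' * f (Y2 i' j' (min (Suc l) (k - 1))))"
    using assms by (cases rule: lk; cases S1_first)
      (simp_all add: defs del: sum_of_bool_mult_eq sum_mult_of_bool_eq)
  show "Aop f (Y3 i j l) = (if Suc l < k then b2 j * (\<Sum>i'<N S1. B1 i i' * f (Y13 i' (Suc l)))
       else b2 j * (\<Sum>i'<N S1. \<Sum>j'<N S2. B1 i i' * a2 j' * f (Y8 i' j')))
     + (\<Sum>i'<N S1. \<Sum>j'<N S2. B1 i i' * B2 j j' * f (Y3 i' j' (min (Suc l) (k - 1))))"
    using assms by (cases rule: lk; cases S1_first)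
      (simp_all add: defs del: sum_of_bool_mult_eq sum_mult_of_bool_eq)
  show "Aop f (Y4 i j l) = b1 i * b2 j * idleF f l + (if Suc l < k then b1 i * (\<Sum>j'<N S2. B2 j j' * f (Y6 j' (Suc l))) + b2 j * (\<Sum>i'<N S1. B1 i i' * f (Y9 i' (Suc l)))
       else b1 i * (\<Sum>i'<N S1. \<Sum>j'<N S2. B2 j j' * a1 i' * f (Y3 i' j' 0)) + b2 j * (\<Sum>i'<N S1. \<Sum>j'<N S2. B1 i i' * a2 j' * f (Y12 i' j' 0)))
     + (\<Sum>i'<N S1. \<Sum>j'<N S2. B1 i i' * B2 j j' * f (Y4 i' j' (min (Suc l) (k - 1))))"
    using assms by (cases rule: lk; cases S1_first)
      (simp_all add: defs del: sum_of_bool_mult_eq sum_mult_of_bool_eq)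
  show "Aop f (Y5 i l) = b1 i * idleF f l + (if Suc l < k then (\<Sum>i'<N S1. B1 i i' * f (Y5 i' (Suc l)))
       else (\<Sum>i'<N S1. \<Sum>j'<N S2. B1 i i' * a2 j' * f (Y2 i' j' 0)))"
    using assms by (cases rule: lk; cases S1_first)
      (simp_all add: defs del: sum_of_bool_mult_eq sum_mult_of_bool_eq)
  show "Aop f (Y6 j l) = b2 j * idleF f l + (if Suc l < k then (\<Sum>j'<N S2. B2 j j' * f (Y6 j' (Suc l)))
       else (\<Sum>i'<N S1. \<Sum>j'<N S2. B2 j j' * a1 i' * f (Y3 i' j' 0)))"
    using assms by (cases rule: lk; cases S1_first)
      (simp_all add: defs del: sum_of_bool_mult_eq sum_mult_of_bool_eq)
  show "Aop f (Y7 l) = idleF f l"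
    using assms by (cases rule: lk; cases S1_first)
      (simp_all add: defs del: sum_of_bool_mult_eq sum_mult_of_bool_eq)
  show "Aop f (Y8 i j) = (\<Sum>i'<N S1. \<Sum>j'<N S2. B1 i i' * B2 j j' * f (Y8 i' j'))"
    using assms by (cases rule: lk; cases S1_first)
      (simp_all add: defs del: sum_of_bool_mult_eq sum_mult_of_bool_eq)
  show "Aop f (Y9 i l) = b1 i * idleF f l + (if Suc l < k then (\<Sum>i'<N S1. B1 i i' * f (Y9 i' (Suc l)))
       else (\<Sum>i'<N S1. \<Sum>j'<N S2. B1 i i' * a2 j' * f (Y12 i' j' 0)))"
    using assms by (cases rule: lk; cases S1_first)
      (simp_all add: defs del: sum_of_bool_mult_eq sum_mult_of_bool_eq)
  show "Aop f (Y10 j l) = b2 j * idleF f l + (if Suc l < k then (\<Sum>j'<N S2. B2 j j' * f (Y10 j' (Suc l)))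
       else (\<Sum>i'<N S1. \<Sum>j'<N S2. B2 j j' * a1 i' * f (Y11 i' j' 0)))"
    using assms by (cases rule: lk; cases S1_first)
      (simp_all add: defs del: sum_of_bool_mult_eq sum_mult_of_bool_eq)
  show "Aop f (Y11 i j l) = (if Suc l < k then b2 j * (\<Sum>i'<N S1. B1 i i' * f (Y13 i' (Suc l)))
       else b2 j * (\<Sum>i'<N S1. \<Sum>j'<N S2. B1 i i' * a2 j' * f (Y8 i' j')))
     + (\<Sum>i'<N S1. \<Sum>j'<N S2. B1 i i' * B2 j j' * f (Y11 i' j' (min (Suc l) (k - 1))))"
    using assms by (cases rule: lk; cases S1_first)
      (simp_all add: defs del: sum_of_bool_mult_eq sum_mult_of_bool_eq)
  show "Aop f (Y12 i j l) = (if Suc l < k then b1 i * (\<Sum>j'<N S2. B2 j j' * f (Y14 j' (Suc l)))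
       else b1 i * (\<Sum>i'<N S1. \<Sum>j'<N S2. B2 j j' * a1 i' * f (Y8 i' j')))
     + (\<Sum>i'<N S1. \<Sum>j'<N S2. B1 i i' * B2 j j' * f (Y12 i' j' (min (Suc l) (k - 1))))"
    using assms by (cases rule: lk; cases S1_first)
      (simp_all add: defs del: sum_of_bool_mult_eq sum_mult_of_bool_eq)
  show "Aop f (Y13 i l) = (if Suc l < k then (\<Sum>i'<N S1. B1 i i' * f (Y13 i' (Suc l)))
       else (\<Sum>i'<N S1. \<Sum>j'<N S2. B1 i i' * a2 j' * f (Y8 i' j')))"
    using assms by (cases rule: lk; cases S1_first)
      (simp_all add: defs del: sum_of_bool_mult_eq sum_mult_of_bool_eq)
  show "Aop f (Y14 j l) = (if Suc l < k then (\<Sum>j'<N S2. B2 j j' * f (Y14 j' (Suc l)))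
       else (\<Sum>i'<N S1. \<Sum>j'<N S2. B2 j j' * a1 i' * f (Y8 i' j')))"
    using assms by (cases rule: lk; cases S1_first)
      (simp_all add: defs del: sum_of_bool_mult_eq sum_mult_of_bool_eq)
qed

end

context dual_queue
begin

lemma mem_triples: "y \<in> set (concat (map (\<lambda>i. concat (map (\<lambda>j. map (f i j) [0..<n3]) [0..<n2])) [0..<n1]))
    \<longleftrightarrow> (\<exists>i<n1. \<exists>j<n2. \<exists>l<n3. y = f i j l)"
  by (auto; force)

lemma mem_pairs: "y \<in> set (concat (map (\<lambda>i. map (f i) [0..<n2]) [0..<n1])) \<longleftrightarrow> (\<exists>i<n1. \<exists>l<n2. y = f i l)"
  by (auto; force)

lemma mem_single: "y \<in> set (map f [0..<n]) \<longleftrightarrow> (\<exists>l<n. y = f l)"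
  by (auto; force)

lemmas mem_blocks = set_append Un_iff mem_triples mem_pairs mem_single

lemma mem_y_states [simp]:
  "Y1 i j l \<in> set y_states \<longleftrightarrow> i < N S1 \<and> j < N S2 \<and> l < k"
  "Y2 i j l \<in> set y_states \<longleftrightarrow> i < N S1 \<and> j < N S2 \<and> l < k"
  "Y3 i j l \<in> set y_states \<longleftrightarrow> i < N S1 \<and> j < N S2 \<and> l < k"
  "Y4 i j l \<in> set y_states \<longleftrightarrow> i < N S1 \<and> j < N S2 \<and> l < k"
  "Y5 i l \<in> set y_states \<longleftrightarrow> i < N S1 \<and> l < k"
  "Y6 j l \<in> set y_states \<longleftrightarrow> j < N S2 \<and> l < k"
  "Y7 l \<in> set y_states \<longleftrightarrow> l < k"
  "Y8 i j \<in> set y_states \<longleftrightarrow> i < N S1 \<and> j < N S2"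
  "Y9 i l \<in> set y_states \<longleftrightarrow> i < N S1 \<and> l < k"
  "Y10 j l \<in> set y_states \<longleftrightarrow> j < N S2 \<and> l < k"
  "Y11 i j l \<in> set y_states \<longleftrightarrow> i < N S1 \<and> j < N S2 \<and> l < k"
  "Y12 i j l \<in> set y_states \<longleftrightarrow> i < N S1 \<and> j < N S2 \<and> l < k"
  "Y13 i l \<in> set y_states \<longleftrightarrow> i < N S1 \<and> l < k"
  "Y14 j l \<in> set y_states \<longleftrightarrow> j < N S2 \<and> l < k"
  "Y15 \<notin> set y_states" "Y16 \<notin> set y_states"
  unfolding y_states_def mem_blocks by simp_all

lemma distinct_concat_map:
  assumes "distinct xs" "\<And>x. x \<in> set xs \<Longrightarrow> distinct (h x)"
    and "\<And>x y. x \<in> set xs \<Longrightarrow> y \<in> set xs \<Longrightarrow> x \<noteq> y \<Longrightarrow> set (h x) \<inter> set (h y) = {}"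
  shows "distinct (concat (map h xs))"
  using assms
proof (induction xs)
  case (Cons x xs)
  have "set (h x) \<inter> (\<Union>y\<in>set xs. set (h y)) = {}"
    using Cons.prems(1) Cons.prems(3)[of x] by auto
  then show ?case using Cons by simp
qed simp

lemma distinct_triples:
  assumes "\<And>i j l i' j' l'. f i j l = f i' j' l' \<longleftrightarrow> i = i' \<and> j = j' \<and> l = l'"
  shows "distinct (concat (map (\<lambda>i. concat (map (\<lambda>j. map (f i j) [0..<n3]) [0..<n2])) [0..<n1]))"
  by (rule distinct_concat_map, simp, rule distinct_concat_map) (auto simp: distinct_map inj_on_def assms)

lemma distinct_pairs:
  assumes "\<And>i l i' l'. f i l = f i' l' \<longleftrightarrow> i = i' \<and> l = l'"
  shows "distinct (concat (map (\<lambda>i. map (f i) [0..<n2]) [0..<n1]))"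
  by (rule distinct_concat_map) (auto simp: distinct_map inj_on_def assms)

text \<open>The class number separates the blocks of \<open>y_states\<close>, which spares the
  comparison of all pairs of constructors when distinctness is proved.\<close>

primrec y_class :: "ystate \<Rightarrow> nat" where
    "y_class (Y1 i j l) = 1"
  | "y_class (Y2 i j l) = 2"
  | "y_class (Y3 i j l) = 3"
  | "y_class (Y4 i j l) = 4"
  | "y_class (Y5 i l) = 5"
  | "y_class (Y6 j l) = 6"
  | "y_class (Y7 l) = 7"
  | "y_class (Y8 i j) = 8"
  | "y_class (Y9 i l) = 9"
  | "y_class (Y10 j l) = 10"
  | "y_class (Y11 i j l) = 11"
  | "y_class (Y12 i j l) = 12"
  | "y_class (Y13 i l) = 13"
  | "y_class (Y14 j l) = 14"
  | "y_class (Y15) = 15"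
  | "y_class (Y16) = 16"

lemma distinct_append_class:
  assumes "distinct xs" "distinct ys" "\<forall>x\<in>set xs. y_class x = c" "\<forall>y\<in>set ys. c < y_class y"
  shows "distinct (xs @ ys)"
  using assms by fastforce

text \<open>Distinctness identifies sums over matrix indices with sums over states and lets a vector
  be read back as a function of the state.\<close>

lemma distinct_y_states: "distinct y_states"
proof -
  have 7: "distinct (map Y7 [0..<k])" by (simp add: distinct_map inj_on_def)
  show ?thesis
    unfolding y_states_def
    apply (rule distinct_append_class[where c = 1])
       apply (rule distinct_triples, simp)
    apply (rule distinct_append_class[where c = 2])
       apply (rule distinct_triples, simp)
    apply (rule distinct_append_class[where c = 3])
       apply (rule distinct_triples, simp)
    apply (rule distinct_append_class[where c = 4])
       apply (rule distinct_triples, simp)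
    apply (rule distinct_append_class[where c = 5])
       apply (rule distinct_pairs, simp)
    apply (rule distinct_append_class[where c = 6])
       apply (rule distinct_pairs, simp)
    apply (rule distinct_append_class[where c = 7])
       apply (rule 7)
    apply (rule distinct_append_class[where c = 8])
       apply (rule distinct_pairs, simp)
    apply (rule distinct_append_class[where c = 9])
       apply (rule distinct_pairs, simp)
    apply (rule distinct_append_class[where c = 10])
       apply (rule distinct_pairs, simp)
    apply (rule distinct_append_class[where c = 11])
       apply (rule distinct_triples, simp)
    apply (rule distinct_append_class[where c = 12])
       apply (rule distinct_triples, simp)
    apply (rule distinct_append_class[where c = 13])
       apply (rule distinct_pairs, simp)
               apply (rule distinct_pairs, simp)
               apply (simp_all only: Ball_def mem_blocks)
               apply auto
    done
qed

lemma ysum_set: "ysum f = (\<Sum>y\<in>set y_states. f y)"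
  by (simp add: ysum_def sum_list_distinct_conv_sum_set distinct_y_states)

lemma Aop_cong: "(\<And>y. y \<in> set y_states \<Longrightarrow> f y = g y) \<Longrightarrow> Aop f = Aop g"
  by (simp add: Aop_def ysum_set fun_eq_iff)

lemma Aop_add: "Aop (\<lambda>y. f y + g y) y = Aop f y + Aop g y"
  by (simp add: Aop_def ysum_set distrib_left sum.distrib)

lemma Aop_diff: "Aop (\<lambda>y. f y - g y) y = Aop f y - Aop g y"
  by (simp add: Aop_def ysum_set right_diff_distrib sum_subtractf)

lemma Aop_scale: "Aop (\<lambda>y. c * f y) y = c * Aop f y"
  by (simp add: Aop_def ysum_set sum_distrib_left mult.left_commute)

lemma length_ys: "y_dim = length y_states"
  by (simp add: length_y_states)

lemma sum_index: "(\<Sum>c<y_dim. f (y_states ! c)) = ysum f"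
  by (simp add: ysum_def length_ys sum_list_sum_nth lessThan_atLeast0)

lemma A_mat_vec: "A_mat *\<^sub>v Matrix.vec y_dim (\<lambda>r. f (y_states ! r)) = Matrix.vec y_dim (\<lambda>r. Aop f (y_states ! r))"
  by (intro eq_vecI)
     (simp_all add: A_mat_def scalar_prod_def Aop_def sum_index[symmetric] lessThan_atLeast0)

lemma A_mat_pow_vec: "(A_mat ^\<^sub>m h) *\<^sub>v Matrix.vec y_dim (\<lambda>r. f (y_states ! r))
    = Matrix.vec y_dim (\<lambda>r. (Aop ^^ h) f (y_states ! r))"
proof (induction h arbitrary: f)
  case 0
  have "A_mat \<in> carrier_mat y_dim y_dim" by (simp add: A_mat_def)
  then show ?case by (simp add: one_mult_mat_vec)
next
  case (Suc h)
  have A: "A_mat \<in> carrier_mat y_dim y_dim" by (simp add: A_mat_def)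
  have "(A_mat ^\<^sub>m Suc h) *\<^sub>v Matrix.vec y_dim (\<lambda>r. f (y_states ! r))
      = A_mat ^\<^sub>m h *\<^sub>v (A_mat *\<^sub>v Matrix.vec y_dim (\<lambda>r. f (y_states ! r)))"
    using A by (simp add: assoc_mult_mat_vec[OF pow_carrier_mat[OF A] A])
  also have "\<dots> = Matrix.vec y_dim (\<lambda>r. (Aop ^^ h) (Aop f) (y_states ! r))"
    by (simp add: A_mat_vec Suc)
  finally show ?case by (simp add: funpow_swap1)
qed

lemma c_succ_vec: "c_succ = Matrix.vec y_dim (\<lambda>r. csuc (y_states ! r))"
  by (simp add: c_succ_def csuc_def)

end

section \<open>Transience of Y\<close>

context stable_queue
begin

text \<open>Between generations the clock only rises, so an equation that refers to the next clock
  value is solved downwards from k - 1.\<close>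

lemma clock_induct [consumes 1, case_names step]:
  assumes "l < k" and "\<And>l. l < k \<Longrightarrow> (Suc l < k \<Longrightarrow> P (Suc l)) \<Longrightarrow> P l"
  shows "P l"
  using assms(1)
proof (induction "k - l" arbitrary: l rule: less_induct)
  case less
  then show ?case by (auto intro: assms(2)[OF less.prems])
qed

text \<open>Below k - 1 the sum refers to the next clock value, where \<open>u\<close> vanishes by
  induction; at k - 1 the clock stands still and \<open>both_busy_fixpoint\<close> applies.\<close>

lemma busy_fixpoint:
  assumes fixp: "\<And>i j l. i < N S1 \<Longrightarrow> j < N S2 \<Longrightarrow> l < k \<Longrightarrow>
      u i j l = (\<Sum>i'<N S1. \<Sum>j'<N S2. B1 i i' * B2 j j' * u i' j' (min (Suc l) (k - 1)))"
    and "l < k" "i < N S1" "j < N S2"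
  shows "u i j l = (0 :: real)"
  using assms(2-)
proof (induction l arbitrary: i j rule: clock_induct)
  case (step l)
  show ?case
  proof (cases "Suc l < k")
    case True
    then have "min (Suc l) (k - 1) = Suc l" by linarith
    have "u i j l = (\<Sum>i'<N S1. \<Sum>j'<N S2. B1 i i' * B2 j j' * u i' j' (min (Suc l) (k - 1)))"
      using step.prems step.hyps by (intro fixp)
    also have "\<dots> = 0"
      using True step.IH[OF True] \<open>min (Suc l) (k - 1) = Suc l\<close> by (intro sum.neutral ballI) auto
    finally show ?thesis .
  next
    case False
    then have "l = k - 1" "min (Suc l) (k - 1) = l" using step by auto
    have "u i j l = (\<Sum>i'<N S1. \<Sum>j'<N S2. B1 i i' * B2 j j' * u i' j' l)" if "i < N S1" "j < N S2" for i j
      using fixp[OF that \<open>l < k\<close>] unfolding \<open>min (Suc l) (k - 1) = l\<close> .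
    then show ?thesis
      using step.prems by (rule both_busy_fixpoint)
  qed
qed

text \<open>Each class leads only to itself and to classes settled before it, in the order 8; 13,
  14; 7; 2, 3, 11, 12; 9, 10, 5, 6; 1, 4. Within a class either the clock rises, and
  \<open>clock_induct\<close> applies, or both servers are busy, and survival probabilities force
  \<open>u\<close> to vanish.\<close>

lemma Aop_fixpoint:
  assumes fixp: "\<And>y. y \<in> set y_states \<Longrightarrow> u y = Aop u y" and y: "y \<in> set y_states"
  shows "u y = 0"
proof -
  have k0: "0 < k" using k_ge by simp
  have 8: "u (Y8 i j) = 0" if "i < N S1" "j < N S2" for i j
    using that by (intro both_busy_fixpoint[of "\<lambda>i j. u (Y8 i j)"])
      (rule trans[OF fixp]; simp add: Aop_eqs(8)[OF k0])
  have 13: "u (Y13 i l) = 0" if "l < k" "i < N S1" for i l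
    using that
  proof (induction l arbitrary: i rule: clock_induct)
    case (step l)
    then show ?case by (subst fixp) (auto simp: Aop_eqs 8)
  qed
  have 14: "u (Y14 i l) = 0" if "l < k" "i < N S2" for i l
    using that
  proof (induction l arbitrary: i rule: clock_induct)
    case (step l)
    then show ?case by (subst fixp) (auto simp: Aop_eqs 8)
  qed
  have 7: "u (Y7 l) = 0" if "l < k" for l
    using that
  proof (induction l rule: clock_induct)
    case (step l)
    then show ?case by (subst fixp) (auto simp: Aop_eqs idleF_def 13 14 k0)
  qed
  have F: "idleF u l = 0" if "l < k" for l
    using that 7 13 14 by (simp add: idleF_def k0)
  have 2: "u (Y2 i j l) = 0" if "l < k" "i < N S1" "j < N S2" for i j l
    using that by (intro busy_fixpoint[of "\<lambda>i j l. u (Y2 i j l)"]) (rule trans[OF fixp]; simp add: Aop_eqs 14 8)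
  have 3: "u (Y3 i j l) = 0" if "l < k" "i < N S1" "j < N S2" for i j l
    using that by (intro busy_fixpoint[of "\<lambda>i j l. u (Y3 i j l)"]) (rule trans[OF fixp]; simp add: Aop_eqs 13 8)
  have 11: "u (Y11 i j l) = 0" if "l < k" "i < N S1" "j < N S2" for i j l
    using that by (intro busy_fixpoint[of "\<lambda>i j l. u (Y11 i j l)"]) (rule trans[OF fixp]; simp add: Aop_eqs 13 8)
  have 12: "u (Y12 i j l) = 0" if "l < k" "i < N S1" "j < N S2" for i j l
    using that by (intro busy_fixpoint[of "\<lambda>i j l. u (Y12 i j l)"]) (rule trans[OF fixp]; simp add: Aop_eqs 14 8)
  have 9: "u (Y9 i l) = 0" if "l < k" "i < N S1" for i l
    using that
  proof (induction l arbitrary: i rule: clock_induct)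
    case (step l)
    then show ?case by (subst fixp) (auto simp: Aop_eqs F 12 k0)
  qed
  have 10: "u (Y10 i l) = 0" if "l < k" "i < N S2" for i l
    using that
  proof (induction l arbitrary: i rule: clock_induct)
    case (step l)
    then show ?case by (subst fixp) (auto simp: Aop_eqs F 11 k0)
  qed
  have 5: "u (Y5 i l) = 0" if "l < k" "i < N S1" for i l
    using that
  proof (induction l arbitrary: i rule: clock_induct)
    case (step l)
    then show ?case by (subst fixp) (auto simp: Aop_eqs F 2 k0)
  qed
  have 6: "u (Y6 i l) = 0" if "l < k" "i < N S2" for i l
    using that
  proof (induction l arbitrary: i rule: clock_induct)
    case (step l)
    then show ?case by (subst fixp) (auto simp: Aop_eqs F 3 k0)
  qed
  have 1: "u (Y1 i j l) = 0" if "l < k" "i < N S1" "j < N S2" for i j l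
    using that by (intro busy_fixpoint[of "\<lambda>i j l. u (Y1 i j l)"]) (rule trans[OF fixp]; simp add: Aop_eqs F 10 5 11 2 k0)
  have 4: "u (Y4 i j l) = 0" if "l < k" "i < N S1" "j < N S2" for i j l
    using that by (intro busy_fixpoint[of "\<lambda>i j l. u (Y4 i j l)"]) (rule trans[OF fixp]; simp add: Aop_eqs F 6 9 3 12 k0)
  show ?thesis
    using y 1 2 3 4 5 6 7 8 9 10 11 12 13 14 by (cases y rule: ystate.exhaust) auto
qed

lemma to_F_nonneg: "0 \<le> w \<Longrightarrow> y \<in> set y_states \<Longrightarrow> 0 \<le> to_F l w y"
  by (cases y) (auto simp: alpha_nonneg)

lemma y_step_nonneg:
  assumes "y \<in> set y_states" "y' \<in> set y_states"
  shows "0 \<le> y_step y y'"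
  using assms
  by (cases y rule: ystate.exhaust; cases y' rule: ystate.exhaust;
      simp add: alpha_nonneg b_nonneg B_nonneg mult_nonneg_nonneg)

lemma Aop_mono:
  assumes "\<And>y. y \<in> set y_states \<Longrightarrow> f y \<le> g y" "y \<in> set y_states"
  shows "Aop f y \<le> Aop g y"
  unfolding Aop_def ysum_set using assms y_step_nonneg
  by (intro sum_mono mult_left_mono) auto

text \<open>What is missing to 1 is the probability of moving to state 16.\<close>

lemma Aop_1_le: 
  assumes "y \<in> set y_states"
  shows "Aop (\<lambda>_. 1) y + csuc y \<le> 1"
proof -
  have dbl: "(\<Sum>i\<in>I. \<Sum>j\<in>J. f i * g j) = sum f I * sum g J" "(\<Sum>i\<in>I. \<Sum>j\<in>J. g j * f i) = sum g J * sum f I"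
    for f g :: "nat \<Rightarrow> real" and I J
    by (simp_all add: sum_distrib_right[symmetric] sum_distrib_left[symmetric])
  have F: "idleF (\<lambda>_. 1) l = 1" for l
    by (simp add: idleF_def alpha_sum)
  have k0: "0 < k" using k_ge by simp
  show ?thesis
    using assms
    by (cases y rule: ystate.exhaust)
       (simp_all add: Aop_eqs Aop_eqs(8)[OF k0] F csuc_def dbl alpha_sum B_sum,
        simp_all add: b_nonneg b_le algebra_simps)
qed

end

context stable_queue
begin

lemma csuc_nonneg: "y \<in> set y_states \<Longrightarrow> 0 \<le> csuc y"
proof -
  have "0 \<le> x + y - x * y" if "0 \<le> x" "x \<le> 1" "0 \<le> y" for x y :: real
  proof -
    have "0 \<le> x + y * (1 - x)" using that by simp
    then show ?thesis by (simp add: algebra_simps)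
  qed
  then show "y \<in> set y_states \<Longrightarrow> 0 \<le> csuc y"
    by (cases y rule: ystate.exhaust) (simp_all add: csuc_def b_nonneg b_le)
qed

lemma Apow_mono:
  assumes "\<And>y. y \<in> set y_states \<Longrightarrow> f y \<le> g y" "y \<in> set y_states"
  shows "(Aop ^^ t) f y \<le> (Aop ^^ t) g y"
  using assms(2) by (induction t arbitrary: y) (auto intro: assms(1) Aop_mono)

lemma Aop_0: "Aop (\<lambda>_. 0) y = 0"
  by (simp add: Aop_def ysum_set)

lemma Apow_nonneg:
  assumes "\<And>y. y \<in> set y_states \<Longrightarrow> 0 \<le> f y" "y \<in> set y_states"
  shows "0 \<le> (Aop ^^ t) f y"
proof -
  have "(Aop ^^ t) (\<lambda>_. 0) = (\<lambda>_. 0)"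
    by (induction t) (auto simp: Aop_0)
  then show ?thesis
    using Apow_mono[of "\<lambda>_. 0" f y t] assms by simp
qed

lemma Aop_tendsto:
  assumes "\<And>y. y \<in> set y_states \<Longrightarrow> (\<lambda>t. f t y) \<longlonglongrightarrow> u y"
  shows "(\<lambda>t. Aop (f t) y) \<longlonglongrightarrow> Aop u y"
  unfolding Aop_def ysum_set using assms by (intro tendsto_sum tendsto_mult tendsto_const)

lemma Aop_1_le_1: "y \<in> set y_states \<Longrightarrow> Aop (\<lambda>_. 1) y \<le> 1"
  using Aop_1_le[of y] csuc_nonneg[of y] by simp

lemma Apow_1_dec:
  assumes "y \<in> set y_states"
  shows "(Aop ^^ Suc t) (\<lambda>_. 1) y \<le> (Aop ^^ t) (\<lambda>_. 1) y"
  unfolding funpow_Suc_right comp_def using assms Aop_1_le_1 by (intro Apow_mono)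

text \<open>The sequence decreases and is nonnegative, so it has a limit; the limit is a fixpoint of
  A and hence 0.\<close>

lemma Apow_1_tendsto:
  assumes "y \<in> set y_states"
  shows "(\<lambda>t. (Aop ^^ t) (\<lambda>_. 1) y) \<longlonglongrightarrow> 0"
proof -
  define u where "u y = lim (\<lambda>t. (Aop ^^ t) (\<lambda>_. 1) y)" for y
  have u: "(\<lambda>t. (Aop ^^ t) (\<lambda>_. 1) y) \<longlonglongrightarrow> u y" if "y \<in> set y_states" for y
  proof -
    have "decseq (\<lambda>t. (Aop ^^ t) (\<lambda>_. 1) y)"
      using Apow_1_dec[OF that] by (intro decseq_SucI)
    moreover have "0 \<le> (Aop ^^ t) (\<lambda>_. 1) y" for t
      using that by (intro Apow_nonneg) auto
    ultimately have "convergent (\<lambda>t. (Aop ^^ t) (\<lambda>_. 1) y)"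
      by (intro Bseq_monoseq_convergent decseq_imp_monoseq decseq_bounded[of _ 0]) auto
    then show ?thesis by (simp add: u_def convergent_LIMSEQ_iff)
  qed
  have "u y = Aop u y" if "y \<in> set y_states" for y
  proof (rule LIMSEQ_unique)
    show "(\<lambda>t. (Aop ^^ Suc t) (\<lambda>_. 1) y) \<longlonglongrightarrow> u y"
      using u[OF that] by (rule LIMSEQ_Suc)
    show "(\<lambda>t. (Aop ^^ Suc t) (\<lambda>_. 1) y) \<longlonglongrightarrow> Aop u y"
      using Aop_tendsto[OF u, where y = y] by simp
  qed
  then show ?thesis using u[OF assms] Aop_fixpoint[of u y] assms by simp
qed

section \<open>Success probabilities and the resolvent of A\<close>

definition vsum :: "nat \<Rightarrow> ystate \<Rightarrow> real" where
  "vsum H y = (\<Sum>h<H. (Aop ^^ h) csuc y)"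

text \<open>This is A^h applied to the inequality csuc <= 1 - A 1. The right-hand side telescopes
  when summed over h, which bounds \<open>vsum H\<close>, the probability of success in at most H
  steps.\<close>

lemma Apow_csuc_le:
  assumes "y \<in> set y_states"
  shows "(Aop ^^ h) csuc y \<le> (Aop ^^ h) (\<lambda>_. 1) y - (Aop ^^ Suc h) (\<lambda>_. 1) y"
proof -
  have diff: "(Aop ^^ h) (\<lambda>y. f y - g y) = (\<lambda>y. (Aop ^^ h) f y - (Aop ^^ h) g y)" for f g
    by (induction h) (auto simp: Aop_diff)
  have "(Aop ^^ h) csuc y \<le> (Aop ^^ h) (\<lambda>y. 1 - Aop (\<lambda>_. 1) y) y"
    using assms Aop_1_le by (intro Apow_mono) (auto simp: algebra_simps)
  then show ?thesis by (simp add: diff funpow_swap1)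
qed

lemma vsum_le: 
  assumes "y \<in> set y_states"
  shows "vsum H y \<le> 1 - (Aop ^^ H) (\<lambda>_. 1) y"
proof (induction H)
  case (Suc H)
  then show ?case using Apow_csuc_le[OF assms, of H] by (simp add: vsum_def)
qed (simp add: vsum_def)

lemma vsum_nonneg: "y \<in> set y_states \<Longrightarrow> 0 \<le> vsum H y"
  unfolding vsum_def by (intro sum_nonneg Apow_nonneg csuc_nonneg)

lemma vsum_le_1: "y \<in> set y_states \<Longrightarrow> vsum H y \<le> 1"
  using vsum_le[of y H] Apow_nonneg[of "\<lambda>_. 1" y H] by simp

text \<open>The probability of ever reaching state 15, that is (I - A)^(-1) c as a series.\<close>

definition gsuc :: "ystate \<Rightarrow> real" where
  "gsuc y = (\<Sum>h. (Aop ^^ h) csuc y)"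

lemma gsuc_sums:
  assumes "y \<in> set y_states"
  shows "(\<lambda>h. (Aop ^^ h) csuc y) sums gsuc y"
  unfolding gsuc_def
proof (rule summable_sums, rule bounded_imp_summable[of _ 1])
  fix n
  show "0 \<le> (Aop ^^ n) csuc y" using assms by (intro Apow_nonneg csuc_nonneg)
  show "(\<Sum>h\<le>n. (Aop ^^ h) csuc y) \<le> 1"
    using vsum_le_1[OF assms, of "Suc n"] by (simp add: vsum_def lessThan_Suc_atMost)
qed

lemma vsum_tendsto: "y \<in> set y_states \<Longrightarrow> (\<lambda>H. vsum H y) \<longlonglongrightarrow> gsuc y"
  using gsuc_sums by (simp add: sums_def vsum_def)

lemma gsuc_eq:
  assumes "y \<in> set y_states"
  shows "gsuc y = csuc y + Aop gsuc y"
proof -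
  have "vsum (Suc H) y = csuc y + Aop (vsum H) y" for H
  proof -
    have "Aop (vsum H) y = (\<Sum>h<H. Aop ((Aop ^^ h) csuc) y)"
      unfolding vsum_def Aop_def ysum_set sum_distrib_left by (rule sum.swap)
    then show ?thesis
      by (simp add: vsum_def sum.lessThan_Suc_shift del: sum.lessThan_Suc)
  qed
  then have "(\<lambda>H. vsum (Suc H) y) \<longlonglongrightarrow> csuc y + Aop gsuc y"
    using Aop_tendsto[OF vsum_tendsto] by (simp add: tendsto_add)
  moreover have "(\<lambda>H. vsum (Suc H) y) \<longlonglongrightarrow> gsuc y"
    using vsum_tendsto[OF assms] by (rule LIMSEQ_Suc)
  ultimately show ?thesis by (rule LIMSEQ_unique[rotated])
qed

lemma A_carrier: "A_mat \<in> carrier_mat y_dim y_dim"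
  by (simp add: A_mat_def)

lemma IA_carrier: "1\<^sub>m y_dim - A_mat \<in> carrier_mat y_dim y_dim"
  by (rule minus_carrier_mat[OF A_carrier])

text \<open>A null vector of I - A is a fixpoint of A, hence 0.\<close>

lemma det_IA: "Determinant.det (1\<^sub>m y_dim - A_mat) \<noteq> 0"
proof
  assume "Determinant.det (1\<^sub>m y_dim - A_mat) = 0"
  then obtain v where v: "v \<in> carrier_vec y_dim" "v \<noteq> 0\<^sub>v y_dim" "(1\<^sub>m y_dim - A_mat) *\<^sub>v v = 0\<^sub>v y_dim"
    using det_0_iff_vec_prod_zero[OF IA_carrier] by auto
  \<comment> \<open>Reads the vector back as a function of the state; by
    \<open>distinct_y_states\<close> at most one term of the sum is nonzero.\<close>
  define u where "u y = (\<Sum>r<y_dim. if y_states ! r = y then vec_index v r else 0)" for y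
  have u: "u (y_states ! r) = vec_index v r" if "r < y_dim" for r
  proof -
    have "u (y_states ! r) = (\<Sum>s<y_dim. if s = r then vec_index v s else 0)"
      unfolding u_def using that distinct_y_states
      by (intro sum.cong) (auto simp: nth_eq_iff_index_eq length_ys)
    then show ?thesis using that by simp
  qed
  have vu: "v = Matrix.vec y_dim (\<lambda>r. u (y_states ! r))"
    using v(1) u by (intro eq_vecI) auto
  have eq: "u (y_states ! r) - Aop u (y_states ! r) = 0" if "r < y_dim" for r
  proof -
    have "(1\<^sub>m y_dim - A_mat) *\<^sub>v v = v - A_mat *\<^sub>v v"
      using v(1) A_carrier by (simp add: minus_mult_distrib_mat_vec[of _ y_dim y_dim])
    also have "\<dots> = Matrix.vec y_dim (\<lambda>r. u (y_states ! r) - Aop u (y_states ! r))"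
      by (subst (1 2) vu) (auto simp: A_mat_vec)
    finally have "Matrix.vec y_dim (\<lambda>r. u (y_states ! r) - Aop u (y_states ! r)) = 0\<^sub>v y_dim"
      using v(3) by simp
    then have "vec_index (Matrix.vec y_dim (\<lambda>r. u (y_states ! r) - Aop u (y_states ! r))) r = vec_index (0\<^sub>v y_dim) r"
      by simp
    then show ?thesis using that by simp
  qed
  have "u y = Aop u y" if "y \<in> set y_states" for y
  proof -
    obtain r where "r < y_dim" "y = y_states ! r"
      using \<open>y \<in> set y_states\<close> by (metis in_set_conv_nth length_ys)
    then show ?thesis using eq[of r] by simp
  qed
  then have u0: "u y = 0" if "y \<in> set y_states" for y
    using that by (rule Aop_fixpoint)
  have "vec_index v r = 0" if "r < y_dim" for r
    using u[OF that] u0[of "y_states ! r"] that by (simp add: length_ys)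
  then have "v = 0\<^sub>v y_dim"
    using v(1) by (intro eq_vecI) auto
  then show False using v(2) by simp
qed

lemma inverse_IA:
  obtains W where "mat_inverse (1\<^sub>m y_dim - A_mat) = Some W" "W \<in> carrier_mat y_dim y_dim"
    "W * (1\<^sub>m y_dim - A_mat) = 1\<^sub>m y_dim" "(1\<^sub>m y_dim - A_mat) * W = 1\<^sub>m y_dim"
proof (cases "mat_inverse (1\<^sub>m y_dim - A_mat)")
  case None
  then show ?thesis
    using mat_inverse(1)[OF IA_carrier, of "()"] det_non_zero_imp_unit[OF IA_carrier det_IA, of "()"] by blast
next
  case (Some W)
  then show ?thesis using mat_inverse(2)[OF IA_carrier Some] that by blast
qed

lemma invertible_IA: "invertible_mat (1\<^sub>m y_dim - A_mat)"
proof -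
  obtain W where "W \<in> carrier_mat y_dim y_dim" "W * (1\<^sub>m y_dim - A_mat) = 1\<^sub>m y_dim" "(1\<^sub>m y_dim - A_mat) * W = 1\<^sub>m y_dim"
    by (rule inverse_IA)
  then show ?thesis using carrier_matD[OF A_carrier]
    unfolding invertible_mat_def inverts_mat_def by (intro conjI exI[of _ W]) auto
qed

text \<open>The first-step equation \<open>gsuc_eq\<close> says (I - A) gsuc = c, so the inverse
  applied to c is gsuc.\<close>

lemma resolvent_vec:
  "(A_mat * the (mat_inverse (1\<^sub>m y_dim - A_mat))) *\<^sub>v c_succ = Matrix.vec y_dim (\<lambda>r. Aop gsuc (y_states ! r))"
proof -
  obtain W where W: "mat_inverse (1\<^sub>m y_dim - A_mat) = Some W" "W \<in> carrier_mat y_dim y_dim"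
    "W * (1\<^sub>m y_dim - A_mat) = 1\<^sub>m y_dim"
    by (rule inverse_IA)
  let ?g = "Matrix.vec y_dim (\<lambda>r. gsuc (y_states ! r))"
  have "(1\<^sub>m y_dim - A_mat) *\<^sub>v ?g = ?g - A_mat *\<^sub>v ?g"
    using A_carrier by (simp add: minus_mult_distrib_mat_vec[of _ y_dim y_dim])
  also have "\<dots> = c_succ"
  proof -
    have "gsuc (y_states ! r) - Aop gsuc (y_states ! r) = csuc (y_states ! r)" if "r < y_dim" for r
      using gsuc_eq[of "y_states ! r"] that by (simp add: length_ys)
    then show ?thesis by (intro eq_vecI) (simp_all add: A_mat_vec c_succ_vec)
  qed
  finally have c: "c_succ = (1\<^sub>m y_dim - A_mat) *\<^sub>v ?g" by simp
  have "W *\<^sub>v c_succ = (W * (1\<^sub>m y_dim - A_mat)) *\<^sub>v ?g"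
    unfolding c using W(2) IA_carrier by (simp add: assoc_mult_mat_vec[of _ y_dim y_dim _ y_dim])
  then have "W *\<^sub>v c_succ = ?g" by (simp add: W(3))
  moreover have "c_succ \<in> carrier_vec y_dim" by (simp add: c_succ_def)
  ultimately show ?thesis
    using W(1,2) A_carrier by (simp add: assoc_mult_mat_vec[of _ y_dim y_dim _ y_dim] A_mat_vec)
qed

text \<open>The probability that a stationary slot ends with a generation; it normalises
  sigma.\<close>

definition qtot :: "rstate pmf \<Rightarrow> real" where
  "qtot p = ysum (q_init p)"

lemma sigma_prod:
  "scalar_prod (sigma p) (Matrix.vec y_dim (\<lambda>r. f (y_states ! r))) = ysum (\<lambda>y. q_init p y * f y) / qtot p"
proof -
  have "scalar_prod (sigma p) (Matrix.vec y_dim (\<lambda>r. f (y_states ! r)))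
      = (\<Sum>r<y_dim. (q_init p (y_states ! r) * f (y_states ! r)) / qtot p)"
    by (simp add: scalar_prod_def sigma_def lessThan_atLeast0[symmetric] sum_index qtot_def)
  also have "\<dots> = (\<Sum>r<y_dim. q_init p (y_states ! r) * f (y_states ! r)) / qtot p"
    by (rule sum_divide_distrib[symmetric])
  finally show ?thesis by (simp add: sum_index[of "\<lambda>y. q_init p y * f y"])
qed

text \<open>A new packet starts in class 1, 4, 5 or 6, none of which reaches 15 in one step.\<close>

lemma q_csuc: "ysum (\<lambda>y. q_init p y * csuc y) = 0"
proof -
  have "q_init p y * csuc y = 0" for y by (cases y) (simp_all add: csuc_def)
  then show ?thesis unfolding ysum_set by (rule sum.neutral[OF ballI])
qed

text \<open>By \<open>q_csuc\<close> the term h = 0 of the series for gsuc contributes nothing, so A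
  (I - A)^(-1) c and (I - A)^(-1) c have the same product with sigma.\<close>

lemma denominator:
  "scalar_prod (sigma p) ((A_mat * the (mat_inverse (1\<^sub>m y_dim - A_mat))) *\<^sub>v c_succ)
     = ysum (\<lambda>y. q_init p y * gsuc y) / qtot p"
proof -
  have "ysum (\<lambda>y. q_init p y * gsuc y) = ysum (\<lambda>y. q_init p y * csuc y + q_init p y * Aop gsuc y)"
    unfolding ysum_set
  proof (rule sum.cong[OF refl])
    fix y assume "y \<in> set y_states"
    then show "q_init p y * gsuc y = q_init p y * csuc y + q_init p y * Aop gsuc y"
      unfolding distrib_left[symmetric] by (rule arg_cong[OF gsuc_eq])
  qed
  also have "\<dots> = ysum (\<lambda>y. q_init p y * Aop gsuc y)"
    using q_csuc[of p] by (simp add: ysum_set sum.distrib)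
  finally show ?thesis by (simp add: resolvent_vec sigma_prod)
qed

lemma numerator:
  "scalar_prod (sigma p) ((A_mat ^\<^sub>m h) *\<^sub>v c_succ) = ysum (\<lambda>y. q_init p y * (Aop ^^ h) csuc y) / qtot p"
  by (simp add: c_succ_vec A_mat_pow_vec sigma_prod)

end

section \<open>Cesaro averages under a unique stationary distribution\<close>

lemma finite_family_convergent_subsequence:
  fixes X :: "nat \<Rightarrow> 's \<Rightarrow> real"
  assumes "finite S" and "\<And>s. s \<in> S \<Longrightarrow> bounded (range (\<lambda>n. X n s))"
  shows "\<exists>\<psi> l. strict_mono \<psi> \<and> (\<forall>s\<in>S. (\<lambda>n. X (\<psi> n) s) \<longlonglongrightarrow> l s)"
  using assms
proof (induction S rule: finite_induct)
  case empty
  then show ?case by (intro exI[of _ "\<lambda>n. n"]) (simp add: strict_mono_def)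
next
  case (insert x S)
  then obtain \<psi> l where \<psi>: "strict_mono \<psi>" "\<And>s. s \<in> S \<Longrightarrow> (\<lambda>n. X (\<psi> n) s) \<longlonglongrightarrow> l s" by auto
  have "bounded (range (\<lambda>n. X (\<psi> n) x))"
    using insert.prems[of x] by (rule bounded_subset[OF _ ]) auto
  then obtain y \<phi> where \<phi>: "strict_mono \<phi>" "((\<lambda>n. X (\<psi> n) x) \<circ> \<phi>) \<longlonglongrightarrow> y"
    using bounded_imp_convergent_subsequence by blast
  have "(\<lambda>n. X ((\<psi> \<circ> \<phi>) n) s) \<longlonglongrightarrow> (l(x := y)) s" if "s \<in> insert x S" for s
  proof (cases "s = x")
    case False
    then show ?thesis using LIMSEQ_subseq_LIMSEQ[OF \<psi>(2) \<phi>(1), of s] that by (simp add: comp_def)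
  qed (use \<phi>(2) in \<open>simp add: comp_def\<close>)
  then show ?case using strict_mono_o[OF \<psi>(1) \<phi>(1)] by blast
qed

text \<open>The averages of the first n laws of the chain started in \<open>w\<close> are
  probability vectors, stationary up to an error 1 / n. By compactness every subsequence has a
  convergent further one; its limit is stationary and so equals \<open>p\<close>. The laws
  themselves may oscillate, since the chain may be periodic.\<close>

lemma cesaro_unique_stationary:
  fixes K :: "'s \<Rightarrow> 's \<Rightarrow> real" and S :: "'s set"
  defines "T \<equiv> \<lambda>F w. \<Sum>w'\<in>S. K w w' * F w'"
  assumes fin: "finite S"
    and nonneg: "\<And>s s'. s \<in> S \<Longrightarrow> s' \<in> S \<Longrightarrow> 0 \<le> K s s'"
    and rows: "\<And>s. s \<in> S \<Longrightarrow> (\<Sum>s'\<in>S. K s s') = 1"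
    and uniq: "\<And>\<pi>. (\<And>s. s \<in> S \<Longrightarrow> 0 \<le> \<pi> s) \<Longrightarrow> sum \<pi> S = 1 \<Longrightarrow>
        (\<And>s. s \<in> S \<Longrightarrow> \<pi> s = (\<Sum>s'\<in>S. \<pi> s' * K s' s)) \<Longrightarrow> (\<And>s. s \<in> S \<Longrightarrow> \<pi> s = p s)"
    and w: "w \<in> S"
  shows "(\<lambda>n. (\<Sum>r<n. (T ^^ r) F w) / real n) \<longlonglongrightarrow> (\<Sum>s\<in>S. p s * F s)"
proof -
  define P where "P r s = (T ^^ r) (\<lambda>x. of_bool (x = s)) w" for r s
  have T_sum: "T (\<lambda>x. \<Sum>s\<in>S. g s * f s x) = (\<lambda>x. \<Sum>s\<in>S. g s * T (f s) x)" for g f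
    unfolding T_def by (rule ext) (simp add: sum_distrib_left mult.left_commute, rule sum.swap)
  have Tpow_sum: "(T ^^ r) (\<lambda>x. \<Sum>s\<in>S. g s * f s x) = (\<lambda>x. \<Sum>s\<in>S. g s * (T ^^ r) (f s) x)" for g f r
    by (induction r) (simp_all add: T_sum)
  have T_cong: "T F = T G" if "\<And>s. s \<in> S \<Longrightarrow> F s = G s" for F G
    unfolding T_def using that by (intro ext sum.cong) auto
  have Tpow_cong: "(T ^^ r) F w = (T ^^ r) G w" if "\<And>s. s \<in> S \<Longrightarrow> F s = G s" for F G r
    using that w by (cases r) (simp_all add: funpow_Suc_right T_cong[of F G] del: funpow.simps)
  have expand: "(T ^^ r) F w = (\<Sum>s\<in>S. F s * P r s)" for r F
  proof -
    have "F x = (\<Sum>s\<in>S. F s * of_bool (x = s))" if "x \<in> S" for x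
      using fin that by (simp add: sum.delta' if_distrib cong: if_cong)
    then have "(T ^^ r) F w = (T ^^ r) (\<lambda>x. \<Sum>s\<in>S. F s * of_bool (x = s)) w"
      by (intro Tpow_cong)
    then show ?thesis by (simp add: Tpow_sum P_def)
  qed
  have P_Suc: "P (Suc r) s = (\<Sum>s'\<in>S. P r s' * K s' s)" if "s \<in> S" for r s
  proof -
    have "T (\<lambda>x. of_bool (x = s)) s' = K s' s" for s'
      unfolding T_def using fin that by (simp add: sum.delta' if_distrib cong: if_cong)
    then show ?thesis
      by (simp add: P_def funpow_Suc_right expand[of r "T _"] mult.commute del: funpow.simps)
  qed
  have P_nonneg: "0 \<le> P r s" if "s \<in> S" for r s
    using that w by (induction r arbitrary: s) (auto simp: P_Suc intro!: sum_nonneg mult_nonneg_nonneg nonneg, simp add: P_def)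
  have P_sum: "(\<Sum>s\<in>S. P r s) = 1" for r
  proof (induction r)
    case 0
    show ?case using fin w by (simp add: P_def sum.delta')
  next
    case (Suc r)
    have "(\<Sum>s\<in>S. P (Suc r) s) = (\<Sum>s\<in>S. \<Sum>s'\<in>S. P r s' * K s' s)"
      by (simp add: P_Suc)
    also have "\<dots> = (\<Sum>s'\<in>S. P r s' * (\<Sum>s\<in>S. K s' s))"
      by (simp add: sum_distrib_left) (rule sum.swap)
    finally show ?case using Suc by (simp add: rows)
  qed
  have P_le: "P r s \<le> 1" if "s \<in> S" for r s
    using member_le_sum[of s S "P r"] P_nonneg P_sum[of r] fin that by simp
  define \<mu> where "\<mu> n s = (\<Sum>r<n. P r s) / real n" for n s
  have \<mu>_nonneg: "0 \<le> \<mu> n s" if "s \<in> S" for n s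
    using P_nonneg[OF that] by (auto simp: \<mu>_def intro!: divide_nonneg_nonneg sum_nonneg)
  have \<mu>_le: "\<mu> n s \<le> 1" if "s \<in> S" for n s
  proof -
    have "(\<Sum>r<n. P r s) \<le> (\<Sum>r<n. 1)" using P_le[OF that] by (rule sum_mono)
    then have "(\<Sum>r<n. P r s) \<le> real n" by simp
    then show ?thesis by (cases "n > 0") (simp_all only: \<mu>_def pos_divide_le_eq of_nat_0_less_iff mult_1, simp)
  qed
  have \<mu>_sum: "(\<Sum>s\<in>S. \<mu> n s) = 1" if "n > 0" for n
  proof -
    have "(\<Sum>s\<in>S. \<mu> n s) = (\<Sum>s\<in>S. \<Sum>r<n. P r s) / real n"
      by (simp add: \<mu>_def sum_divide_distrib)
    also have "(\<Sum>s\<in>S. \<Sum>r<n. P r s) = real n"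
      by (subst sum.swap) (simp add: P_sum)
    finally show ?thesis using that by simp
  qed
  \<comment> \<open>In the average the differences of consecutive laws telescope to two boundary
    terms, both in [0, 1].\<close>
  have \<mu>_K: "\<bar>(\<Sum>s'\<in>S. \<mu> n s' * K s' s) - \<mu> n s\<bar> \<le> 1 / real n" if "s \<in> S" for n s
  proof -
    have "(\<Sum>s'\<in>S. \<mu> n s' * K s' s) = (\<Sum>s'\<in>S. \<Sum>r<n. P r s' * K s' s) / real n"
      by (simp add: \<mu>_def sum_divide_distrib sum_distrib_right)
    also have "(\<Sum>s'\<in>S. \<Sum>r<n. P r s' * K s' s) = (\<Sum>r<n. P (Suc r) s)"
      by (subst sum.swap) (simp add: P_Suc[OF that])
    finally have "(\<Sum>s'\<in>S. \<mu> n s' * K s' s) - \<mu> n s = (\<Sum>r<n. P (Suc r) s - P r s) / real n"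
      by (simp add: \<mu>_def sum_subtractf diff_divide_distrib)
    also have "\<dots> = (P n s - P 0 s) / real n"
      by (subst sum_lessThan_telescope) simp
    finally show ?thesis
      using P_nonneg[OF that, of n] P_nonneg[OF that, of 0] P_le[OF that, of n] P_le[OF that, of 0]
      by (auto simp: abs_divide intro!: divide_right_mono)
  qed
  have lim: "(\<lambda>n. \<mu> n s) \<longlonglongrightarrow> p s" if s: "s \<in> S" for s
  proof (rule ccontr)
    assume "\<not> (\<lambda>n. \<mu> n s) \<longlonglongrightarrow> p s"
    then obtain e where e: "e > 0" "\<not> (\<forall>\<^sub>F n in sequentially. dist (\<mu> n s) (p s) < e)"
      by (auto simp: tendsto_iff)
    then have "infinite {n. e \<le> dist (\<mu> n s) (p s)}"
      by (auto simp: infinite_nat_iff_unbounded_le eventually_sequentially not_less)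
    \<comment> \<open>Along \<open>\<phi>\<close> the averages stay at distance \<open>e\<close>
      from \<open>p s\<close>; a convergent subsequence taken inside it will contradict
      uniqueness.\<close>
    then obtain \<phi> :: "nat \<Rightarrow> nat" where \<phi>: "strict_mono \<phi>" "\<And>n. e \<le> dist (\<mu> (\<phi> n) s) (p s)"
      using infinite_enumerate[of "{n. e \<le> dist (\<mu> n s) (p s)}"] by auto
    have "bounded (range (\<lambda>n. \<mu> (\<phi> n) s))" if "s \<in> S" for s
      using \<mu>_nonneg[OF that] \<mu>_le[OF that] by (intro boundedI[of _ 1]) auto
    then obtain \<psi> l where \<psi>: "strict_mono \<psi>" "\<And>s. s \<in> S \<Longrightarrow> (\<lambda>n. \<mu> (\<phi> (\<psi> n)) s) \<longlonglongrightarrow> l s"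
      using finite_family_convergent_subsequence[OF fin, of "\<lambda>n. \<mu> (\<phi> n)"] by auto
    define \<theta> where "\<theta> n = \<phi> (\<psi> n)" for n
    have \<theta>: "strict_mono \<theta>" using strict_mono_o[OF \<phi>(1) \<psi>(1)] by (simp add: \<theta>_def[abs_def] comp_def)
    have l: "(\<lambda>n. \<mu> (\<theta> n) s) \<longlonglongrightarrow> l s" if "s \<in> S" for s
      using \<psi>(2)[OF that] by (simp add: \<theta>_def)
    have ev: "\<forall>\<^sub>F n in sequentially. \<theta> n > 0"
      using filterlim_subseq[OF \<theta>] eventually_gt_at_top[of 0] by (rule filterlim_iff[THEN iffD1, rule_format])
    have "l s = p s"
    proof (rule uniq[of l])
      show "0 \<le> l s" if "s \<in> S" for s
        using l[OF that] \<mu>_nonneg[OF that] by (intro LIMSEQ_le_const[OF l[OF that]]) auto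
      have "(\<lambda>n. \<Sum>s\<in>S. \<mu> (\<theta> n) s) \<longlonglongrightarrow> sum l S" using l by (intro tendsto_sum)
      moreover have "(\<lambda>n. \<Sum>s\<in>S. \<mu> (\<theta> n) s) \<longlonglongrightarrow> 1"
        using ev by (intro tendsto_eventually) (auto elim!: eventually_mono simp: \<mu>_sum)
      ultimately show "sum l S = 1" by (rule LIMSEQ_unique)
      fix s assume s: "s \<in> S"
      have "(\<lambda>n. (\<Sum>s'\<in>S. \<mu> (\<theta> n) s' * K s' s) - \<mu> (\<theta> n) s) \<longlonglongrightarrow> (\<Sum>s'\<in>S. l s' * K s' s) - l s"
        using l s by (intro tendsto_intros)
      moreover have "(\<lambda>n. (\<Sum>s'\<in>S. \<mu> (\<theta> n) s' * K s' s) - \<mu> (\<theta> n) s) \<longlonglongrightarrow> 0"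
      proof (rule Lim_null_comparison)
        show "\<forall>\<^sub>F n in sequentially. norm ((\<Sum>s'\<in>S. \<mu> (\<theta> n) s' * K s' s) - \<mu> (\<theta> n) s) \<le> 1 / real (\<theta> n)"
          using \<mu>_K[OF s] by simp
        show "(\<lambda>n. 1 / real (\<theta> n)) \<longlonglongrightarrow> 0"
          using LIMSEQ_subseq_LIMSEQ[OF lim_1_over_n \<theta>] by (simp add: comp_def)
      qed
      ultimately show "l s = (\<Sum>s'\<in>S. l s' * K s' s)"
        using LIMSEQ_unique by fastforce
    qed (use s in auto)
    then have "(\<lambda>n. \<mu> (\<theta> n) s) \<longlonglongrightarrow> p s" using l[OF s] by simp
    then have "\<forall>\<^sub>F n in sequentially. dist (\<mu> (\<theta> n) s) (p s) < e"
      using e(1) by (auto simp: tendsto_iff)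
    then obtain n where "dist (\<mu> (\<theta> n) s) (p s) < e"
      by (auto simp: eventually_sequentially)
    then show False using \<phi>(2)[of "\<psi> n"] by (simp add: \<theta>_def)
  qed
  have "(\<Sum>r<n. (T ^^ r) F w) / real n = (\<Sum>s\<in>S. \<mu> n s * F s)" for n
  proof -
    have "(\<Sum>r<n. (T ^^ r) F w) = (\<Sum>s\<in>S. \<Sum>r<n. F s * P r s)"
      unfolding expand by (rule sum.swap)
    then show ?thesis
      by (simp add: \<mu>_def sum_divide_distrib sum_distrib_left sum_distrib_right mult.commute)
  qed
  then show ?thesis using lim by (auto intro!: tendsto_sum tendsto_mult)
qed

section \<open>W on its finite state space; generations do not die out\<close>

context stable_queue
begin

definition phases :: "nat option \<Rightarrow> nat option \<Rightarrow> nat \<Rightarrow> bool" where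
  "phases p1 p2 l \<longleftrightarrow> l < k \<and> (\<forall>i. p1 = Some i \<longrightarrow> i < N S1) \<and> (\<forall>j. p2 = Some j \<longrightarrow> j < N S2)"

lemma rst_mem: "rst p1 p2 l \<in> r_states \<longleftrightarrow> phases p1 p2 l"
  by (auto simp: rst_def r_states_def phases_def split: option.splits)

lemma at_rst_rst [simp]: "at_rst f (rst p1 p2 l) = f p1 p2 l"
  by (simp add: rst_def split: option.splits)

lemma r_states_cases:
  assumes "w \<in> r_states"
  obtains p1 p2 l where "w = rst p1 p2 l" "phases p1 p2 l"
proof -
  have "\<exists>p1 p2 l. w = rst p1 p2 l"
  proof (cases w)
    case (R1 l) then show ?thesis by (intro exI[of _ None] exI[of _ None] exI[of _ l]) (simp add: rst_def)
  next
    case (R2 i l) then show ?thesis by (intro exI[of _ "Some i"] exI[of _ None] exI[of _ l]) (simp add: rst_def)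
  next
    case (R3 j l) then show ?thesis by (intro exI[of _ None] exI[of _ "Some j"] exI[of _ l]) (simp add: rst_def)
  next
    case (R4 i j l) then show ?thesis by (intro exI[of _ "Some i"] exI[of _ "Some j"] exI[of _ l]) (simp add: rst_def)
  qed
  then show ?thesis using that assms rst_mem by metis
qed

text \<open>Agrees with \<open>Rop\<close> on admissible phases (\<open>Rop_Rr\<close>), but acts on
  functions of actual states, where the general result on finite chains applies.\<close>

definition Rr :: "(rstate \<Rightarrow> real) \<Rightarrow> rstate \<Rightarrow> real" where
  "Rr F w = (\<Sum>w'\<in>r_states. r_step w w' * F w')"

lemma Rr_cong: "(\<And>w'. w' \<in> r_states \<Longrightarrow> F w' = G w') \<Longrightarrow> Rr F w = Rr G w"
  by (simp add: Rr_def)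

lemma Rop_Rr: "phases p1 p2 l \<Longrightarrow> Rop f p1 p2 l = Rr (at_rst f) (rst p1 p2 l)"
  unfolding Rr_def by (subst r_step_rst) (auto simp: phases_def)

lemma Rop_pow_Rr:
  assumes "phases p1 p2 l"
  shows "(Rop ^^ r) f p1 p2 l = (Rr ^^ r) (at_rst f) (rst p1 p2 l)"
proof -
  have "at_rst ((Rop ^^ r) f) w = (Rr ^^ r) (at_rst f) w" if "w \<in> r_states" for w
    using that
  proof (induction r arbitrary: w)
    case (Suc r)
    obtain p1 p2 l where w: "w = rst p1 p2 l" "phases p1 p2 l" using r_states_cases[OF Suc.prems] .
    have "at_rst ((Rop ^^ Suc r) f) w = Rr (at_rst ((Rop ^^ r) f)) w"
      using Rop_Rr[OF w(2), of "(Rop ^^ r) f"] by (simp add: w(1))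
    also have "\<dots> = Rr ((Rr ^^ r) (at_rst f)) w"
      using Suc.IH by (rule Rr_cong)
    finally show ?case by simp
  qed simp
  from this[of "rst p1 p2 l"] show ?thesis using assms by (simp add: rst_mem)
qed

lemma sum_bool2: "(\<Sum>c\<in>UNIV. h c) = (\<Sum>c1\<in>UNIV. \<Sum>c2\<in>UNIV. h (c1, c2))" for h :: "bool \<times> bool \<Rightarrow> real"
  unfolding UNIV_Times_UNIV[symmetric] by (subst sum.cartesian_product) simp

lemma Tc_total:
  assumes "\<And>i. p = Some i \<Longrightarrow> i < N m"
  shows "(\<Sum>c\<in>UNIV. Tc m c (\<lambda>_. x) p) = x"
  using Tc_sum_1[of p m x] assms by (simp add: UNIV_bool)

lemma Tc_sum: "Tc m c (\<lambda>q. \<Sum>x\<in>X. g x q) p = (\<Sum>x\<in>X. Tc m c (g x) p)"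
  by (auto simp: Tc_def sum_distrib_left intro: sum.swap split: option.splits)

lemma Tc_add: "Tc m c (\<lambda>q. g q + h q) p = Tc m c g p + Tc m c h p"
  by (auto simp: Tc_def distrib_left sum.distrib split: option.splits)

lemma Rop_1: "phases p1 p2 l \<Longrightarrow> Rop (\<lambda>_ _ _. 1) p1 p2 l = 1"
  by (simp add: Rop_def sum_bool2 Lop_1 phases_def Tc_sum[symmetric] Tc_total)

lemma Tc_mono:
  assumes "\<And>q. (\<And>i. q = Some i \<Longrightarrow> i < N m) \<Longrightarrow> g q \<le> h q" "\<And>i. p = Some i \<Longrightarrow> i < N m"
  shows "Tc m c g p \<le> Tc m c h p"
  using assms by (auto simp: Tc_def b_nonneg B_nonneg intro!: mult_left_mono sum_mono split: option.splits)

lemma to_F_R_nonneg: "0 \<le> w \<Longrightarrow> s \<in> r_states \<Longrightarrow> 0 \<le> to_F_R l w s"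
  by (cases s) (auto simp: alpha_nonneg r_states_def)

lemma r_step_nonneg: "s \<in> r_states \<Longrightarrow> s' \<in> r_states \<Longrightarrow> 0 \<le> r_step s s'"
  by (cases s; cases s'; simp add: r_states_def alpha_nonneg b_nonneg B_nonneg mult_nonneg_nonneg add_nonneg_nonneg)

lemma r_step_sum: "w \<in> r_states \<Longrightarrow> (\<Sum>w'\<in>r_states. r_step w w') = 1"
  using r_step_rst[of _ _ _ "\<lambda>_. 1"] Rop_1 by (elim r_states_cases) (simp add: phases_def)

lemma gam_mono:
  assumes "\<And>y. y \<in> set y_states \<Longrightarrow> f y \<le> g y" "phases p1 p2 l"
  shows "gam f p1 p2 l \<le> gam g p1 p2 l"
  unfolding gam_def using assms k_ge
  by (intro sum_mono) (auto simp: phases_def intro!: Tc_mono sum_mono mult_left_mono alpha_nonneg split: option.splits)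

lemma gam_0: "gam (\<lambda>_. 0) = (\<lambda>_ _ _. 0)"
  by (intro ext) (simp add: gam_def case_prod_unfold cong: if_cong)

lemma gam_nonneg:
  assumes "\<And>y. y \<in> set y_states \<Longrightarrow> 0 \<le> f y" "phases p1 p2 l"
  shows "0 \<le> gam f p1 p2 l"
  using gam_mono[of "\<lambda>_. 0" f, OF _ assms(2)] assms(1) by (simp add: gam_0)

text \<open>One slot of W without a generation. Its powers applied to 1 give the probability that no
  packet is generated for t slots.\<close>

definition Nop :: "wfun \<Rightarrow> wfun" where
  "Nop f p1 p2 l = (\<Sum>(c1, c2)\<in>UNIV. Tc S1 c1 (\<lambda>q1. Tc S2 c2 (\<lambda>q2.
     if waits l q1 q2 then f q1 q2 (min (l + 1) (k - 1)) else 0) p2) p1)"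

text \<open>Split by whether the slot ends with a generation; if it does, \<open>f\<close> is
  bounded by 1.\<close>

lemma Rop_le_Nop:
  assumes "\<And>p1 p2 l. phases p1 p2 l \<Longrightarrow> f p1 p2 l \<le> 1" "phases p1 p2 l"
  shows "Rop f p1 p2 l \<le> Nop f p1 p2 l + gam (\<lambda>_. 1) p1 p2 l"
proof -
  have L: "Lop f l q1 q2 \<le> (if waits l q1 q2 then f q1 q2 (min (l + 1) (k - 1)) else 0)
      + (if waits l q1 q2 then 0 else 1)"
    if q: "\<And>i. q1 = Some i \<Longrightarrow> i < N S1" "\<And>j. q2 = Some j \<Longrightarrow> j < N S2" for q1 q2
  proof -
    have "(\<Sum>i<N S1. a1 i * f (Some i) q2 0) \<le> (\<Sum>i<N S1. a1 i * 1)"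
      using q k_ge by (intro sum_mono mult_left_mono assms(1) alpha_nonneg) (auto simp: phases_def)
    moreover have "(\<Sum>j<N S2. a2 j * f q1 (Some j) 0) \<le> (\<Sum>j<N S2. a2 j * 1)"
      using q k_ge by (intro sum_mono mult_left_mono assms(1) alpha_nonneg) (auto simp: phases_def)
    ultimately show ?thesis by (simp add: Lop_def alpha_sum)
  qed
  have gam: "gam (\<lambda>_. 1) p1 p2 l = (\<Sum>(c1, c2)\<in>UNIV. Tc S1 c1 (\<lambda>q1. Tc S2 c2 (\<lambda>q2.
     if waits l q1 q2 then 0 else 1) p2) p1)"
    by (simp add: gam_def alpha_sum option.case_eq_if cong: if_cong)
  have "Kc (c1, c2) f p1 p2 l \<le> Tc S1 c1 (\<lambda>q1. Tc S2 c2 (\<lambda>q2.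
     (if waits l q1 q2 then f q1 q2 (min (l + 1) (k - 1)) else 0) + (if waits l q1 q2 then 0 else 1)) p2) p1" for c1 c2
    unfolding Kc.simps using assms(2) by (intro Tc_mono L) (auto simp: phases_def)
  then have "Rop f p1 p2 l \<le> (\<Sum>(c1, c2)\<in>UNIV. Tc S1 c1 (\<lambda>q1. Tc S2 c2 (\<lambda>q2.
     (if waits l q1 q2 then f q1 q2 (min (l + 1) (k - 1)) else 0) + (if waits l q1 q2 then 0 else 1)) p2) p1)"
    unfolding Rop_def by (intro sum_mono) (simp only: split_paired_all prod.case)
  then show ?thesis
    by (simp only: gam Nop_def Tc_add case_prod_unfold sum.distrib)
qed

lemma Nop_both: "Nop f (Some i) (Some j) l =
     (if Suc l < k then b1 i * (b2 j * f None None (Suc l)) + b1 i * (\<Sum>j'<N S2. B2 j j' * f None (Some j') (Suc l))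
        + (\<Sum>i'<N S1. B1 i i' * (b2 j * f (Some i') None (Suc l))) else 0)
     + (\<Sum>i'<N S1. B1 i i' * (\<Sum>j'<N S2. B2 j j' * f (Some i') (Some j') (min (Suc l) (k - 1))))"
  by (auto simp: Nop_def UNIV_Times_UNIV[symmetric] UNIV_bool Tc_def waits_def min_def)

lemma Nop_1: "Nop f (Some i) None l =
     (if Suc l < k then b1 i * f None None (Suc l) + (\<Sum>i'<N S1. B1 i i' * f (Some i') None (Suc l)) else 0)"
  by (auto simp: Nop_def UNIV_Times_UNIV[symmetric] UNIV_bool Tc_def waits_def min_def)

lemma Nop_2: "Nop f None (Some j) l =
     (if Suc l < k then b2 j * f None None (Suc l) + (\<Sum>j'<N S2. B2 j j' * f None (Some j') (Suc l)) else 0)"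
  by (auto simp: Nop_def UNIV_Times_UNIV[symmetric] UNIV_bool Tc_def waits_def min_def)

lemma Nop_None: "Nop f None None l = (if Suc l < k then f None None (Suc l) else 0)"
  by (auto simp: Nop_def UNIV_Times_UNIV[symmetric] UNIV_bool Tc_def waits_def min_def)

text \<open>Without generations the clock rises to k - 1, where an idle server would receive a
  packet. Only the state with both servers busy can persist, and its probability decays with the
  survival probabilities.\<close>

lemma Nop_pow_tendsto:
  assumes "phases p1 p2 l"
  shows "(\<lambda>t. (Nop ^^ t) (\<lambda>_ _ _. 1) p1 p2 l) \<longlonglongrightarrow> 0"
proof -
  let ?n = "\<lambda>t. (Nop ^^ t) (\<lambda>_ _ _. 1 :: real)"
  have 0: "(\<lambda>t. ?n t None None l) \<longlonglongrightarrow> 0" if "l < k" for l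
    using that
  proof (induction l rule: clock_induct)
    case (step l)
    have "(\<lambda>t. ?n (Suc t) None None l) \<longlonglongrightarrow> 0"
      using step by (cases "Suc l < k") (simp_all add: Nop_None)
    then show ?case by (rule LIMSEQ_imp_Suc)
  qed
  have 1: "(\<lambda>t. ?n t (Some i) None l) \<longlonglongrightarrow> 0" if "l < k" "i < N S1" for l i
    using that
  proof (induction l arbitrary: i rule: clock_induct)
    case (step l)
    have "(\<lambda>t. ?n (Suc t) (Some i) None l) \<longlonglongrightarrow> 0"
    proof (cases "Suc l < k")
      case True
      have "(\<lambda>t. b1 i * ?n t None None (Suc l) + (\<Sum>i'<N S1. B1 i i' * ?n t (Some i') None (Suc l)))
        \<longlonglongrightarrow> b1 i * 0 + (\<Sum>i'<N S1. B1 i i' * 0)"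
        using step.IH[OF True] 0[OF True] by (intro tendsto_intros) auto
      then show ?thesis using True by (simp add: Nop_1)
    qed (simp add: Nop_1)
    then show ?case by (rule LIMSEQ_imp_Suc)
  qed
  have 2: "(\<lambda>t. ?n t None (Some j) l) \<longlonglongrightarrow> 0" if "l < k" "j < N S2" for l j
    using that
  proof (induction l arbitrary: j rule: clock_induct)
    case (step l)
    have "(\<lambda>t. ?n (Suc t) None (Some j) l) \<longlonglongrightarrow> 0"
    proof (cases "Suc l < k")
      case True
      have "(\<lambda>t. b2 j * ?n t None None (Suc l) + (\<Sum>j'<N S2. B2 j j' * ?n t None (Some j') (Suc l)))
        \<longlonglongrightarrow> b2 j * 0 + (\<Sum>j'<N S2. B2 j j' * 0)"
        using step.IH[OF True] 0[OF True] by (intro tendsto_intros) auto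
      then show ?thesis using True by (simp add: Nop_2)
    qed (simp add: Nop_2)
    then show ?case by (rule LIMSEQ_imp_Suc)
  qed
  \<comment> \<open>With both servers busy and the clock at k - 1 the two services run
    independently, so the powers factor.\<close>
  have last: "?n t (Some i) (Some j) (k - 1) = surv S1 t i * surv S2 t j" for t i j
  proof (induction t arbitrary: i j)
    case (Suc t)
    have m: "min (Suc (k - 1)) (k - 1) = k - 1" "\<not> Suc (k - 1) < k" by auto
    show ?case
      by (simp only: funpow.simps comp_def Nop_both m Suc if_False surv.simps sum_product)
         (simp add: sum_distrib_left mult_ac)
  qed simp
  have 3: "(\<lambda>t. ?n t (Some i) (Some j) l) \<longlonglongrightarrow> 0" if "l < k" "i < N S1" "j < N S2" for l i j
    using that
  proof (induction l arbitrary: i j rule: clock_induct)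
    case (step l)
    show ?case
    proof (cases "Suc l < k")
      case True
      have "(\<lambda>t. b1 i * (b2 j * ?n t None None (Suc l)) + b1 i * (\<Sum>j'<N S2. B2 j j' * ?n t None (Some j') (Suc l))
        + (\<Sum>i'<N S1. B1 i i' * (b2 j * ?n t (Some i') None (Suc l)))
        + (\<Sum>i'<N S1. B1 i i' * (\<Sum>j'<N S2. B2 j j' * ?n t (Some i') (Some j') (Suc l))))
        \<longlonglongrightarrow> b1 i * (b2 j * 0) + b1 i * (\<Sum>j'<N S2. B2 j j' * 0)
        + (\<Sum>i'<N S1. B1 i i' * (b2 j * 0)) + (\<Sum>i'<N S1. B1 i i' * (\<Sum>j'<N S2. B2 j j' * 0))"
        using step.IH[OF True] 0[OF True] 1[OF True] 2[OF True] by (intro tendsto_intros) auto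
      moreover have "min (Suc l) (k - 1) = Suc l" "min (Suc l) (k - Suc 0) = Suc l" using True by linarith+
      ultimately have "(\<lambda>t. ?n (Suc t) (Some i) (Some j) l) \<longlonglongrightarrow> 0" using True by (simp add: Nop_both)
      then show ?thesis by (rule LIMSEQ_imp_Suc)
    next
      case False
      then have "l = k - 1" using step by simp
      then show ?thesis
        using tendsto_mult[OF surv_tendsto_0 surv_tendsto_0, OF step.prems] unfolding \<open>l = k - 1\<close> last by simp
    qed
  qed
  show ?thesis using assms 0 1 2 3 by (cases p1; cases p2) (auto simp: phases_def)
qed

end

locale stationary_queue = stable_queue +
  fixes p :: "rstate pmf"
  assumes stat: "stationary p" and uniq: "\<And>p'. stationary p' \<Longrightarrow> p' = p"
begin

lemma p_sum: "(\<Sum>w\<in>r_states. pmf p w) = 1"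
  using stat by (intro sum_pmf_eq_1) (auto simp: stationary_def)

lemma p_Rr: "(\<Sum>w\<in>r_states. pmf p w * Rr F w) = (\<Sum>w\<in>r_states. pmf p w * F w)"
proof -
  have "(\<Sum>w\<in>r_states. pmf p w * Rr F w) = (\<Sum>w\<in>r_states. \<Sum>w'\<in>r_states. pmf p w * r_step w w' * F w')"
    by (simp add: Rr_def sum_distrib_left mult.assoc)
  also have "\<dots> = (\<Sum>w'\<in>r_states. (\<Sum>w\<in>r_states. pmf p w * r_step w w') * F w')"
    by (subst sum.swap) (simp add: sum_distrib_right)
  also have "\<dots> = (\<Sum>w\<in>r_states. pmf p w * F w)"
    using stat by (intro sum.cong) (auto simp: stationary_def)
  finally show ?thesis .
qed

text \<open>The locale states uniqueness for \<open>pmf\<close>s; a stationary vector is extended by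
  0 outside \<open>r_states\<close> and turned into one.\<close>

lemma stationary_unique:
  assumes nonneg: "\<And>s. s \<in> r_states \<Longrightarrow> 0 \<le> \<pi> s" and "sum \<pi> r_states = 1"
    and eq: "\<And>s. s \<in> r_states \<Longrightarrow> \<pi> s = (\<Sum>s'\<in>r_states. \<pi> s' * r_step s' s)" and s: "s \<in> r_states"
  shows "\<pi> s = pmf p s"
proof -
  define \<pi>' where "\<pi>' s = (if s \<in> r_states then \<pi> s else 0)" for s
  have n: "0 \<le> \<pi>' s" for s using nonneg by (simp add: \<pi>'_def)
  have "(\<integral>\<^sup>+ s. ennreal (\<pi>' s) \<partial>count_space UNIV) = (\<Sum>s\<in>r_states. ennreal (\<pi>' s))"
    by (rule nn_integral_count_space'[OF finite_r_states]) (auto simp: \<pi>'_def)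
  also have "\<dots> = ennreal (sum \<pi>' r_states)"
    using n by (intro sum_ennreal)
  also have "\<dots> = 1" using assms(2) by (simp add: \<pi>'_def)
  finally have pmf: "pmf (embed_pmf \<pi>') s = \<pi>' s" for s
    by (rule pmf_embed_pmf[OF n])
  have "stationary (embed_pmf \<pi>')"
    unfolding stationary_def pmf
    using eq by (auto simp: set_pmf_iff pmf \<pi>'_def split: if_splits)
  then show ?thesis using uniq pmf[of s] s by (simp add: \<pi>'_def)
qed

lemma cesaro_Rr:
  assumes "w \<in> r_states"
  shows "(\<lambda>n. (\<Sum>r<n. (Rr ^^ r) F w) / real n) \<longlonglongrightarrow> (\<Sum>s\<in>r_states. pmf p s * F s)"
proof -
  have "(\<lambda>F w. \<Sum>w'\<in>r_states. r_step w w' * F w') = Rr"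
    by (intro ext) (simp add: Rr_def)
  moreover have "(\<lambda>n. (\<Sum>r<n. ((\<lambda>F w. \<Sum>w'\<in>r_states. r_step w w' * F w') ^^ r) F w) / real n)
      \<longlonglongrightarrow> (\<Sum>s\<in>r_states. pmf p s * F s)"
  proof (rule cesaro_unique_stationary[OF finite_r_states])
    fix \<pi> s
    assume "\<And>s. s \<in> r_states \<Longrightarrow> 0 \<le> \<pi> s" "sum \<pi> r_states = 1"
      "\<And>s. s \<in> r_states \<Longrightarrow> \<pi> s = (\<Sum>s'\<in>r_states. \<pi> s' * r_step s' s)" "s \<in> r_states"
    then show "\<pi> s = pmf p s" by (rule stationary_unique)
  qed (use assms r_step_nonneg r_step_sum in auto)
  ultimately show ?thesis by (simp only:)
qed

lemma cesaro_gam: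
  assumes "phases p1 p2 l"
  shows "(\<lambda>n. (\<Sum>r<n. (Rop ^^ r) (gam v) p1 p2 l) / real n) \<longlonglongrightarrow> ysum (\<lambda>y. q_init p y * v y)"
  using cesaro_Rr[of "rst p1 p2 l" "at_rst (gam v)"] assms
  by (simp add: rst_mem Rop_pow_Rr sum_gam[OF k_ge])

text \<open>Were \<open>qtot p\<close> equal to 0, stationary W would never generate a packet. The
  stationary mass 1 would then be bounded by the probability of no generation in t slots, which
  tends to 0.\<close>

lemma qtot_pos: "0 < qtot p"
proof -
  have q: "qtot p = (\<Sum>w\<in>r_states. pmf p w * at_rst (gam (\<lambda>_. 1)) w)"
    by (simp add: qtot_def sum_gam[OF k_ge])
  have "0 \<le> qtot p"
    unfolding q by (intro sum_nonneg mult_nonneg_nonneg) (auto elim!: r_states_cases intro!: gam_nonneg)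
  moreover have "qtot p \<noteq> 0"
  proof
    assume q0: "qtot p = 0"
    let ?n = "\<lambda>t. (Nop ^^ t) (\<lambda>_ _ _. 1 :: real)"
    have Nmono: "Nop f p1 p2 l \<le> Nop g p1 p2 l"
      if "\<And>p1 p2 l. phases p1 p2 l \<Longrightarrow> f p1 p2 l \<le> g p1 p2 l" "phases p1 p2 l" for f g p1 p2 l
      unfolding Nop_def case_prod_unfold using that k_ge
      by (intro sum_mono Tc_mono) (auto simp: phases_def)
    have Rmono: "Nop (\<lambda>_ _ _. 1) p1 p2 l \<le> 1" if "phases p1 p2 l" for p1 p2 l
    proof -
      have "Nop (\<lambda>_ _ _. 1) p1 p2 l \<le> (\<Sum>(c1, c2)\<in>UNIV. Tc S1 c1 (\<lambda>q1. Tc S2 c2 (\<lambda>q2. 1) p2) p1)"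
        unfolding Nop_def case_prod_unfold using that
        by (intro sum_mono Tc_mono) (auto simp: phases_def)
      also have "\<dots> = 1"
        using that by (simp add: sum_bool2 phases_def Tc_sum[symmetric] Tc_total)
      finally show ?thesis .
    qed
    have le1: "?n t p1 p2 l \<le> 1" if "phases p1 p2 l" for t p1 p2 l
      using that
    proof (induction t arbitrary: p1 p2 l)
      case (Suc t)
      then have "?n (Suc t) p1 p2 l \<le> Nop (\<lambda>_ _ _. 1) p1 p2 l" by (auto intro: Nmono)
      then show ?case using Rmono[OF Suc.prems] by simp
    qed simp
    have step: "(\<Sum>w\<in>r_states. pmf p w * at_rst (?n t) w) \<le> (\<Sum>w\<in>r_states. pmf p w * at_rst (?n (Suc t)) w)" for t
    proof -
      have "(\<Sum>w\<in>r_states. pmf p w * at_rst (?n t) w) = (\<Sum>w\<in>r_states. pmf p w * Rr (at_rst (?n t)) w)"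
        by (rule p_Rr[symmetric])
      also have "\<dots> \<le> (\<Sum>w\<in>r_states. pmf p w * (at_rst (?n (Suc t)) w + at_rst (gam (\<lambda>_. 1)) w))"
      proof (intro sum_mono mult_left_mono)
        fix w assume "w \<in> r_states"
        then show "Rr (at_rst (?n t)) w \<le> at_rst (?n (Suc t)) w + at_rst (gam (\<lambda>_. 1)) w"
          using Rop_le_Nop[of "?n t"] le1 by (elim r_states_cases) (simp add: Rop_Rr[symmetric])
      qed simp
      also have "\<dots> = (\<Sum>w\<in>r_states. pmf p w * at_rst (?n (Suc t)) w) + qtot p"
        unfolding q by (simp add: distrib_left sum.distrib)
      finally show ?thesis using q0 by simp
    qed
    have ge: "1 \<le> (\<Sum>w\<in>r_states. pmf p w * at_rst (?n t) w)" for t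
    proof (induction t)
      case 0
      have "at_rst (\<lambda>_ _ _. 1) w = 1" for w by (cases w) auto
      then show ?case using p_sum by simp
    next
      case (Suc t)
      then show ?case using step[of t] by linarith
    qed
    have "(\<lambda>t. \<Sum>w\<in>r_states. pmf p w * at_rst (?n t) w) \<longlonglongrightarrow> (\<Sum>w\<in>r_states. pmf p w * 0)"
      by (intro tendsto_sum tendsto_mult tendsto_const) (auto elim!: r_states_cases intro!: Nop_pow_tendsto)
    then have "(1 :: real) \<le> (\<Sum>w\<in>r_states. pmf p w * 0)"
      using ge by (intro LIMSEQ_le_const) auto
    then show False by simp
  qed
  ultimately show ?thesis by simp
qed

end

section \<open>Sample paths by packet number\<close>

context stable_queue
begin

abbreviation "gen \<equiv> gen_slot k prio"
abbreviation "srv \<equiv> server_of k prio"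
abbreviation "rcv \<equiv> rec_slot k prio"
abbreviation "utd \<equiv> up_to_date k prio"

definition free_at :: "(server \<Rightarrow> nat \<Rightarrow> nat) \<Rightarrow> nat \<Rightarrow> server \<Rightarrow> nat" where
  "free_at x n = snd (snd (history k prio x n))"

lemma history_0: "gen x 0 = 0" "srv x 0 = prio" "free_at x 0 = (\<lambda>_. 0)(prio := rcv x 0)"
  by (simp_all add: gen_slot_def server_of_def rec_slot_def free_at_def launch_def)

lemma history_Suc:
  "gen x (Suc n) = (LEAST t. gen x n + k \<le> t \<and> (\<exists>m. free_at x n m \<le> t))"
  "srv x (Suc n) = (if free_at x n S1 \<le> gen x (Suc n) \<and> free_at x n S2 \<le> gen x (Suc n) then prio
     else if free_at x n S1 \<le> gen x (Suc n) then S1 else S2)"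
  "free_at x (Suc n) = (free_at x n)(srv x (Suc n) := rcv x (Suc n))"
  by (simp_all add: gen_slot_def server_of_def rec_slot_def free_at_def launch_def Let_def split: prod.split)

lemma gen_Suc_spec: "gen x n + k \<le> gen x (Suc n)" "\<exists>m. free_at x n m \<le> gen x (Suc n)"
proof -
  have "\<exists>t. gen x n + k \<le> t \<and> (\<exists>m. free_at x n m \<le> t)"
    by (intro exI[of _ "gen x n + k + free_at x n S1"]) (auto intro!: exI[of _ S1])
  from LeastI_ex[OF this] show "gen x n + k \<le> gen x (Suc n)" "\<exists>m. free_at x n m \<le> gen x (Suc n)"
    unfolding history_Suc(1) by auto
qed

lemma gen_Suc_least: "gen x n + k \<le> t \<Longrightarrow> free_at x n m \<le> t \<Longrightarrow> gen x (Suc n) \<le> t"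
  unfolding history_Suc(1) by (rule Least_le) auto

lemma free_srv_Suc: "free_at x n (srv x (Suc n)) \<le> gen x (Suc n)"
proof -
  obtain m where "free_at x n m \<le> gen x (Suc n)" using gen_Suc_spec(2) by blast
  then show ?thesis unfolding history_Suc(2)
    by (cases m; cases prio) auto
qed

lemma strict_mono_gen: "strict_mono (gen x)"
proof (rule strict_mono_Suc_iff[THEN iffD2], rule allI)
  fix n show "gen x n < gen x (Suc n)" using gen_Suc_spec(1)[of x n] k_ge by linarith
qed

lemma gen_less_iff [simp]: "gen x i < gen x j \<longleftrightarrow> i < j"
  using strict_mono_gen by (rule strict_mono_less)

lemma gen_le_iff [simp]: "gen x i \<le> gen x j \<longleftrightarrow> i \<le> j"
  using strict_mono_gen by (rule strict_mono_less_eq)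

lemma gen_eq_iff [simp]: "gen x i = gen x j \<longleftrightarrow> i = j"
  using strict_mono_gen by (rule strict_mono_eq)

lemma gen_ge: "n \<le> gen x n"
  using strict_mono_gen by (rule strict_mono_imp_increasing)

lemma gen_le_rcv: "gen x n \<le> rcv x n"
  by (simp add: rec_slot_def)

text \<open>A server receives a packet only when it is free, so its entry in \<open>free_at\<close>
  never decreases.\<close>

lemma rcv_le_free: "j \<le> n \<Longrightarrow> rcv x j \<le> free_at x n (srv x j)"
proof (induction n)
  case (Suc n)
  show ?case
  proof (cases "j = Suc n")
    case False
    then have IH: "rcv x j \<le> free_at x n (srv x j)" using Suc by simp
    show ?thesis
    proof (cases "srv x j = srv x (Suc n)")
      case True
      then have "rcv x j \<le> gen x (Suc n)" using IH free_srv_Suc[of x n] by simp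
      then show ?thesis using True gen_le_rcv[of x "Suc n"] by (simp add: history_Suc(3))
    qed (use IH in \<open>simp add: history_Suc(3)\<close>)
  qed (simp add: history_Suc(3))
qed (simp add: history_0)

lemma same_server:
  assumes "j < n" "srv x j = srv x n"
  shows "rcv x j \<le> gen x n"
proof -
  obtain n' where n: "n = Suc n'" using assms(1) by (cases n) auto
  have "rcv x j \<le> free_at x n' (srv x j)" using assms(1) n by (intro rcv_le_free) simp
  then show ?thesis using free_srv_Suc[of x n'] assms(2) n by simp
qed

text \<open>Packet numbers and generation slots are ordered alike, so the definition says in
  contraposition that no later packet is received as early.\<close>

lemma utd_iff: "utd x i \<longleftrightarrow> (\<forall>j>i. rcv x i < rcv x j)"
  unfolding up_to_date_def gen_less_iff
proof safe
  fix j assume *: "\<forall>j. j \<noteq> i \<and> rcv x j \<le> rcv x i \<longrightarrow> j < i" and "i < j"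
  show "rcv x i < rcv x j"
  proof (rule ccontr)
    assume "\<not> rcv x i < rcv x j"
    then have "j < i" using * \<open>i < j\<close> by simp
    then show False using \<open>i < j\<close> by simp
  qed
next
  fix j assume *: "\<forall>j>i. rcv x i < rcv x j" "j \<noteq> i" "rcv x j \<le> rcv x i"
  show "j < i"
  proof (rule ccontr)
    assume "\<not> j < i"
    then have "i < j" using *(2) by simp
    then show False using *(1,3) by fastforce
  qed
qed

text \<open>The slot at which, for the first time, a packet generated after packet \<open>i\<close> is received.\<close>

definition next_rcv :: "(server \<Rightarrow> nat \<Rightarrow> nat) \<Rightarrow> nat \<Rightarrow> nat" where
  "next_rcv x i = (LEAST r. \<exists>j>i. rcv x j = r)"

lemma next_rcv_ex: "\<exists>j>i. rcv x j = next_rcv x i"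
  unfolding next_rcv_def by (rule LeastI[of _ "rcv x (Suc i)"]) auto

lemma next_rcv_le: "i < j \<Longrightarrow> next_rcv x i \<le> rcv x j"
  unfolding next_rcv_def by (rule Least_le) auto

lemma gen_less_next_rcv: "gen x i < next_rcv x i"
  using next_rcv_ex[of i x] gen_le_rcv[of x] by (metis gen_less_iff order_less_le_trans)

lemma utd_next_rcv: "utd x i \<longleftrightarrow> rcv x i < next_rcv x i"
  unfolding utd_iff using next_rcv_ex[of i x] next_rcv_le[of i _ x] by (metis order_less_le_trans)

text \<open>Several packets may be received in slot \<open>next_rcv x i\<close>. The one with the
  largest number is up to date, and any packet between is received no earlier than it and hence
  obsolete.\<close>

lemma next_utd:
  obtains j where "i < j" "utd x j" "rcv x j = next_rcv x i" "\<And>j'. i < j' \<Longrightarrow> j' < j \<Longrightarrow> \<not> utd x j'"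
proof -
  let ?J = "{j. i < j \<and> rcv x j = next_rcv x i}"
  have "?J \<subseteq> {..next_rcv x i}"
  proof
    fix j assume "j \<in> ?J"
    then show "j \<in> {..next_rcv x i}" using gen_ge[of j x] gen_le_rcv[of x j] by simp
  qed
  then have fin: "finite ?J" by (rule finite_subset) simp
  have ne: "?J \<noteq> {}" using next_rcv_ex[of i x] by auto
  define j where "j = Max ?J"
  have j: "i < j" "rcv x j = next_rcv x i" using Max_in[OF fin ne] by (auto simp: j_def)
  have "rcv x j < rcv x j'" if "j < j'" for j'
  proof -
    have "j' \<notin> ?J" using Max_ge[OF fin, of j'] that by (auto simp: j_def)
    then show ?thesis using next_rcv_le[of i j' x] that j by auto
  qed
  moreover have "\<not> utd x j'" if "i < j'" "j' < j" for j'
    using next_rcv_le[OF that(1), of x] that(2) j(2) by (auto simp: utd_iff intro!: exI[of _ j])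
  ultimately show ?thesis using that j by (auto simp: utd_iff)
qed

lemma infinite_utd: "infinite {i. utd x i}"
  unfolding infinite_nat_iff_unbounded using next_utd by (metis mem_Collect_eq)

abbreviation "uidx x \<equiv> enumerate {i. utd x i}"

lemma utd_uidx: "utd x (uidx x n)"
  using enumerate_in_set[OF infinite_utd, of x n] by simp

lemma strict_mono_uidx: "strict_mono (uidx x)"
  using strict_mono_enumerate[OF infinite_utd] .

lemma rcv_uidx_Suc: "rcv x (uidx x (Suc n)) = next_rcv x (uidx x n)"
proof -
  obtain j where j: "uidx x n < j" "utd x j" "rcv x j = next_rcv x (uidx x n)"
     "\<And>j'. uidx x n < j' \<Longrightarrow> j' < j \<Longrightarrow> \<not> utd x j'" by (rule next_utd[where i = "uidx x n" and x = x]) blast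
  have "uidx x (Suc n) = j"
    using enumerate_Suc''[OF infinite_utd, of x n] j by (auto intro!: Least_equality simp: not_less[symmetric])
  then show ?thesis using j by simp
qed

text \<open>Cycles are counted from 1 and up-to-date packets from 0, hence \<open>Suc n\<close>
  against \<open>uidx x n\<close>.\<close>

lemma peak_eq: "peak_aoi k prio x (Suc n) = next_rcv x (uidx x n) - 1 - gen x (uidx x n)"
proof -
  have "strict_mono (utd_rec k prio x)"
    unfolding utd_rec_def
    using utd_uidx[of x] strict_monoD[OF strict_mono_uidx[of x]] unfolding utd_iff[of x] by (intro strict_monoI) blast
  from peak_aoi_eq[OF this, of "Suc n"] show ?thesis
    by (simp add: utd_rec_def utd_gen_def rcv_uidx_Suc)
qed

lemma peak_eq_iff: "peak_aoi k prio x (Suc n) = h \<longleftrightarrow> next_rcv x (uidx x n) = gen x (uidx x n) + h + 1"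
  using gen_less_next_rcv[of x "uidx x n"] unfolding peak_eq by auto

definition utd_before :: "(server \<Rightarrow> nat \<Rightarrow> nat) \<Rightarrow> nat \<Rightarrow> nat set" where
  "utd_before x t = {i. utd x i \<and> gen x i < t}"

lemma finite_gen_less: "finite {i. gen x i < t}"
  by (rule finite_subset[of _ "{..<t}"]) (auto intro: le_less_trans[OF gen_ge])

text \<open>Generation slots increase along \<open>uidx\<close>, so the packets in question form an
  initial segment of the enumeration.\<close>

lemma utd_before_eq: "utd_before x t = uidx x ` {..<card (utd_before x t)}"
proof -
  define c where "c = card (utd_before x t)"
  have fin: "finite (utd_before x t)"
    unfolding utd_before_def using finite_gen_less by (rule rev_finite_subset) auto
  define J where "J = {n. gen x (uidx x n) < t}"
  have im: "utd_before x t = uidx x ` J"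
    unfolding utd_before_def J_def using range_enumerate[OF infinite_utd, of x] by fastforce
  have inj: "inj_on (uidx x) J" using strict_mono_uidx by (auto intro: strict_mono_imp_inj_on inj_on_subset)
  have "finite J" using fin im inj by (simp add: finite_image_iff)
  have down: "n' \<in> J" if "n \<in> J" "n' \<le> n" for n n'
  proof -
    have "uidx x n' \<le> uidx x n" using strict_mono_uidx that(2) by (simp add: strict_mono_less_eq)
    then have "gen x (uidx x n') \<le> gen x (uidx x n)" by (simp only: gen_le_iff)
    then show ?thesis using that(1) unfolding J_def by (blast intro: le_less_trans)
  qed
  have "J = {..<card J}"
  proof (cases "J = {}")
    case False
    have "J = {..Max J}" using \<open>finite J\<close> False down[OF Max_in] by (auto intro: Max_ge)
    then show ?thesis by (metis card_atMost lessThan_Suc_atMost)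
  qed simp
  moreover have "card J = c" unfolding c_def im using inj by (rule card_image[symmetric])
  ultimately show ?thesis using im by (simp add: c_def)
qed

text \<open>Converts a count over cycle indices into a count over packets by generation slot, to
  which probabilities given the past apply.\<close>

lemma count_peaks:
  "card {j. j < card (utd_before x t) \<and> peak_aoi k prio x (Suc j) = h}
    = card {i \<in> utd_before x t. next_rcv x i = gen x i + h + 1}"
proof -
  have "{i \<in> utd_before x t. next_rcv x i = gen x i + h + 1}
      = uidx x ` {j. j < card (utd_before x t) \<and> peak_aoi k prio x (Suc j) = h}"
    by (subst utd_before_eq) (auto simp: peak_eq_iff)
  moreover have "inj_on (uidx x) S" for S
    using strict_mono_uidx by (auto intro: strict_mono_imp_inj_on inj_on_subset)
  ultimately show ?thesis by (simp add: card_image)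
qed

text \<open>If packets i and i + 1 were both obsolete, each would still be in service when the next
  one is generated. The servers then alternate, so i + 2 follows i on the same server and i is
  received by the time i + 2 is generated. Hence only i + 1 can be received as early as i, so i + 1
  would be received by that time too, although it is still in service.\<close>

lemma utd_or_utd_Suc:
  assumes pos: "\<forall>m i. 1 \<le> x m i"
  shows "utd x i \<or> utd x (Suc i)"
proof (rule ccontr)
  assume "\<not> ?thesis"
  then obtain j j' where j: "i < j" "rcv x j \<le> rcv x i" and j': "Suc i < j'" "rcv x j' \<le> rcv x (Suc i)"
    by (auto simp: utd_iff not_less)
  have gr: "gen x n < rcv x n" for n using pos[rule_format, of "srv x n" n] by (simp add: rec_slot_def)
  have "gen x (Suc i) \<le> gen x j" using j(1) by simp
  then have i: "gen x (Suc i) < rcv x i" using gr[of j] j(2) by linarith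
  have "gen x (Suc (Suc i)) \<le> gen x j'" using j'(1) by simp
  then have Si: "gen x (Suc (Suc i)) < rcv x (Suc i)" using gr[of j'] j'(2) by linarith
  have "srv x i \<noteq> srv x (Suc i)" using same_server[of i "Suc i" x] i by auto
  moreover have "srv x (Suc i) \<noteq> srv x (Suc (Suc i))" using same_server[of "Suc i" "Suc (Suc i)" x] Si by auto
  ultimately have "srv x i = srv x (Suc (Suc i))"
    by (metis server.exhaust)
  then have ri: "rcv x i \<le> gen x (Suc (Suc i))" using same_server[of i "Suc (Suc i)" x] by simp
  have "j = Suc i"
  proof (rule ccontr)
    assume "j \<noteq> Suc i"
    then have "gen x (Suc (Suc i)) \<le> gen x j" using j(1) by simp
    then show False using gr[of j] j(2) ri by linarith
  qed
  then show False using j(2) ri Si by simp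
qed

text \<open>Every packet other than 0 is up to date or the successor of an up-to-date one.\<close>

lemma card_gen_le:
  assumes pos: "\<forall>m i. 1 \<le> x m i"
  shows "card {i. gen x i < t} \<le> 2 * card (utd_before x t) + 1"
proof -
  have fin: "finite (utd_before x t)"
    unfolding utd_before_def using finite_gen_less by (rule rev_finite_subset) auto
  have "{i. gen x i < t} \<subseteq> {0} \<union> (utd_before x t \<union> Suc ` utd_before x t)"
  proof
    fix i assume "i \<in> {i. gen x i < t}"
    then have i: "gen x i < t" by simp
    show "i \<in> {0} \<union> (utd_before x t \<union> Suc ` utd_before x t)"
    proof (cases i)
      case (Suc i')
      have "gen x i' < gen x i" using Suc by simp
      then have "gen x i' < t" using i by (rule less_trans)
      then show ?thesis using utd_or_utd_Suc[where i = i', OF pos] Suc i by (auto simp: utd_before_def)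
    qed simp
  qed
  then have "card {i. gen x i < t} \<le> card ({0} \<union> (utd_before x t \<union> Suc ` utd_before x t))"
    using fin by (intro card_mono) auto
  also have "\<dots> \<le> 1 + (card (utd_before x t) + card (Suc ` utd_before x t))"
    by (intro order_trans[OF card_Un_le] add_mono card_Un_le) auto
  finally show ?thesis by (simp add: card_image)
qed

section \<open>Sample paths by slot\<close>

section \<open>Slots\<close>

text \<open>The age \<open>a\<close> is that of the current slot, so a completion in the next slot
  means service time \<open>Suc a\<close>.\<close>

definition don :: "server \<Rightarrow> (server \<Rightarrow> nat \<Rightarrow> nat) \<Rightarrow> serving \<Rightarrow> bool" where
  "don m x s \<longleftrightarrow> (case s of None \<Rightarrow> False | Some (j, a) \<Rightarrow> x m j = Suc a)"

fun cmp :: "(server \<Rightarrow> nat \<Rightarrow> nat) \<Rightarrow> config \<Rightarrow> bool \<times> bool" where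
  "cmp x (n, s1, s2, l) = (don S1 x s1, don S2 x s2)"

definition cfg0 :: config where
  "cfg0 = (if S1_first then (1, Some (0, 0), None, 0) else (1, None, Some (0, 0), 0))"

primrec st :: "(server \<Rightarrow> nat \<Rightarrow> nat) \<Rightarrow> nat \<Rightarrow> config" where
  "st x 0 = cfg0"
| "st x (Suc t) = nxt (st x t) (cmp x (st x t))"

fun on_server :: "config \<Rightarrow> server \<Rightarrow> serving" where
  "on_server (n, s1, s2, l) m = (case m of S1 \<Rightarrow> s1 | S2 \<Rightarrow> s2)"

text \<open>Links the slotwise view to \<open>history\<close>: packet \<open>i\<close> is the last
  one generated by slot \<open>t\<close>, and \<open>free_at x i\<close> is the state of the servers
  after its launch.\<close>

definition tracks :: "(server \<Rightarrow> nat \<Rightarrow> nat) \<Rightarrow> nat \<Rightarrow> nat \<Rightarrow> server \<Rightarrow> serving \<Rightarrow> bool" where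
  "tracks x i t m s \<longleftrightarrow> (case s of None \<Rightarrow> free_at x i m \<le> t
     | Some (j, a) \<Rightarrow> j \<le> i \<and> srv x j = m \<and> gen x j + a = t \<and> rcv x j = free_at x i m \<and> t < rcv x j)"

lemma tracks_adv:
  assumes "tracks x i t m s"
  shows "tracks x i (Suc t) m (adv s (don m x s))"
proof (cases s)
  case (Some ja)
  then obtain j a where s: "s = Some (j, a)" by (cases ja) auto
  have r: "rcv x j = gen x j + x m j" using assms by (simp add: s tracks_def rec_slot_def)
  show ?thesis using assms r by (auto simp: s tracks_def adv_def don_def)
qed (use assms in \<open>auto simp: tracks_def adv_def don_def\<close>)

text \<open>Invariant of the slotwise recursion. The clock counts the slots since the last
  generation, capped at k - 1; with this, the rule in \<open>relaunch\<close> launches exactly at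
  the \<open>LEAST\<close> slot of \<open>history\<close>.\<close>

lemma st_inv:
  assumes pos: "\<forall>m i. 1 \<le> x m i"
  shows "\<exists>i s1 s2. st x t = (Suc i, s1, s2, min (t - gen x i) (k - 1)) \<and> gen x i \<le> t \<and> t < gen x (Suc i)
    \<and> tracks x i t S1 s1 \<and> tracks x i t S2 s2"
proof (induction t)
  case 0
  have "0 < rcv x 0" using pos[rule_format, of prio 0] by (simp add: rec_slot_def history_0)
  then have t: "m = prio \<Longrightarrow> tracks x 0 0 m (Some (0, 0))" "m \<noteq> prio \<Longrightarrow> tracks x 0 0 m None" for m
    by (simp_all add: tracks_def history_0)
  have g: "gen x 0 < gen x (Suc 0)" by simp
  show ?case
  proof (cases S1_first)
    case True
    then have "S1 = prio" "S2 \<noteq> prio" using prio_iff by metis+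
    then have "tracks x 0 0 S1 (Some (0, 0))" "tracks x 0 0 S2 None" using t by blast+
    then show ?thesis using g True by (intro exI[of _ 0]) (simp add: cfg0_def history_0)
  next
    case False
    then have "S2 = prio" "S1 \<noteq> prio" using prio_iff by metis+
    then have "tracks x 0 0 S2 (Some (0, 0))" "tracks x 0 0 S1 None" using t by blast+
    then show ?thesis using g False by (intro exI[of _ 0]) (simp add: cfg0_def history_0)
  qed
next
  case (Suc t)
  then obtain i s1 s2 where st: "st x t = (Suc i, s1, s2, min (t - gen x i) (k - 1))" and i: "gen x i \<le> t" "t < gen x (Suc i)"
    and tr: "tracks x i t S1 s1" "tracks x i t S2 s2" by blast
  define s1' where "s1' = adv s1 (don S1 x s1)"
  define s2' where "s2' = adv s2 (don S2 x s2)"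
  have tr': "tracks x i (Suc t) S1 s1'" "tracks x i (Suc t) S2 s2'"
    unfolding s1'_def s2'_def using tr by (auto intro: tracks_adv)
  define l where "l = min (t - gen x i) (k - 1)"
  have st': "st x (Suc t) = relaunch (Suc i) s1' s2' l"
    by (simp add: st s1'_def s2'_def l_def)
  have free: "free_at x i S1 \<le> Suc t \<longleftrightarrow> s1' = None" "free_at x i S2 \<le> Suc t \<longleftrightarrow> s2' = None"
    using tr' by (auto simp: tracks_def split: option.splits)
  show ?case
  proof (cases "waits l s1' s2'")
    case True
    have gi: "Suc t < gen x (Suc i)"
    proof (cases "l < k - 1")
      case True
      then show ?thesis using gen_Suc_spec(1)[of x i] i by (auto simp: l_def)
    next
      case False
      then have "\<not> free_at x i m \<le> Suc t" for m using True free by (cases m) (auto simp: waits_def)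
      then show ?thesis using free_srv_Suc[of x i] by (meson leD leI order_trans)
    qed
    have lS: "min (l + 1) (k - 1) = min (Suc t - gen x i) (k - 1)" using i by (auto simp: l_def)
    show ?thesis
      by (rule exI[of _ i], rule exI[of _ s1'], rule exI[of _ s2']) (use i tr' True gi lS in \<open>auto simp: st' relaunch_def simp del: st.simps\<close>)
  next
    case False
    then have l: "\<not> l < k - 1" and idle: "s1' = None \<or> s2' = None"
      by (cases s1'; cases s2'; simp add: waits_def)+
    \<comment> \<open>A clock at k - 1 means at least k - 1 slots by \<open>t\<close>, hence at
      least k by \<open>Suc t\<close>.\<close>
    have "gen x i + k \<le> Suc t" using l i by (auto simp: l_def)
    moreover obtain m where "free_at x i m \<le> Suc t" using idle free by blast
    ultimately have g: "gen x (Suc i) = Suc t" using gen_Suc_least[of x i "Suc t" m] i by simp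
    have m: "srv x (Suc i) = (if launch1 s1' s2' then S1 else S2)"
      unfolding history_Suc(2) g free using idle by (auto simp: launch1_def prio_iff)
    have r: "Suc t < rcv x (Suc i)" using pos[rule_format, of "srv x (Suc i)" "Suc i"] by (simp add: rec_slot_def g)
    have gS: "Suc t < gen x (Suc (Suc i))" using gen_less_iff[of x "Suc i" "Suc (Suc i)"] unfolding g by simp
    have keep: "tracks x (Suc i) (Suc t) m' s" if "tracks x i (Suc t) m' s" "m' \<noteq> srv x (Suc i)" for m' s
      using that by (auto simp: tracks_def history_Suc(3) split: option.splits)
    have new: "tracks x (Suc i) (Suc t) (srv x (Suc i)) (Some (Suc i, 0))"
      using r by (simp add: tracks_def g history_Suc(3))
    show ?thesis
    proof (cases "launch1 s1' s2'")
      case True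
      show ?thesis
      by (rule exI[of _ "Suc i"], rule exI[of _ "Some (Suc i, 0)"], rule exI[of _ s2']) (use False keep[OF tr'(2)] new m gS g True in \<open>auto simp: st' relaunch_def simp del: st.simps\<close>)
    next
      case F: False
      show ?thesis
      by (rule exI[of _ "Suc i"], rule exI[of _ s1'], rule exI[of _ "Some (Suc i, 0)"]) (use False keep[OF tr'(1)] new m gS g F in \<open>auto simp: st' relaunch_def simp del: st.simps\<close>)
    qed
  qed
qed

lemma on_server_iff:
  assumes pos: "\<forall>m i. 1 \<le> x m i"
  shows "on_server (st x t) m = Some (j, a) \<longleftrightarrow> srv x j = m \<and> gen x j + a = t \<and> t < rcv x j"
proof -
  obtain i s1 s2 where st: "st x t = (Suc i, s1, s2, min (t - gen x i) (k - 1))" and i: "gen x i \<le> t" "t < gen x (Suc i)"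
    and tr: "tracks x i t S1 s1" "tracks x i t S2 s2" using st_inv[where t = t, OF pos] by blast
  have tr: "tracks x i t m (on_server (st x t) m)" using tr by (cases m) (simp_all add: st)
  show ?thesis
  proof
    assume r: "srv x j = m \<and> gen x j + a = t \<and> t < rcv x j"
    then have "gen x j \<le> t" by auto
    then have "gen x j < gen x (Suc i)" using i(2) by (rule le_less_trans)
    then have "j \<le> i" by simp
    then have f: "rcv x j \<le> free_at x i m" using rcv_le_free[of j i x] r by simp
    show "on_server (st x t) m = Some (j, a)"
    proof (cases "on_server (st x t) m")
      case None
      then show ?thesis using tr f r by (simp add: tracks_def)
    next
      case (Some ja)
      obtain j' a' where s: "on_server (st x t) m = Some (j', a')" using Some by (cases ja) auto
      have j': "srv x j' = m" "gen x j' + a' = t" "t < rcv x j'" using tr by (simp_all add: s tracks_def)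
      have "\<not> j < j'" using same_server[of j j' x] r j' by auto
      moreover have "\<not> j' < j" using same_server[of j' j x] r j' by auto
      ultimately show ?thesis using s r j' by auto
    qed
  qed (use tr in \<open>simp add: tracks_def\<close>)
qed

lemma kill_iff:
  assumes pos: "\<forall>m i. 1 \<le> x m i"
  shows "kill i (st x t) (cmp x (st x t)) \<longleftrightarrow> (\<exists>j>i. rcv x j = Suc t)"
proof -
  obtain n s1 s2 l where st: "st x t = (n, s1, s2, l)" by (cases "st x t")
  have "kill i (st x t) (cmp x (st x t)) \<longleftrightarrow> (\<exists>m j a. on_server (st x t) m = Some (j, a) \<and> i < j \<and> x m j = Suc a)"
  proof
    assume "kill i (st x t) (cmp x (st x t))"
    then show "\<exists>m j a. on_server (st x t) m = Some (j, a) \<and> i < j \<and> x m j = Suc a"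
      by (auto simp: st don_def newer_def split: option.splits intro: exI[of _ S1] exI[of _ S2])
  next
    assume "\<exists>m j a. on_server (st x t) m = Some (j, a) \<and> i < j \<and> x m j = Suc a"
    then obtain m j a where "on_server (st x t) m = Some (j, a)" "i < j" "x m j = Suc a" by blast
    then show "kill i (st x t) (cmp x (st x t))"
      by (cases m) (auto simp: st don_def newer_def)
  qed
  also have "\<dots> \<longleftrightarrow> (\<exists>j>i. rcv x j = Suc t)"
  proof
    assume "\<exists>m j a. on_server (st x t) m = Some (j, a) \<and> i < j \<and> x m j = Suc a"
    then show "\<exists>j>i. rcv x j = Suc t" by (auto simp: on_server_iff[OF pos] rec_slot_def)
  next
    assume "\<exists>j>i. rcv x j = Suc t"
    then obtain j where j: "i < j" "gen x j + x (srv x j) j = Suc t" by (auto simp: rec_slot_def)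
    have "1 \<le> x (srv x j) j" using pos by blast
    then have "on_server (st x t) (srv x j) = Some (j, t - gen x j)" "x (srv x j) j = Suc (t - gen x j)"
      using j(2) by (auto simp: on_server_iff[OF pos] rec_slot_def)
    then show "\<exists>m j a. on_server (st x t) m = Some (j, a) \<and> i < j \<and> x m j = Suc a" using j(1) by blast
  qed
  finally show ?thesis .
qed

lemma inserv_iff:
  assumes pos: "\<forall>m i. 1 \<le> x m i" and "gen x i \<le> t"
  shows "inserv i (st x t) \<longleftrightarrow> t < rcv x i"
proof -
  obtain n s1 s2 l where st: "st x t = (n, s1, s2, l)" by (cases "st x t")
  have "inserv i (st x t) \<longleftrightarrow> (\<exists>m a. on_server (st x t) m = Some (i, a))"
  proof
    assume "inserv i (st x t)"
    then show "\<exists>m a. on_server (st x t) m = Some (i, a)"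
      by (auto simp: st serves_def split: option.splits intro: exI[of _ S1] exI[of _ S2])
  next
    assume "\<exists>m a. on_server (st x t) m = Some (i, a)"
    then obtain m a where "on_server (st x t) m = Some (i, a)" by blast
    then show "inserv i (st x t)" by (cases m) (auto simp: st serves_def)
  qed
  also have "\<dots> \<longleftrightarrow> t < rcv x i"
    using assms(2) by (auto simp: on_server_iff[OF pos] intro: le_add_diff_inverse)
  finally show ?thesis .
qed

lemma launches_iff:
  assumes pos: "\<forall>m i. 1 \<le> x m i"
  shows "launches (st x t) (cmp x (st x t)) \<and> fst (st x t) = i \<longleftrightarrow> gen x i = Suc t"
proof -
  obtain i' s1 s2 where st: "st x t = (Suc i', s1, s2, min (t - gen x i') (k - 1))" and i': "gen x i' \<le> t" "t < gen x (Suc i')"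
    using st_inv[where t = t, OF pos] by blast
  obtain i'' where st': "fst (st x (Suc t)) = Suc i''" and i'': "gen x i'' \<le> Suc t" "Suc t < gen x (Suc i'')"
    using st_inv[where t = "Suc t", OF pos] by auto
  have "fst (st x (Suc t)) = (if launches (st x t) (cmp x (st x t)) then Suc (fst (st x t)) else fst (st x t))"
    by (simp add: st relaunch_def)
  then have l: "launches (st x t) (cmp x (st x t)) \<longleftrightarrow> i'' = Suc i'" and l': "\<not> launches (st x t) (cmp x (st x t)) \<longleftrightarrow> i'' = i'"
    using st' st by (auto split: if_splits)
  show ?thesis
  proof
    assume "launches (st x t) (cmp x (st x t)) \<and> fst (st x t) = i"
    then show "gen x i = Suc t" using l i' i'' st by auto
  next
    assume g: "gen x i = Suc t"
    then have "gen x i \<le> gen x i'' \<or> gen x (Suc i'') \<le> gen x i" using gen_le_iff[of x i i''] gen_le_iff[of x "Suc i''" i] by linarith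
    then have "gen x i'' = Suc t" using g i'' by auto
    then have "i'' = i" using g gen_eq_iff[of x i'' i] by simp
    have "gen x i' < gen x i" using i'(1) g by simp
    then have "i' < i" by simp
    have "i = Suc i'" using l l' \<open>i' < i\<close> \<open>i'' = i\<close> by blast
    then show "launches (st x t) (cmp x (st x t)) \<and> fst (st x t) = i" using l \<open>i'' = i\<close> st by simp
  qed
qed

text \<open>Recursive in \<open>r\<close> so that each slot without \<open>kill\<close> becomes one
  application of \<open>Aop\<close>, while the last slot contributes \<open>csuc\<close>.\<close>

primrec succ_at :: "(server \<Rightarrow> nat \<Rightarrow> nat) \<Rightarrow> nat \<Rightarrow> nat \<Rightarrow> nat \<Rightarrow> bool" where
  "succ_at x i s 0 \<longleftrightarrow> kill i (st x s) (cmp x (st x s)) \<and> \<not> inserv i (st x s)"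
| "succ_at x i s (Suc r) \<longleftrightarrow> \<not> kill i (st x s) (cmp x (st x s)) \<and> succ_at x i (Suc s) r"

primrec alive_at :: "(server \<Rightarrow> nat \<Rightarrow> nat) \<Rightarrow> nat \<Rightarrow> nat \<Rightarrow> nat \<Rightarrow> bool" where
  "alive_at x i s 0 \<longleftrightarrow> True"
| "alive_at x i s (Suc r) \<longleftrightarrow> \<not> kill i (st x s) (cmp x (st x s)) \<and> alive_at x i (Suc s) r"

lemma kill_next_rcv:
  assumes pos: "\<forall>m i. 1 \<le> x m i" and "s < next_rcv x i"
  shows "kill i (st x s) (cmp x (st x s)) \<longleftrightarrow> next_rcv x i = Suc s"
  unfolding kill_iff[OF pos] using next_rcv_ex[of i x] next_rcv_le[of i _ x] assms(2)
  by (metis Suc_leI le_antisym)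

lemma succ_at_iff:
  assumes pos: "\<forall>m i. 1 \<le> x m i" and "s < next_rcv x i" "gen x i \<le> s"
  shows "succ_at x i s r \<longleftrightarrow> next_rcv x i = s + r + 1 \<and> rcv x i \<le> s + r"
  using assms(2,3)
proof (induction r arbitrary: s)
  case 0
  then show ?case by (auto simp: kill_next_rcv[OF pos] inserv_iff[OF pos])
next
  case (Suc r)
  show ?case
  proof (cases "next_rcv x i = Suc s")
    case False
    then have "Suc s < next_rcv x i" using Suc.prems by simp
    then show ?thesis using Suc.IH[of "Suc s"] Suc.prems False by (simp add: kill_next_rcv[OF pos])
  qed (use Suc.prems in \<open>simp add: kill_next_rcv[OF pos]\<close>)
qed

lemma alive_at_iff:
  assumes pos: "\<forall>m i. 1 \<le> x m i" and "s < next_rcv x i"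
  shows "alive_at x i s r \<longleftrightarrow> s + r < next_rcv x i"
  using assms(2)
proof (induction r arbitrary: s)
  case (Suc r)
  show ?case
  proof (cases "next_rcv x i = Suc s")
    case False
    then have "Suc s < next_rcv x i" using Suc.prems by simp
    then show ?thesis using Suc.IH[of "Suc s"] Suc.prems False by (simp add: kill_next_rcv[OF pos])
  qed (use Suc.prems in \<open>simp add: kill_next_rcv[OF pos]\<close>)
qed simp

text \<open>By \<open>peak_eq_iff\<close>, success after exactly \<open>h\<close> slots without a
  kill means that packet \<open>i\<close> opens a cycle with peak \<open>h\<close>; the reception
  itself happens in slot h + 1 after the generation.\<close>

lemma succ_at_gen:
  assumes pos: "\<forall>m i. 1 \<le> x m i"
  shows "succ_at x i (gen x i) h \<longleftrightarrow> utd x i \<and> next_rcv x i = gen x i + h + 1"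
  using succ_at_iff[OF pos gen_less_next_rcv order_refl] by (auto simp: utd_next_rcv)

lemma alive_at_gen:
  assumes pos: "\<forall>m i. 1 \<le> x m i"
  shows "alive_at x i (gen x i) r \<longleftrightarrow> gen x i + r < next_rcv x i"
  by (rule alive_at_iff[OF pos gen_less_next_rcv])

end

section \<open>Tails of a phase-type service time; observations\<close>

context stable_queue
begin

lemma urow_surv: "(\<Sum>i<N m. urow m a i * surv m (Suc r) i) = (\<Sum>i<N m. urow m (Suc a) i * surv m r i)"
proof -
  have "(\<Sum>i<N m. urow m a i * surv m (Suc r) i) = (\<Sum>i<N m. \<Sum>j<N m. urow m a i * BS m i j * surv m r j)"
    by (simp add: sum_distrib_left mult.assoc)
  also have "\<dots> = (\<Sum>j<N m. \<Sum>i<N m. urow m a i * BS m i j * surv m r j)"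
    by (rule sum.swap)
  finally show ?thesis by (simp add: sum_distrib_right)
qed

text \<open>Both sides are alpha B^a 1, bracketed from different ends.\<close>

lemma alpha_surv: "(\<Sum>i<N m. aS m i * surv m a i) = (\<Sum>i<N m. urow m a i)"
proof -
  have "(\<Sum>i<N m. urow m b i * surv m r i) = (\<Sum>i<N m. urow m (b + r) i)" for b r
  proof (induction r arbitrary: b)
    case (Suc r)
    show ?case using Suc.IH[of "Suc b"] by (simp only: urow_surv add_Suc add_Suc_right)
  qed simp
  from this[of 0 a] show ?thesis by simp
qed

definition tail :: "server \<Rightarrow> nat \<Rightarrow> real" where
  "tail m a = (\<Sum>i<N m. urow m a i)"

lemma tail_0: "tail m 0 = 1"
  by (simp add: tail_def alpha_sum)

lemma tail_Suc: "tail m a - tail m (Suc a) = (\<Sum>i<N m. urow m a i * bS m i)"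
proof -
  have "(\<Sum>i<N m. urow m a i * bS m i) = (\<Sum>i<N m. urow m a i - urow m a i * surv m 1 i)"
    by (rule sum.cong) (simp_all add: b_eq right_diff_distrib)
  then show ?thesis
    using urow_surv[of m a 0] by (simp add: tail_def sum_subtractf)
qed

lemma tail_tendsto: "tail m \<longlonglongrightarrow> 0"
proof -
  have "(\<lambda>a. \<Sum>i<N m. aS m i * surv m a i) \<longlonglongrightarrow> (\<Sum>i<N m. aS m i * 0)"
    by (intro tendsto_sum tendsto_mult tendsto_const surv_tendsto_0) auto
  then show ?thesis by (simp add: alpha_surv tail_def[abs_def])
qed

text \<open>Up to null sets, the absorption time exceeds \<open>a\<close> exactly when the chain is
  in transient phases at times 0 to \<open>a\<close>; summing path probabilities gives alpha B^a
  1.\<close>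

lemma dph_tail:
  assumes "dph_distributed M T (N m) (\<alpha> m) (B m)" and T: "T \<in> measurable M (count_space UNIV)"
  shows "measure M {\<omega>\<in>space M. a < T \<omega>} = tail m a"
proof -
  let ?S = "insert None (Some ` {..<N m})"
  obtain Q :: "(nat \<Rightarrow> nat option) measure" and X where
    mc: "markov_chain Q X ?S (dph_start (\<alpha> m)) (dph_step (N m) (B m))"
    and dist: "distr M (count_space UNIV) T = distr Q (count_space UNIV) (\<lambda>\<omega>. LEAST t. X t \<omega> = None)"
    using assms(1) unfolding dph_distributed_def by blast
  interpret Q: prob_space Q using mc by (simp add: markov_chain_def)
  have X: "X t \<in> measurable Q (count_space ?S)" for t
    using mc by (simp add: markov_chain_def)
  have path: "measure Q {\<omega> \<in> space Q. \<forall>t\<le>n. X t \<omega> = y t}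
      = dph_start (\<alpha> m) (y 0) * (\<Prod>t<n. dph_step (N m) (B m) (y t) (y (Suc t)))" if "\<And>t. t \<le> n \<Longrightarrow> y t \<in> ?S" for n y
    using mc that by (simp add: markov_chain_def)
  have XS: "X t \<omega> \<in> ?S" if "\<omega> \<in> space Q" for t \<omega>
    using measurable_space[OF X that] by simp
  have pred: "{\<omega> \<in> space Q. X t \<omega> \<in> A} \<in> sets Q" for t A
  proof -
    have "X t -` (A \<inter> ?S) \<inter> space Q \<in> sets Q" using X by (rule measurable_sets) auto
    moreover have "X t -` (A \<inter> ?S) \<inter> space Q = {\<omega> \<in> space Q. X t \<omega> \<in> A}" using XS by blast
    ultimately show ?thesis by simp
  qed
  have pred_eq [measurable]: "Measurable.pred Q (\<lambda>\<omega>. X t \<omega> = v)" for t v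
    using pred[of t "{v}"] by (simp add: pred_def)
  \<comment> \<open>Induction on the number \<open>r\<close> of steps whose phases are unspecified,
    splitting by the phase at time \<open>Suc n\<close>.\<close>
  have claim: "measure Q {\<omega> \<in> space Q. (\<forall>t\<le>n. X t \<omega> = y t) \<and> (\<forall>t. n < t \<and> t \<le> n + r \<longrightarrow> X t \<omega> \<noteq> None)}
      = dph_start (\<alpha> m) (y 0) * (\<Prod>t<n. dph_step (N m) (B m) (y t) (y (Suc t))) * surv m r (the (y n))"
    if "\<And>t. t \<le> n \<Longrightarrow> y t \<in> Some ` {..<N m}" for n r y
    using that
  proof (induction r arbitrary: n y)
    case 0
    have "y t \<in> ?S" if "t \<le> n" for t using 0[OF that] by auto
    moreover have "{\<omega> \<in> space Q. (\<forall>t\<le>n. X t \<omega> = y t) \<and> (\<forall>t. n < t \<and> t \<le> n + 0 \<longrightarrow> X t \<omega> \<noteq> None)}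
        = {\<omega> \<in> space Q. \<forall>t\<le>n. X t \<omega> = y t}" by auto
    ultimately show ?case using path[of n y] by (simp only: surv.simps mult_1_right)
  next
    case (Suc r)
    let ?y = "\<lambda>i. y(Suc n := Some i)"
    let ?E = "\<lambda>i. {\<omega> \<in> space Q. (\<forall>t\<le>Suc n. X t \<omega> = ?y i t) \<and> (\<forall>t. Suc n < t \<and> t \<le> Suc n + r \<longrightarrow> X t \<omega> \<noteq> None)}"
    have "{\<omega> \<in> space Q. (\<forall>t\<le>n. X t \<omega> = y t) \<and> (\<forall>t. n < t \<and> t \<le> n + Suc r \<longrightarrow> X t \<omega> \<noteq> None)} = (\<Union>i<N m. ?E i)"
    proof (rule Set.set_eqI, rule iffI)
      fix \<omega> assume w: "\<omega> \<in> {\<omega> \<in> space Q. (\<forall>t\<le>n. X t \<omega> = y t) \<and> (\<forall>t. n < t \<and> t \<le> n + Suc r \<longrightarrow> X t \<omega> \<noteq> None)}"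
      then have "X (Suc n) \<omega> \<noteq> None" "X (Suc n) \<omega> \<in> ?S" using XS by auto
      then obtain i where i: "i < N m" "X (Suc n) \<omega> = Some i" by auto
      have "\<omega> \<in> ?E i" using w i(2) by (auto simp: le_Suc_eq)
      then show "\<omega> \<in> (\<Union>i<N m. ?E i)" using i(1) by blast
    next
      fix \<omega> assume "\<omega> \<in> (\<Union>i<N m. ?E i)"
      then obtain i where i: "i < N m" "\<omega> \<in> ?E i" by blast
      have "X (Suc n) \<omega> = Some i" using i(2) by simp
      moreover have "X t \<omega> = y t" if "t \<le> n" for t using i(2) that by (auto dest!: spec[of _ t])
      moreover have "X t \<omega> \<noteq> None" if "n < t" "t \<le> n + Suc r" for t
        using i(2) that \<open>X (Suc n) \<omega> = Some i\<close> by (cases "t = Suc n") auto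
      ultimately show "\<omega> \<in> {\<omega> \<in> space Q. (\<forall>t\<le>n. X t \<omega> = y t) \<and> (\<forall>t. n < t \<and> t \<le> n + Suc r \<longrightarrow> X t \<omega> \<noteq> None)}"
        using i(2) by blast
    qed
    moreover have "measure Q (\<Union>i<N m. ?E i) = (\<Sum>i<N m. measure Q (?E i))"
    proof (rule Q.finite_measure_finite_Union)
      show "disjoint_family_on ?E {..<N m}"
        by (auto simp: disjoint_family_on_def dest!: spec[of _ "Suc n"])
      have "?E i \<in> sets Q" for i by measurable
      then show "?E ` {..<N m} \<subseteq> sets Q" by blast
    qed simp
    moreover have "measure Q (?E i) = dph_start (\<alpha> m) (y 0) * (\<Prod>t<n. dph_step (N m) (B m) (y t) (y (Suc t)))
        * (BS m (the (y n)) i * surv m r i)" if i: "i < N m" for i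
    proof -
      have "?y i t \<in> Some ` {..<N m}" if "t \<le> Suc n" for t using Suc.prems[of t] i that by auto
      then have "measure Q (?E i) = dph_start (\<alpha> m) (?y i 0) * (\<Prod>t<Suc n. dph_step (N m) (B m) (?y i t) (?y i (Suc t))) * surv m r (the (?y i (Suc n)))"
        by (rule Suc.IH)
      moreover obtain i0 where "y n = Some i0" using Suc.prems[of n] by auto
      ultimately show ?thesis by (simp add: mult.assoc)
    qed
    ultimately show ?case by (simp add: sum_distrib_left)
  qed
  define alive where "alive a = {\<omega> \<in> space Q. \<forall>t\<le>a. X t \<omega> \<noteq> None}" for a
  have alive_sets [measurable]: "alive a \<in> sets Q" for a unfolding alive_def by measurable
  have alive: "measure Q (alive a) = tail m a" for a
  proof -
    let ?E = "\<lambda>i. {\<omega> \<in> space Q. (\<forall>t\<le>(0::nat). X t \<omega> = (\<lambda>_. Some i) t) \<and> (\<forall>t. 0 < t \<and> t \<le> 0 + a \<longrightarrow> X t \<omega> \<noteq> None)}"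
    have "alive a = (\<Union>i<N m. ?E i)"
    proof (rule Set.set_eqI, rule iffI)
      fix \<omega> assume w: "\<omega> \<in> alive a"
      then have "X 0 \<omega> \<noteq> None" "X 0 \<omega> \<in> ?S" using XS by (auto simp: alive_def)
      then obtain i where "i < N m" "X 0 \<omega> = Some i" by auto
      then show "\<omega> \<in> (\<Union>i<N m. ?E i)" using w by (auto simp: alive_def)
    next
      fix \<omega> assume "\<omega> \<in> (\<Union>i<N m. ?E i)"
      then show "\<omega> \<in> alive a" by (auto simp: alive_def) (metis gr0I option.distinct(1))
    qed
    moreover have "measure Q (\<Union>i<N m. ?E i) = (\<Sum>i<N m. measure Q (?E i))"
    proof (rule Q.finite_measure_finite_Union)
      show "disjoint_family_on ?E {..<N m}"
        by (auto simp: disjoint_family_on_def)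
      have "?E i \<in> sets Q" for i by measurable
      then show "?E ` {..<N m} \<subseteq> sets Q" by blast
    qed simp
    moreover have "measure Q (?E i) = aS m i * surv m a i" if "i < N m" for i
      using claim[of 0 "\<lambda>_. Some i" a] that by simp
    ultimately show ?thesis by (simp add: alpha_surv tail_def)
  qed
  \<comment> \<open>On a path that is never absorbed the \<open>LEAST\<close> is arbitrary, so such
    paths must form a null set.\<close>
  have "AE \<omega> in Q. \<exists>t. X t \<omega> = None"
  proof -
    let ?N = "{\<omega> \<in> space Q. \<forall>t. X t \<omega> \<noteq> None}"
    have sets: "?N \<in> sets Q" by measurable
    have "measure Q ?N \<le> tail m a" for a
      unfolding alive[symmetric] by (intro Q.finite_measure_mono) (auto simp: alive_def[of a])
    then have "measure Q ?N \<le> 0"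
      using tail_tendsto[of m] by (intro LIMSEQ_le_const) auto
    then have "measure Q ?N = 0" using measure_nonneg[of Q ?N] by linarith
    then have "?N \<in> null_sets Q" using sets by (simp add: Q.emeasure_eq_measure null_sets_def)
    then show ?thesis by (rule AE_I') auto
  qed
  moreover have "(\<forall>t\<le>a. X t \<omega> \<noteq> None) \<longleftrightarrow> a < (LEAST t. X t \<omega> = None)" if "\<exists>t. X t \<omega> = None" for \<omega>
    using LeastI_ex[OF that] not_less_Least[of _ "\<lambda>t. X t \<omega> = None"] by (meson leI le_less_trans)
  ultimately have ae: "AE \<omega> in Q. \<omega> \<in> alive a \<longleftrightarrow> \<omega> \<in> {\<omega> \<in> space Q. a < (LEAST t. X t \<omega> = None)}"
    by (auto simp: alive_def elim!: eventually_mono)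
  have L [measurable]: "(\<lambda>\<omega>. LEAST t. X t \<omega> = None) \<in> measurable Q (count_space UNIV)"
    by measurable
  have "measure M {\<omega>\<in>space M. a < T \<omega>} = measure (distr M (count_space UNIV) T) {a<..}"
    using T by (subst measure_distr) (auto simp: vimage_def Int_def conj_commute)
  also have "\<dots> = measure Q {\<omega> \<in> space Q. a < (LEAST t. X t \<omega> = None)}"
    unfolding dist by (subst measure_distr[OF L]) (auto simp: vimage_def Int_def conj_commute)
  also have "\<dots> = measure Q (alive a)"
    using ae by (intro measure_eq_AE) (auto elim!: eventually_mono)
  finally show ?thesis by (simp add: alive)
qed

text \<open>The completions of the first \<open>t\<close> slots, latest first. They determine the
  configuration (\<open>st_obs\<close>), hence all decisions of the system.\<close>

primrec obs :: "(server \<Rightarrow> nat \<Rightarrow> nat) \<Rightarrow> nat \<Rightarrow> (bool \<times> bool) list" where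
  "obs x 0 = []"
| "obs x (Suc t) = cmp x (st x t) # obs x t"

primrec cfgo :: "(bool \<times> bool) list \<Rightarrow> config" where
  "cfgo [] = cfg0"
| "cfgo (c # q) = nxt (cfgo q) c"

primrec wgt :: "(bool \<times> bool) list \<Rightarrow> real" where
  "wgt [] = 1"
| "wgt (c # q) = wgt q * facs (cfgo q) c"

text \<open>The unnormalised conditional expectation of \<open>f\<close>, over hidden phases and
  clock, given the observations \<open>q\<close>.\<close>

definition Z :: "(bool \<times> bool) list \<Rightarrow> wfun \<Rightarrow> real" where
  "Z q f = wgt q * pair (cfgo q) f"

lemma st_obs: "st x t = cfgo (obs x t)"
  by (induction t) auto

lemma length_obs [simp]: "length (obs x t) = t"
  by (induction t) auto

lemma Z_Cons: "Z (c # q) f = Z q (Kc c f)"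
  by (simp add: Z_def mult.assoc pair_nxt)

lemma obs_Suc: "obs x (Suc t) = c # q \<longleftrightarrow> obs x t = q \<and> cmp x (cfgo q) = c"
  by (auto simp: st_obs)

end

section \<open>The probability of an observed history\<close>

locale queue_model = stable_queue +
  fixes M :: "'w measure" and T :: "server \<Rightarrow> nat \<Rightarrow> 'w \<Rightarrow> nat"
  assumes prob_space_M: "prob_space M"
    and dist: "\<And>m n. dph_distributed M (T m n) (N m) (\<alpha> m) (B m)"
    and indep: "prob_space.indep_vars M (\<lambda>_. count_space UNIV) (\<lambda>(m, n). T m n) UNIV"
begin

sublocale prob_space M by (rule prob_space_M)

definition xx :: "'w \<Rightarrow> server \<Rightarrow> nat \<Rightarrow> nat" where
  "xx \<omega> = (\<lambda>m i. T m i \<omega>)"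

lemma T_measurable [measurable]: "T m n \<in> measurable M (count_space UNIV)"
  using indep unfolding indep_vars_def by (auto dest!: bspec[of _ _ "(m, n)"])

text \<open>Dependence on the service times of packets below \<open>n\<close> only; in this form the
  independence of a new packet from the past is used.\<close>

definition dep :: "nat \<Rightarrow> ((server \<Rightarrow> nat \<Rightarrow> nat) \<Rightarrow> 'b) \<Rightarrow> bool" where
  "dep n \<phi> \<longleftrightarrow> (\<forall>x y. (\<forall>m. \<forall>i<n. x m i = y m i) \<longrightarrow> \<phi> x = \<phi> y)"

lemma dep_D: "dep n \<phi> \<Longrightarrow> (\<And>m i. i < n \<Longrightarrow> x m i = y m i) \<Longrightarrow> \<phi> x = \<phi> y"
  by (auto simp: dep_def)

abbreviation "past n \<omega> \<equiv> restrict (\<lambda>p. (\<lambda>(m, n). T m n) p \<omega>) (UNIV \<times> {..<n})"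

lemma dep_past:
  assumes "dep n \<phi>"
  shows "\<phi> (xx \<omega>) = \<phi> (\<lambda>m i. past n \<omega> (m, i))"
  by (rule dep_D[OF assms]) (simp add: xx_def)

lemma finite_servers: "finite (UNIV :: server set)"
proof -
  have "(UNIV :: server set) \<subseteq> {S1, S2}" using server.exhaust by auto
  then show ?thesis by (rule finite_subset) simp
qed

text \<open>A finite product of discrete countable spaces is discrete, so every function of finitely
  many service times is measurable.\<close>

lemma past_space: "PiM ((UNIV :: server set) \<times> {..<n :: nat}) (\<lambda>_. count_space (UNIV :: nat set))
    = count_space (PiE (UNIV \<times> {..<n}) (\<lambda>_. UNIV))"
  by (rule count_space_PiM_finite) (use finite_servers in \<open>auto intro: finite_cartesian_product\<close>)

lemma dep_sets:
  assumes "dep n \<phi>"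
  shows "{\<omega> \<in> space M. \<phi> (xx \<omega>)} \<in> events"
proof -
  have "past n \<in> measurable M (PiM (UNIV \<times> {..<n}) (\<lambda>_. count_space UNIV))"
    by (rule measurable_restrict) (auto simp: split_beta)
  then have m: "past n \<in> measurable M (count_space (PiE (UNIV \<times> {..<n}) (\<lambda>_. UNIV)))"
    by (simp add: past_space)
  have "past n -` {f \<in> PiE (UNIV \<times> {..<n}) (\<lambda>_. UNIV). \<phi> (\<lambda>m i. f (m, i))} \<inter> space M \<in> events"
    using m by (rule measurable_sets) auto
  moreover have "past n -` {f \<in> PiE (UNIV \<times> {..<n}) (\<lambda>_. UNIV). \<phi> (\<lambda>m i. f (m, i))} \<inter> space M = {\<omega> \<in> space M. \<phi> (xx \<omega>)}"
    using dep_past[OF assms] by auto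
  ultimately show ?thesis by simp
qed

lemma dep_indep:
  assumes "dep n \<phi>"
  shows "prob {\<omega> \<in> space M. \<phi> (xx \<omega>) \<and> T m n \<omega> \<in> X} = prob {\<omega> \<in> space M. \<phi> (xx \<omega>)} * prob {\<omega> \<in> space M. T m n \<omega> \<in> X}"
proof -
  let ?A = "(UNIV :: server set) \<times> {..<n}" and ?B = "{(m, n)}"
  let ?C = "\<lambda>A. PiM A (\<lambda>_ :: server \<times> nat. count_space (UNIV :: nat set))"
  let ?b = "\<lambda>\<omega>. restrict (\<lambda>p. (\<lambda>(m, n). T m n) p \<omega>) ?B"
  have ind: "indep_var (?C ?A) (past n) (?C ?B) ?b"
    using indep by (rule indep_var_restrict) auto
  let ?Xa = "{f \<in> PiE ?A (\<lambda>_. UNIV). \<phi> (\<lambda>m i. f (m, i))}" and ?Xb = "{f \<in> space (?C ?B). f (m, n) \<in> X}"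
  have a: "?Xa \<in> sets (?C ?A)" unfolding past_space by auto
  have b: "?Xb \<in> sets (?C ?B)"
    by (rule measurable_sets_Collect[where N = "count_space UNIV"]) auto
  have e1: "(\<lambda>x. (past n x, ?b x)) -` (?Xa \<times> ?Xb) \<inter> space M = {\<omega> \<in> space M. \<phi> (xx \<omega>) \<and> T m n \<omega> \<in> X}"
    using dep_past[OF assms] by (auto simp: space_PiM)
  have e2: "past n -` ?Xa \<inter> space M = {\<omega> \<in> space M. \<phi> (xx \<omega>)}"
    using dep_past[OF assms] by auto
  have e3: "?b -` ?Xb \<inter> space M = {\<omega> \<in> space M. T m n \<omega> \<in> X}"
    by (auto simp: space_PiM)
  show ?thesis using indep_varD[OF ind a b] unfolding e1 e2 e3 .
qed

lemma T_tail: "prob {\<omega> \<in> space M. a < T m n \<omega>} = tail m a"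
  by (rule dph_tail[OF dist T_measurable])

lemma T_eq_Suc: "prob {\<omega> \<in> space M. T m n \<omega> = Suc a} = (\<Sum>i<N m. urow m a i * bS m i)"
proof -
  have "prob {\<omega> \<in> space M. T m n \<omega> = Suc a} = prob ({\<omega> \<in> space M. a < T m n \<omega>} - {\<omega> \<in> space M. Suc a < T m n \<omega>})"
    by (rule arg_cong[where f = prob]) auto
  also have "\<dots> = prob {\<omega> \<in> space M. a < T m n \<omega>} - prob {\<omega> \<in> space M. Suc a < T m n \<omega>}"
    by (rule finite_measure_Diff) auto
  finally show ?thesis by (simp add: T_tail tail_Suc)
qed

text \<open>A service starts in a transient phase, so it takes at least one slot. The pathwise
  lemmas with premise \<open>pos\<close> thereby hold almost surely.\<close>

lemma T_pos: "AE \<omega> in M. \<forall>m i. 1 \<le> xx \<omega> m i"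
proof -
  have "AE \<omega> in M. 0 < T m i \<omega>" for m i
    using T_tail[of 0 m i] by (simp add: prob_Collect_eq_1 tail_0)
  then have "AE \<omega> in M. \<forall>i. 0 < T m i \<omega>" for m
    by (simp add: AE_all_countable)
  then have "AE \<omega> in M. (\<forall>i. 0 < T S1 i \<omega>) \<and> (\<forall>i. 0 < T S2 i \<omega>)" by simp
  then show ?thesis
    by eventually_elim (metis One_nat_def Suc_leI server.exhaust xx_def)
qed

definition in_set :: "server \<Rightarrow> serving \<Rightarrow> nat set \<Rightarrow> (server \<Rightarrow> nat \<Rightarrow> nat) \<Rightarrow> bool" where
  "in_set m s X x \<longleftrightarrow> (case s of None \<Rightarrow> True | Some (j, a) \<Rightarrow> x m j \<in> X)"

definition mass :: "server \<Rightarrow> serving \<Rightarrow> nat set \<Rightarrow> real" where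
  "mass m s X = (case s of None \<Rightarrow> 1 | Some (j, a) \<Rightarrow> prob {\<omega> \<in> space M. T m j \<omega> \<in> X \<inter> {a<..}})"

text \<open>Seeing \<open>c\<close> either fixes the service time to \<open>Suc a\<close> or
  excludes this value, so the event is again of the form \<open>in_set\<close>, for another set
  \<open>Y\<close>. The exceptional case is a completion on an idle server, which is impossible and
  has weight 0.\<close>

lemma mass_adv:
  "\<exists>Y. (\<forall>x. don m x s = c \<and> in_set m (adv s c) X x \<longleftrightarrow> in_set m s Y x \<and> (c \<longrightarrow> s \<noteq> None))
     \<and> (if c \<longrightarrow> s \<noteq> None then mass m s Y = fac m s c * mass m (adv s c) X else fac m s c = 0)"
proof (cases s)
  case None
  then show ?thesis by (auto simp: don_def in_set_def adv_def mass_def fac_def)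
next
  case (Some ja)
  then obtain j a where s: "s = Some (j, a)" by (cases ja) auto
  show ?thesis
  proof (cases c)
    case True
    have "mass m s {Suc a} = prob {\<omega> \<in> space M. T m j \<omega> = Suc a}"
      unfolding s mass_def option.case prod.case by (rule arg_cong[where f = prob]) auto
    then have "mass m s {Suc a} = fac m s c * mass m (adv s c) X"
      using True by (simp add: s mass_def[of _ None] fac_def adv_def T_eq_Suc)
    then show ?thesis using True
      by (intro exI[of _ "{Suc a}"]) (auto simp: s don_def in_set_def adv_def)
  next
    case False
    have "X \<inter> - {Suc a} \<inter> {a<..} = X \<inter> {Suc a<..}" by auto
    moreover have "adv s c = Some (j, Suc a)" "fac m s c = 1" using False by (simp_all add: s adv_def fac_def)
    ultimately have "mass m s (X \<inter> - {Suc a}) = fac m s c * mass m (adv s c) X"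
      by (simp only: s mass_def option.case prod.case mult_1)
    then show ?thesis using False
      by (intro exI[of _ "X \<inter> - {Suc a}"]) (auto simp: s don_def in_set_def adv_def)
  qed
qed

lemma bounded_idx_nxt: "bounded_idx z \<Longrightarrow> bounded_idx (nxt z c)"
proof -
  assume b: "bounded_idx z"
  obtain n s1 s2 l where z: "z = (n, s1, s2, l)" by (cases z)
  obtain c1 c2 where c: "c = (c1, c2)" by (cases c)
  have "j < n" if "adv s1 c1 = Some (j, a) \<or> adv s2 c2 = Some (j, a)" for j a
    using b that by (auto simp: z adv_def split: if_splits)
  then show ?thesis by (fastforce simp: z c relaunch_def)
qed

lemma bounded_idx_cfgo: "bounded_idx (cfgo q)"
  by (induction q) (simp_all add: bounded_idx_nxt, simp add: cfg0_def)

lemma fst_cfgo_mono: "fst (cfgo q) \<le> fst (cfgo (c # q))"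
  by (cases "cfgo q"; cases c) (simp add: relaunch_def)

lemma dep_in_set: "(\<And>j a. s = Some (j, a) \<Longrightarrow> j < n) \<Longrightarrow> dep n (in_set m s X)"
  by (auto simp: dep_def in_set_def split: option.splits)

lemma dep_conj: "dep n \<phi> \<Longrightarrow> dep n \<psi> \<Longrightarrow> dep n (\<lambda>x. \<phi> x \<and> \<psi> x)"
  unfolding dep_def by metis

lemma dep_mono: "dep n \<phi> \<Longrightarrow> n \<le> n' \<Longrightarrow> dep n' \<phi>"
  by (simp add: dep_def)

lemma dep_cmp: "bounded_idx z \<Longrightarrow> dep (fst z) (\<lambda>x. cmp x z = c)"
proof -
  assume b: "bounded_idx z"
  obtain n s1 s2 l where z: "z = (n, s1, s2, l)" by (cases z)
  have "don m x s = don m y s" if "\<And>m i. i < n \<Longrightarrow> x m i = y m i" "\<And>j a. s = Some (j, a) \<Longrightarrow> j < n" for m x y s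
    using that by (auto simp: don_def split: option.splits)
  note D = this
  show ?thesis
    unfolding dep_def
  proof (intro allI impI)
    fix x y :: "server \<Rightarrow> nat \<Rightarrow> nat" assume "\<forall>m. \<forall>i<fst z. x m i = y m i"
    then have "don S1 x s1 = don S1 y s1" "don S2 x s2 = don S2 y s2"
      using b by (auto simp: z intro!: D)
    then show "(cmp x z = c) = (cmp y z = c)" by (simp add: z)
  qed
qed

text \<open>The observation after \<open>q\<close> concerns packets already in service, all numbered
  below \<open>fst (cfgo q)\<close>; the packet that may be launched next is not involved.\<close>

lemma dep_obs_Suc: "dep (fst (cfgo q)) (\<lambda>x. obs x (Suc (length q)) = c # q)"
proof (induction q arbitrary: c)
  case Nil
  then show ?case using dep_cmp[OF bounded_idx_cfgo[of "[]"]] by (simp add: obs_Suc)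
next
  case (Cons c' q)
  have "dep (fst (cfgo (c' # q))) (\<lambda>x. obs x (Suc (length q)) = c' # q \<and> cmp x (cfgo (c' # q)) = c)"
    using dep_mono[OF Cons.IH fst_cfgo_mono] dep_cmp[OF bounded_idx_cfgo] by (rule dep_conj)
  then show ?case by (simp only: obs_Suc[where t = "Suc (length q)"] list.size add_Suc_right add_0_right)
qed

lemma dep_obs: "\<exists>n. dep n (\<lambda>x. obs x t = q)"
proof (induction t arbitrary: q)
  case 0
  show ?case by (simp add: dep_def)
next
  case (Suc t)
  show ?case
  proof (cases q)
    case Nil
    then show ?thesis by (simp add: dep_def)
  next
    case (Cons c q')
    obtain n where n: "dep n (\<lambda>x. obs x t = q')" using Suc by blast
    have "dep (max n (fst (cfgo q'))) (\<lambda>x. obs x t = q' \<and> cmp x (cfgo q') = c)"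
      by (intro dep_conj dep_mono[OF n] dep_mono[OF dep_cmp[OF bounded_idx_cfgo]]) auto
    then show ?thesis unfolding Cons obs_Suc by blast
  qed
qed

end

context stable_queue
begin

declare obs.simps(2) [simp del] cfgo.simps(2) [simp del]

lemma ev_cong:
  assumes "\<And>p. matches s p \<Longrightarrow> (\<And>i. p = Some i \<Longrightarrow> i < N m) \<Longrightarrow> f p = g p"
  shows "ev m s f = ev m s g"
proof (cases s)
  case None
  then show ?thesis using assms[of None] by (simp add: ev_def)
next
  case (Some ja)
  then have "f (Some i) = g (Some i)" if "i < N m" for i using assms[of "Some i"] that by simp
  then show ?thesis using Some by (simp add: ev_def split: prod.split)
qed

lemma pair_cong:
  assumes "\<And>p1 p2. matches s1 p1 \<Longrightarrow> matches s2 p2 \<Longrightarrow> (\<And>i. p1 = Some i \<Longrightarrow> i < N S1) \<Longrightarrow> (\<And>j. p2 = Some j \<Longrightarrow> j < N S2)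
     \<Longrightarrow> f p1 p2 l = g p1 p2 l"
  shows "pair (n, s1, s2, l) f = pair (n, s1, s2, l) g"
  unfolding pair.simps by (intro ev_cong assms)

lemma ev_add: "ev m s (\<lambda>p. f p + g p) = ev m s f + ev m s g"
  by (auto simp: ev_def distrib_left sum.distrib split: option.splits)

lemma pair_sum: "pair z (\<lambda>p1 p2 l. \<Sum>x\<in>X. f x p1 p2 l) = (\<Sum>x\<in>X. pair z (f x))"
  by (cases z) (simp add: ev_sum)

lemma pair_scale: "pair z (\<lambda>p1 p2 l. c * f p1 p2 l) = c * pair z f"
  by (cases z) (simp add: ev_mult)

lemma pair_zero: "pair z (\<lambda>_ _ _. 0) = 0"
  using pair_scale[of z 0 "\<lambda>_ _ _. 0"] by simp

lemma Z_sum: "Z q (\<lambda>p1 p2 l. \<Sum>x\<in>X. f x p1 p2 l) = (\<Sum>x\<in>X. Z q (f x))"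
  by (simp add: Z_def pair_sum sum_distrib_left)

lemma Z_scale: "Z q (\<lambda>p1 p2 l. c * f p1 p2 l) = c * Z q f"
  by (simp add: Z_def pair_scale)

lemma Z_if: "Z q (\<lambda>p1 p2 l. if P then f p1 p2 l else 0) = (if P then Z q f else 0)"
  by (simp add: Z_def pair_zero)

lemma urow_nonneg: "i < N m \<Longrightarrow> 0 \<le> urow m a i"
  by (induction a arbitrary: i) (auto simp: alpha_nonneg B_nonneg intro!: sum_nonneg)

lemma ev_nonneg:
  assumes "\<And>p. matches s p \<Longrightarrow> (\<And>i. p = Some i \<Longrightarrow> i < N m) \<Longrightarrow> 0 \<le> f p"
  shows "0 \<le> ev m s f"
  using assms by (auto simp: ev_def urow_nonneg intro!: sum_nonneg mult_nonneg_nonneg split: option.splits)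

lemma fac_nonneg: "0 \<le> fac m s c"
  by (auto simp: fac_def urow_nonneg b_nonneg intro!: sum_nonneg split: option.splits)

lemma wgt_nonneg: "0 \<le> wgt q"
proof (induction q)
  case (Cons c q)
  then show ?case by (cases "cfgo q"; cases c) (simp add: fac_nonneg)
qed simp

lemma clock_nxt: "snd (snd (snd (nxt z c))) < k"
  using k_ge by (cases z; cases c) (auto simp: relaunch_def min_def)

lemma clock_cfgo: "snd (snd (snd (cfgo q))) < k"
  using k_ge clock_nxt by (cases q) (auto simp: cfg0_def cfgo.simps)

lemma Z_nonneg:
  assumes "\<And>p1 p2 l. phases p1 p2 l \<Longrightarrow> 0 \<le> f p1 p2 l"
  shows "0 \<le> Z q f"
proof -
  obtain n s1 s2 l where z: "cfgo q = (n, s1, s2, l)" by (cases "cfgo q")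
  then have "l < k" using clock_cfgo[of q] by simp
  then have "0 \<le> pair (cfgo q) f"
    unfolding z pair.simps by (intro ev_nonneg assms) (auto simp: phases_def)
  then show ?thesis by (simp add: Z_def wgt_nonneg)
qed

lemma Z_mono:
  assumes "\<And>p1 p2 l. phases p1 p2 l \<Longrightarrow> f p1 p2 l \<le> g p1 p2 l"
  shows "Z q f \<le> Z q g"
proof -
  have "Z q g = Z q f + Z q (\<lambda>p1 p2 l. g p1 p2 l - f p1 p2 l)"
    by (cases "cfgo q") (simp add: Z_def distrib_left[symmetric] ev_add[symmetric])
  then show ?thesis using Z_nonneg[of "\<lambda>p1 p2 l. g p1 p2 l - f p1 p2 l" q] assms by simp
qed

lemma Z_bound:
  assumes "\<And>p1 p2 l. phases p1 p2 l \<Longrightarrow> \<bar>f p1 p2 l\<bar> \<le> e"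
  shows "\<bar>Z q f\<bar> \<le> e * Z q (\<lambda>_ _ _. 1)"
proof -
  have "Z q f \<le> Z q (\<lambda>_ _ _. e * 1)" using assms by (intro Z_mono) (auto simp: abs_le_iff)
  moreover have "Z q (\<lambda>_ _ _. (- e) * 1) \<le> Z q f" using assms by (intro Z_mono) (fastforce simp: abs_le_iff)
  ultimately show ?thesis unfolding Z_scale by (simp add: abs_le_iff)
qed

lemma valid_nxt:
  assumes "valid i z" "bounded_idx z"
  shows "valid i (nxt z c)"
proof -
  obtain n s1 s2 l where z: "z = (n, s1, s2, l)" by (cases z)
  obtain c1 c2 where c: "c = (c1, c2)" by (cases c)
  have adv: "\<exists>a'. s = Some (j, a')" if "adv s c = Some (j, a)" for s c j a
    using that by (auto simp: adv_def split: if_splits)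
  have old: "older i s" if "older i (adv s c)" for s c
    using that by (cases s) (auto simp: older_def adv_def split: if_splits)
  have lt: "j < n" if "adv s1 c1 = Some (j, a) \<or> adv s2 c2 = Some (j, a)" for j a
    using assms(2) that adv unfolding z bounded_idx.simps by blast
  have ne: "adv s2 c2 \<noteq> Some (j, a')" if "adv s1 c1 = Some (j, a)" for j a a'
    using assms(1) that adv unfolding z valid.simps by metis
  have no: "\<not> (older i (adv s1 c1) \<and> older i (adv s2 c2))"
    using assms(1) old by (auto simp: z)
  have new: "\<not> older i (Some (n, 0))" using assms(1) by (auto simp: z older_def)
  show ?thesis
    using assms(1) k_ge lt ne no new unfolding z c nxt.simps relaunch_def
    by (auto simp: less_Suc_eq) 
qed

lemma valid_launch:
  assumes "launches z c" "bounded_idx z"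
  shows "valid (fst z) (nxt z c)"
proof -
  obtain n s1 s2 l where z: "z = (n, s1, s2, l)" by (cases z)
  obtain c1 c2 where c: "c = (c1, c2)" by (cases c)
  have adv: "\<exists>a'. s = Some (j, a')" if "adv s c = Some (j, a)" for s c j a
    using that by (auto simp: adv_def split: if_splits)
  have lt: "j < n" if "adv s1 c1 = Some (j, a) \<or> adv s2 c2 = Some (j, a)" for j a
    using assms(2) that adv unfolding z bounded_idx.simps by blast
  have new: "\<not> older n (Some (n, 0))" by (simp add: older_def)
  show ?thesis
    using assms(1) k_ge lt new unfolding z c
    by (auto simp: relaunch_def less_Suc_eq)
qed

end

context queue_model
begin

lemma mass_new: "mass m (Some (j, 0)) X = prob {\<omega> \<in> space M. T m j \<omega> \<in> X}"
  unfolding mass_def option.case prod.case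
proof (rule measure_eq_AE)
  show "AE \<omega> in M. (\<omega> \<in> {\<omega> \<in> space M. T m j \<omega> \<in> X \<inter> {0<..}}) = (\<omega> \<in> {\<omega> \<in> space M. T m j \<omega> \<in> X})"
    using T_pos by eventually_elim (auto simp: xx_def Suc_le_eq)
qed auto

lemma mass_UNIV: "mass m s UNIV = ev m s (\<lambda>_. 1)"
proof (cases s)
  case (Some ja)
  then obtain j a where s: "s = Some (j, a)" by (cases ja) auto
  have "mass m s UNIV = prob {\<omega> \<in> space M. a < T m j \<omega>}"
    unfolding s mass_def option.case prod.case by (rule arg_cong[where f = prob]) auto
  then show ?thesis by (simp add: T_tail s ev_def tail_def)
qed (simp add: mass_def ev_def)

text \<open>Given the observations, the service times of the two packets in service are independent,
  with weights \<open>mass\<close>. In the induction over slots, \<open>mass_adv\<close> treats the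
  completions on each server, and a packet launched at the end of the slot brings a fresh service
  time, independent of the past by \<open>dep_indep\<close>. The sets \<open>X1\<close> and
  \<open>X2\<close> make the statement strong enough for the induction.\<close>

lemma obs_law:
  assumes "cfgo q = (n, s1, s2, l)"
  shows "prob {\<omega> \<in> space M. obs (xx \<omega>) (length q) = q \<and> in_set S1 s1 X1 (xx \<omega>) \<and> in_set S2 s2 X2 (xx \<omega>)}
    = wgt q * mass S1 s1 X1 * mass S2 s2 X2"
  using assms
proof (induction q arbitrary: n s1 s2 l X1 X2)
  case Nil
  have none: "mass m None X = 1" "in_set m None X x" for m X x by (simp_all add: mass_def in_set_def)
  have some: "in_set m (Some (j, a)) X (xx \<omega>) \<longleftrightarrow> T m j \<omega> \<in> X" for m j a X \<omega> by (simp add: in_set_def xx_def)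
  show ?case
    using Nil by (cases S1_first) (auto simp: cfg0_def none some mass_new)
next
  case (Cons c q)
  obtain n0 s1 s2 l0 where z: "cfgo q = (n0, s1, s2, l0)" by (cases "cfgo q")
  obtain c1 c2 where c: "c = (c1, c2)" by (cases c)
  let ?s1 = "adv s1 c1" and ?s2 = "adv s2 c2"
  note IH = Cons.IH[OF z]
  \<comment> \<open>The slot up to, but without, the launch at its end.\<close>
  have step: "prob {\<omega> \<in> space M. obs (xx \<omega>) (Suc (length q)) = c # q \<and> in_set S1 ?s1 X1 (xx \<omega>) \<and> in_set S2 ?s2 X2 (xx \<omega>)}
    = wgt (c # q) * mass S1 ?s1 X1 * mass S2 ?s2 X2" for X1 X2
  proof -
    obtain Y1 where Y1: "\<And>x. don S1 x s1 = c1 \<and> in_set S1 ?s1 X1 x \<longleftrightarrow> in_set S1 s1 Y1 x \<and> (c1 \<longrightarrow> s1 \<noteq> None)"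
      "if c1 \<longrightarrow> s1 \<noteq> None then mass S1 s1 Y1 = fac S1 s1 c1 * mass S1 ?s1 X1 else fac S1 s1 c1 = 0"
      using mass_adv by metis
    obtain Y2 where Y2: "\<And>x. don S2 x s2 = c2 \<and> in_set S2 ?s2 X2 x \<longleftrightarrow> in_set S2 s2 Y2 x \<and> (c2 \<longrightarrow> s2 \<noteq> None)"
      "if c2 \<longrightarrow> s2 \<noteq> None then mass S2 s2 Y2 = fac S2 s2 c2 * mass S2 ?s2 X2 else fac S2 s2 c2 = 0"
      using mass_adv by metis
    have ev: "obs x (Suc (length q)) = c # q \<and> in_set S1 ?s1 X1 x \<and> in_set S2 ?s2 X2 x
      \<longleftrightarrow> (obs x (length q) = q \<and> in_set S1 s1 Y1 x \<and> in_set S2 s2 Y2 x) \<and> (c1 \<longrightarrow> s1 \<noteq> None) \<and> (c2 \<longrightarrow> s2 \<noteq> None)" for x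
      unfolding obs_Suc z c cmp.simps prod.inject using Y1(1)[of x] Y2(1)[of x] by blast
    show ?thesis
    proof (cases "(c1 \<longrightarrow> s1 \<noteq> None) \<and> (c2 \<longrightarrow> s2 \<noteq> None)")
      case True
      then have m: "mass S1 s1 Y1 = fac S1 s1 c1 * mass S1 ?s1 X1" "mass S2 s2 Y2 = fac S2 s2 c2 * mass S2 ?s2 X2"
        using Y1(2) Y2(2) by simp_all
      have "prob {\<omega> \<in> space M. obs (xx \<omega>) (Suc (length q)) = c # q \<and> in_set S1 ?s1 X1 (xx \<omega>) \<and> in_set S2 ?s2 X2 (xx \<omega>)}
        = prob {\<omega> \<in> space M. obs (xx \<omega>) (length q) = q \<and> in_set S1 s1 Y1 (xx \<omega>) \<and> in_set S2 s2 Y2 (xx \<omega>)}"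
        unfolding ev using True by simp
      then show ?thesis unfolding IH m by (simp add: z c mult_ac)
    next
      case False
      then have "facs (cfgo q) c = 0" using Y1(2) Y2(2) by (auto simp: z c split: if_splits)
      moreover have "{\<omega> \<in> space M. obs (xx \<omega>) (Suc (length q)) = c # q \<and> in_set S1 ?s1 X1 (xx \<omega>) \<and> in_set S2 ?s2 X2 (xx \<omega>)} = {}"
        unfolding ev using False by blast
      ultimately show ?thesis by (simp only: wgt.simps measure_empty mult_zero_left mult_zero_right)
    qed
  qed
  have len: "length (c # q) = Suc (length q)" by simp
  have b: "\<And>j a. s1 = Some (j, a) \<or> s2 = Some (j, a) \<Longrightarrow> j < n0"
    using bounded_idx_cfgo[of q] by (auto simp: z)
  have b': "j < n0" if "adv s1 c1 = Some (j, a) \<or> adv s2 c2 = Some (j, a)" for j a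
    using b that by (auto simp: adv_def split: if_splits)
  have dobs: "dep n0 (\<lambda>x. obs x (Suc (length q)) = c # q)" using dep_obs_Suc[of q c] by (simp add: z)
  have some: "in_set m (Some (j, a)) X (xx \<omega>) \<longleftrightarrow> T m j \<omega> \<in> X" for m j a X \<omega> by (simp add: in_set_def xx_def)
  have none: "mass m None X = 1" "in_set m None X x" for m X x by (simp_all add: mass_def in_set_def)
  show ?case
  proof (cases "waits l0 ?s1 ?s2")
    case True
    then show ?thesis using step[of X1 X2] Cons.prems unfolding len by (simp add: z c relaunch_def cfgo.simps del: wgt.simps)
  next
    case W: False
    show ?thesis
    proof (cases "launch1 ?s1 ?s2")
      case True
      then have s1': "?s1 = None" by (simp add: launch1_def)
      have eq: "n = Suc n0" and eqs: "cfgo (c # q) = (Suc n0, Some (n0, 0), ?s2, 0)"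
        using Cons.prems W True by (simp_all add: z c relaunch_def cfgo.simps)
      \<comment> \<open>The new packet has number \<open>n0\<close>; all that is observed so far
        depends on smaller numbers.\<close>
      have d: "dep n0 (\<lambda>x. obs x (Suc (length q)) = c # q \<and> in_set S2 ?s2 X2 x)"
        using b' by (intro dep_conj dobs dep_in_set) blast
      have "prob {\<omega> \<in> space M. obs (xx \<omega>) (Suc (length q)) = c # q \<and> in_set S1 (Some (n0, 0)) X1 (xx \<omega>) \<and> in_set S2 ?s2 X2 (xx \<omega>)}
        = prob {\<omega> \<in> space M. (obs (xx \<omega>) (Suc (length q)) = c # q \<and> in_set S2 ?s2 X2 (xx \<omega>)) \<and> T S1 n0 \<omega> \<in> X1}"
        by (rule arg_cong[where f = prob]) (auto simp: some )
      also have "\<dots> = prob {\<omega> \<in> space M. obs (xx \<omega>) (Suc (length q)) = c # q \<and> in_set S2 ?s2 X2 (xx \<omega>)} * mass S1 (Some (n0, 0)) X1"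
        unfolding mass_new by (rule dep_indep[OF d])
      also have "prob {\<omega> \<in> space M. obs (xx \<omega>) (Suc (length q)) = c # q \<and> in_set S2 ?s2 X2 (xx \<omega>)} = wgt (c # q) * mass S2 ?s2 X2"
        using step[of UNIV X2] unfolding s1' by (simp add: none del: wgt.simps)
      finally show ?thesis
        using Cons.prems unfolding eqs len by (simp add: mult_ac del: wgt.simps)
    next
      case False
      then have s2': "?s2 = None"
        using W by (cases "adv s1 c1"; cases "adv s2 c2"; simp add: launch1_def waits_def)
      have eqs: "cfgo (c # q) = (Suc n0, ?s1, Some (n0, 0), 0)"
        using W False by (simp add: z c relaunch_def cfgo.simps)
      have d: "dep n0 (\<lambda>x. obs x (Suc (length q)) = c # q \<and> in_set S1 ?s1 X1 x)"
        using b' by (intro dep_conj dobs dep_in_set) blast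
      have "prob {\<omega> \<in> space M. obs (xx \<omega>) (Suc (length q)) = c # q \<and> in_set S1 ?s1 X1 (xx \<omega>) \<and> in_set S2 (Some (n0, 0)) X2 (xx \<omega>)}
        = prob {\<omega> \<in> space M. (obs (xx \<omega>) (Suc (length q)) = c # q \<and> in_set S1 ?s1 X1 (xx \<omega>)) \<and> T S2 n0 \<omega> \<in> X2}"
        by (rule arg_cong[where f = prob]) (auto simp: some )
      also have "\<dots> = prob {\<omega> \<in> space M. obs (xx \<omega>) (Suc (length q)) = c # q \<and> in_set S1 ?s1 X1 (xx \<omega>)} * mass S2 (Some (n0, 0)) X2"
        unfolding mass_new by (rule dep_indep[OF d])
      also have "prob {\<omega> \<in> space M. obs (xx \<omega>) (Suc (length q)) = c # q \<and> in_set S1 ?s1 X1 (xx \<omega>)} = wgt (c # q) * mass S1 ?s1 X1"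
        using step[of X1 UNIV] unfolding s2' by (simp add: none del: wgt.simps)
      finally show ?thesis
        using Cons.prems unfolding eqs len by (simp add: mult_ac del: wgt.simps)
    qed
  qed
qed

section \<open>Future events given the past, as powers of A and W\<close>

lemma obs_prob: "prob {\<omega> \<in> space M. obs (xx \<omega>) (length q) = q} = Z q (\<lambda>_ _ _. 1)"
proof -
  obtain n s1 s2 l where z: "cfgo q = (n, s1, s2, l)" by (cases "cfgo q")
  have "in_set m s UNIV x" for m s x by (simp add: in_set_def split: option.splits)
  then have "prob {\<omega> \<in> space M. obs (xx \<omega>) (length q) = q} = wgt q * mass S1 s1 UNIV * mass S2 s2 UNIV"
    using obs_law[OF z, of UNIV UNIV] by simp
  then show ?thesis using ev_mult[of S1 s1 "ev S2 s2 (\<lambda>_. 1)" "\<lambda>_. 1"]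
    by (simp add: Z_def z mass_UNIV mult_ac)
qed

text \<open>Adaptedness to the observed completions; unlike \<open>dep\<close>, it bounds time
  instead of packet numbers.\<close>

definition determined :: "nat \<Rightarrow> ((server \<Rightarrow> nat \<Rightarrow> nat) \<Rightarrow> 'b) \<Rightarrow> bool" where
  "determined t \<phi> \<longleftrightarrow> (\<forall>x y. obs x t = obs y t \<longrightarrow> \<phi> x = \<phi> y)"

lemma obs_prefix:
  assumes "obs x t = obs y t" "s \<le> t"
  shows "obs x s = obs y s"
  using assms by (induction t) (auto simp: le_Suc_eq obs.simps)

lemma determined_mono: "determined s \<phi> \<Longrightarrow> s \<le> t \<Longrightarrow> determined t \<phi>"
  unfolding determined_def using obs_prefix by blast

lemma determined_conj: "determined t \<phi> \<Longrightarrow> determined t \<psi> \<Longrightarrow> determined t (\<lambda>x. \<phi> x \<and> \<psi> x)"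
  unfolding determined_def by metis

lemma determined_step: "determined (Suc t) (\<lambda>x. F (st x t) (cmp x (st x t)))"
  by (auto simp: determined_def st_obs obs.simps)

lemma finite_obs: "finite {q :: (bool \<times> bool) list. length q = t}"
  using finite_lists_length_eq[of "UNIV :: (bool \<times> bool) set" t] by simp

lemma obs_sets [measurable]: "{\<omega> \<in> space M. obs (xx \<omega>) t = q} \<in> events"
proof -
  obtain n where "dep n (\<lambda>x. obs x t = q)" using dep_obs by blast
  then show ?thesis by (rule dep_sets)
qed

lemma determined_sets:
  assumes "determined t \<phi>"
  shows "{\<omega> \<in> space M. \<phi> (xx \<omega>)} \<in> events"
proof -
  define Q where "Q = {q. length q = t \<and> (\<exists>x. obs x t = q \<and> \<phi> x)}"
  have "\<phi> (xx \<omega>) \<longleftrightarrow> obs (xx \<omega>) t \<in> Q" for \<omega>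
  proof
    assume "\<phi> (xx \<omega>)"
    then show "obs (xx \<omega>) t \<in> Q" unfolding Q_def by (intro CollectI conjI exI[of _ "xx \<omega>"]) simp_all
  next
    assume "obs (xx \<omega>) t \<in> Q"
    then obtain x where x: "obs x t = obs (xx \<omega>) t" "\<phi> x" unfolding Q_def by blast
    have "\<phi> x = \<phi> (xx \<omega>)"
      using assms[unfolded determined_def, rule_format, OF x(1)] .
    then show "\<phi> (xx \<omega>)" using x(2) by simp
  qed
  then have "{\<omega> \<in> space M. \<phi> (xx \<omega>)} = (\<Union>q\<in>Q. {\<omega> \<in> space M. obs (xx \<omega>) t = q})"
    by blast
  also have "\<dots> \<in> events"
  proof (rule sets.finite_UN)
    show "finite Q" unfolding Q_def by (rule finite_subset[OF _ finite_obs[of t]]) auto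
  qed (rule obs_sets)
  finally show ?thesis .
qed

lemma prob_split:
  assumes "{\<omega> \<in> space M. D (xx \<omega>)} \<in> events"
  shows "prob {\<omega> \<in> space M. obs (xx \<omega>) t = q \<and> D (xx \<omega>)}
    = (\<Sum>c\<in>UNIV. prob {\<omega> \<in> space M. obs (xx \<omega>) (Suc t) = c # q \<and> D (xx \<omega>)})"
proof -
  have "{\<omega> \<in> space M. obs (xx \<omega>) t = q \<and> D (xx \<omega>)} = (\<Union>c\<in>UNIV. {\<omega> \<in> space M. obs (xx \<omega>) (Suc t) = c # q \<and> D (xx \<omega>)})"
    by (auto simp: obs.simps)
  also have "prob \<dots> = (\<Sum>c\<in>UNIV. prob {\<omega> \<in> space M. obs (xx \<omega>) (Suc t) = c # q \<and> D (xx \<omega>)})"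
  proof (rule finite_measure_finite_Union)
    have "{\<omega> \<in> space M. obs (xx \<omega>) (Suc t) = c # q} \<inter> {\<omega> \<in> space M. D (xx \<omega>)} \<in> events" for c
      using obs_sets assms by (rule sets.Int)
    moreover have "{\<omega> \<in> space M. obs (xx \<omega>) (Suc t) = c # q} \<inter> {\<omega> \<in> space M. D (xx \<omega>)}
      = {\<omega> \<in> space M. obs (xx \<omega>) (Suc t) = c # q \<and> D (xx \<omega>)}" for c by auto
    ultimately show "(\<lambda>c. {\<omega> \<in> space M. obs (xx \<omega>) (Suc t) = c # q \<and> D (xx \<omega>)}) ` UNIV \<subseteq> events" by auto
  qed (auto simp: disjoint_family_on_def)
  finally show ?thesis .
qed

lemma prob_split_if:
  assumes "{\<omega> \<in> space M. D (xx \<omega>)} \<in> events" "{\<omega> \<in> space M. P (st (xx \<omega>) (length q)) (cmp (xx \<omega>) (st (xx \<omega>) (length q))) \<and> D (xx \<omega>)} \<in> events"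
  shows "prob {\<omega> \<in> space M. obs (xx \<omega>) (length q) = q \<and> P (st (xx \<omega>) (length q)) (cmp (xx \<omega>) (st (xx \<omega>) (length q))) \<and> D (xx \<omega>)}
    = (\<Sum>c\<in>UNIV. if P (cfgo q) c then prob {\<omega> \<in> space M. obs (xx \<omega>) (Suc (length q)) = c # q \<and> D (xx \<omega>)} else 0)"
proof -
  have "{\<omega> \<in> space M. obs (xx \<omega>) (Suc (length q)) = c # q \<and> P (st (xx \<omega>) (length q)) (cmp (xx \<omega>) (st (xx \<omega>) (length q))) \<and> D (xx \<omega>)}
     = (if P (cfgo q) c then {\<omega> \<in> space M. obs (xx \<omega>) (Suc (length q)) = c # q \<and> D (xx \<omega>)} else {})" for c
    by (auto simp: obs_Suc st_obs )
  then show ?thesis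
    by (subst prob_split[OF assms(2)]) (auto intro!: sum.cong )
qed

lemma determined_succ_at: "determined (s + r + 1) (\<lambda>x. succ_at x i s r)"
proof (induction r arbitrary: s)
  case 0
  then show ?case using determined_step[of s "\<lambda>z c. kill i z c \<and> \<not> inserv i z"] by simp
next
  case (Suc r)
  have "determined (s + Suc r + 1) (\<lambda>x. \<not> kill i (st x s) (cmp x (st x s)))"
    by (rule determined_mono[OF determined_step[of s "\<lambda>z c. \<not> kill i z c"]]) simp
  then show ?case using determined_conj[OF _ Suc.IH[of "Suc s"]] by simp
qed

lemma determined_alive_at: "determined (s + r) (\<lambda>x. alive_at x i s r)"
proof (induction r arbitrary: s)
  case 0
  then show ?case by (simp add: determined_def)
next
  case (Suc r)
  have "determined (s + Suc r) (\<lambda>x. \<not> kill i (st x s) (cmp x (st x s)))"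
    by (rule determined_mono[OF determined_step[of s "\<lambda>z c. \<not> kill i z c"]]) simp
  then show ?case using determined_conj[OF _ Suc.IH[of "Suc s"]] by simp
qed

abbreviation on_emb :: "nat \<Rightarrow> (bool \<times> bool) list \<Rightarrow> (ystate \<Rightarrow> real) \<Rightarrow> wfun" where
  "on_emb i q f \<equiv> (\<lambda>p1 p2 l. f (emb i (cfgo q) p1 p2 l))"

lemma Z_cong:
  assumes "cfgo q = (n, s1, s2, l)"
    "\<And>p1 p2. matches s1 p1 \<Longrightarrow> matches s2 p2 \<Longrightarrow> (\<And>i. p1 = Some i \<Longrightarrow> i < N S1) \<Longrightarrow> (\<And>j. p2 = Some j \<Longrightarrow> j < N S2)
     \<Longrightarrow> f p1 p2 l = g p1 p2 l"
  shows "Z q f = Z q g"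
  unfolding Z_def assms(1) by (rule arg_cong[OF pair_cong]) (rule assms(2))

text \<open>This is \<open>Aop_emb\<close> integrated over the hidden phases, with
  \<open>Z_Cons\<close> absorbing the kernels into longer histories.\<close>

lemma Z_Aop:
  assumes "valid i (cfgo q)"
  shows "(\<Sum>c\<in>UNIV. if \<not> kill i (cfgo q) c then Z (c # q) (on_emb i (c # q) f) else 0) = Z q (on_emb i q (Aop f))"
proof -
  obtain n s1 s2 l where z: "cfgo q = (n, s1, s2, l)" by (cases "cfgo q")
  have "(\<Sum>c\<in>UNIV. if \<not> kill i (cfgo q) c then Z (c # q) (on_emb i (c # q) f) else 0)
    = Z q (\<lambda>p1 p2 l. \<Sum>c\<in>UNIV. if \<not> kill i (cfgo q) c then Kc c (on_emb i (c # q) f) p1 p2 l else 0)"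
    unfolding Z_sum Z_if Z_Cons by (intro sum.cong refl if_cong)
  also have "\<dots> = Z q (on_emb i q (Aop f))"
    using assms unfolding z by (intro Z_cong[OF z]) (auto simp: z Aop_emb cfgo.simps intro!: sum.cong)
  finally show ?thesis .
qed

lemma Z_csuc:
  assumes "valid i (cfgo q)"
  shows "(\<Sum>c\<in>UNIV. if kill i (cfgo q) c \<and> \<not> inserv i (cfgo q) then Z (c # q) (\<lambda>_ _ _. 1) else 0) = Z q (on_emb i q csuc)"
proof -
  obtain n s1 s2 l where z: "cfgo q = (n, s1, s2, l)" by (cases "cfgo q")
  have "(\<Sum>c\<in>UNIV. if kill i (cfgo q) c \<and> \<not> inserv i (cfgo q) then Z (c # q) (\<lambda>_ _ _. 1) else 0)
    = Z q (\<lambda>p1 p2 l. \<Sum>c\<in>UNIV. if kill i (cfgo q) c \<and> \<not> inserv i (cfgo q) then Kc c (\<lambda>_ _ _. 1) p1 p2 l else 0)"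
    unfolding Z_sum Z_if Z_Cons by (intro sum.cong refl if_cong)
  also have "\<dots> = Z q (on_emb i q csuc)"
    using assms unfolding z by (intro Z_cong[OF z]) (auto simp: z csuc_emb intro!: sum.cong)
  finally show ?thesis .
qed

lemma prob_kill_step:
  assumes v: "valid i (cfgo q)" and D: "{\<omega> \<in> space M. D (xx \<omega>)} \<in> events"
    and sets: "{\<omega> \<in> space M. \<not> kill i (st (xx \<omega>) (length q)) (cmp (xx \<omega>) (st (xx \<omega>) (length q))) \<and> D (xx \<omega>)} \<in> events"
    and IH: "\<And>c. valid i (cfgo (c # q)) \<Longrightarrow>
      prob {\<omega> \<in> space M. obs (xx \<omega>) (length (c # q)) = c # q \<and> D (xx \<omega>)} = Z (c # q) (on_emb i (c # q) f)"
  shows "prob {\<omega> \<in> space M. obs (xx \<omega>) (length q) = q \<and> \<not> kill i (st (xx \<omega>) (length q)) (cmp (xx \<omega>) (st (xx \<omega>) (length q))) \<and> D (xx \<omega>)}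
    = Z q (on_emb i q (Aop f))"
proof -
  have "valid i (cfgo (c # q))" for c using valid_nxt[OF v bounded_idx_cfgo] by (simp add: cfgo.simps)
  then have "prob {\<omega> \<in> space M. obs (xx \<omega>) (Suc (length q)) = c # q \<and> D (xx \<omega>)} = Z (c # q) (on_emb i (c # q) f)" for c
    using IH by simp
  then show ?thesis
    using prob_split_if[where P = "\<lambda>z c. \<not> kill i z c", OF D sets] Z_Aop[OF v] by (simp cong: if_cong)
qed

text \<open>The Markov property of Y, obtained without constructing Y: each slot without a kill
  contributes A by \<open>prob_kill_step\<close>, the last one c by \<open>Z_csuc\<close>.\<close>

lemma prob_succ_at:
  assumes "valid i (cfgo q)"
  shows "prob {\<omega> \<in> space M. obs (xx \<omega>) (length q) = q \<and> succ_at (xx \<omega>) i (length q) r} = Z q (on_emb i q ((Aop ^^ r) csuc))"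
  using assms
proof (induction r arbitrary: q)
  case 0
  have "prob {\<omega> \<in> space M. obs (xx \<omega>) (length q) = q \<and> succ_at (xx \<omega>) i (length q) 0}
     = (\<Sum>c\<in>UNIV. if kill i (cfgo q) c \<and> \<not> inserv i (cfgo q) then prob {\<omega> \<in> space M. obs (xx \<omega>) (Suc (length q)) = c # q \<and> True} else 0)"
    using prob_split_if[where P = "\<lambda>z c. kill i z c \<and> \<not> inserv i z" and D = "\<lambda>_. True" and q = q]
      determined_sets[OF determined_step[of "length q" "\<lambda>z c. kill i z c \<and> \<not> inserv i z"]] by simp
  also have "\<dots> = Z q (on_emb i q csuc)"
    using obs_prob[of "_ # q"] Z_csuc[OF 0] by (simp cong: if_cong)
  finally show ?case by simp
next
  case (Suc r)
  have "{\<omega> \<in> space M. succ_at (xx \<omega>) i (Suc (length q)) r} \<in> events"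
    by (rule determined_sets[OF determined_succ_at])
  moreover have "{\<omega> \<in> space M. succ_at (xx \<omega>) i (length q) (Suc r)} \<in> events"
    by (rule determined_sets[OF determined_succ_at])
  ultimately show ?case
    using prob_kill_step[OF Suc.prems, where D = "\<lambda>x. succ_at x i (Suc (length q)) r" and f = "(Aop ^^ r) csuc"] Suc.IH[of "_ # q"] by simp
qed

lemma prob_alive_at:
  assumes "valid i (cfgo q)"
  shows "prob {\<omega> \<in> space M. obs (xx \<omega>) (length q) = q \<and> alive_at (xx \<omega>) i (length q) r} = Z q (on_emb i q ((Aop ^^ r) (\<lambda>_. 1)))"
  using assms
proof (induction r arbitrary: q)
  case 0
  then show ?case using obs_prob[of q] by simp
next
  case (Suc r)
  have "{\<omega> \<in> space M. alive_at (xx \<omega>) i (Suc (length q)) r} \<in> events"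
    by (rule determined_sets[OF determined_alive_at])
  moreover have "{\<omega> \<in> space M. alive_at (xx \<omega>) i (length q) (Suc r)} \<in> events"
    by (rule determined_sets[OF determined_alive_at])
  ultimately show ?case
    using prob_kill_step[OF Suc.prems, where D = "\<lambda>x. alive_at x i (Suc (length q)) r" and f = "(Aop ^^ r) (\<lambda>_. 1)"] Suc.IH[of "_ # q"] by simp
qed

text \<open>The first component of the configuration before the launch is the number of the packet
  launched.\<close>

definition launched :: "nat \<Rightarrow> (nat \<Rightarrow> (server \<Rightarrow> nat \<Rightarrow> nat) \<Rightarrow> bool) \<Rightarrow> (server \<Rightarrow> nat \<Rightarrow> nat) \<Rightarrow> bool" where
  "launched s \<phi> x \<longleftrightarrow> launches (st x s) (cmp x (st x s)) \<and> \<phi> (fst (st x s)) x"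

lemma determined_launched:
  assumes "\<And>i. determined t (\<phi> i)" "s < t"
  shows "determined t (launched s \<phi>)"
  unfolding determined_def launched_def
proof (intro allI impI)
  fix x y assume eq: "obs x t = obs y t"
  have "obs x s = obs y s" "obs x (Suc s) = obs y (Suc s)" using obs_prefix[OF eq] assms(2) by auto
  then have "st x s = st y s" "cmp x (st x s) = cmp y (st y s)" by (auto simp: st_obs obs.simps)
  moreover have "\<phi> i x = \<phi> i y" for i using assms(1)[unfolded determined_def, rule_format, OF eq] .
  ultimately show "(launches (st x s) (cmp x (st x s)) \<and> \<phi> (fst (st x s)) x) = (launches (st y s) (cmp y (st y s)) \<and> \<phi> (fst (st y s)) y)"
    by simp
qed

lemma prob_launched_now:
  assumes \<phi>: "\<And>i. determined t (\<phi> i)" "length q < t"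
    and f: "\<And>i c. valid i (cfgo (c # q)) \<Longrightarrow>
      prob {\<omega> \<in> space M. obs (xx \<omega>) (length (c # q)) = c # q \<and> \<phi> i (xx \<omega>)} = Z (c # q) (on_emb i (c # q) f)"
  shows "prob {\<omega> \<in> space M. obs (xx \<omega>) (length q) = q \<and> launched (length q) \<phi> (xx \<omega>)} = Z q (gam f)"
proof -
  obtain n s1 s2 l where z: "cfgo q = (n, s1, s2, l)" by (cases "cfgo q")
  have D: "{\<omega> \<in> space M. \<phi> n (xx \<omega>)} \<in> events" by (rule determined_sets[OF \<phi>(1)])
  have d: "determined t (\<lambda>x. launches (st x (length q)) (cmp x (st x (length q))))"
    by (rule determined_mono[OF determined_step]) (use \<phi>(2) in simp)
  have D': "{\<omega> \<in> space M. launches (st (xx \<omega>) (length q)) (cmp (xx \<omega>) (st (xx \<omega>) (length q))) \<and> \<phi> n (xx \<omega>)} \<in> events"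
    by (rule determined_sets[OF determined_conj[OF d \<phi>(1)]])
  have v: "valid n (cfgo (c # q))" if "launches (cfgo q) c" for c
    using valid_launch[OF that bounded_idx_cfgo] by (simp add: z cfgo.simps)
  have "{\<omega> \<in> space M. obs (xx \<omega>) (length q) = q \<and> launched (length q) \<phi> (xx \<omega>)} =
     {\<omega> \<in> space M. obs (xx \<omega>) (length q) = q \<and> launches (st (xx \<omega>) (length q)) (cmp (xx \<omega>) (st (xx \<omega>) (length q))) \<and> \<phi> n (xx \<omega>)}"
    by (auto simp: launched_def st_obs z)
  then have "prob {\<omega> \<in> space M. obs (xx \<omega>) (length q) = q \<and> launched (length q) \<phi> (xx \<omega>)}
    = (\<Sum>c\<in>UNIV. if launches (cfgo q) c then prob {\<omega> \<in> space M. obs (xx \<omega>) (Suc (length q)) = c # q \<and> \<phi> n (xx \<omega>)} else 0)"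
    using prob_split_if[where P = launches, OF D D'] by simp
  also have "\<dots> = (\<Sum>c\<in>UNIV. if launches (cfgo q) c then Z (c # q) (on_emb n (c # q) f) else 0)"
    using f[OF v] by (intro sum.cong refl if_cong) (simp_all)
  also have "\<dots> = Z q (\<lambda>p1 p2 l. \<Sum>c\<in>UNIV. if launches (cfgo q) c then Kc c (on_emb n (c # q) f) p1 p2 l else 0)"
    unfolding Z_sum Z_if Z_Cons by (intro sum.cong refl if_cong)
  also have "\<dots> = Z q (gam f)"
    using bounded_idx_cfgo[of q] unfolding z by (intro Z_cong[OF z]) (auto simp: z gam_emb cfgo.simps intro!: sum.cong)
  finally show ?thesis .
qed

text \<open>The slots before \<open>s\<close> contribute powers of W, since no packet is tagged yet.
  The slot of the launch contributes \<open>gam\<close>, and from then on the new packet is tagged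
  and \<open>f\<close> describes its future.\<close>

lemma prob_launched:
  assumes \<phi>: "\<And>i. determined t (\<phi> i)" "s < t"
    and f: "\<And>i q. valid i (cfgo q) \<Longrightarrow> length q = Suc s \<Longrightarrow>
      prob {\<omega> \<in> space M. obs (xx \<omega>) (length q) = q \<and> \<phi> i (xx \<omega>)} = Z q (on_emb i q f)"
    and "length q \<le> s"
  shows "prob {\<omega> \<in> space M. obs (xx \<omega>) (length q) = q \<and> launched s \<phi> (xx \<omega>)} = Z q ((Rop ^^ (s - length q)) (gam f))"
  using assms(4)
proof (induction "s - length q" arbitrary: q)
  case 0
  then have s: "s = length q" by simp
  show ?case using prob_launched_now[of t \<phi> q f] \<phi> f unfolding s by simp
next
  case (Suc d)
  have sets: "{\<omega> \<in> space M. launched s \<phi> (xx \<omega>)} \<in> events"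
    by (rule determined_sets[OF determined_launched[OF \<phi>]])
  have d: "d = s - length (c # q)" "length (c # q) \<le> s" for c :: "bool \<times> bool" using Suc by auto
  have IH: "prob {\<omega> \<in> space M. obs (xx \<omega>) (Suc (length q)) = c # q \<and> launched s \<phi> (xx \<omega>)} = Z (c # q) ((Rop ^^ d) (gam f))" for c
    using Suc.hyps(1)[OF d(1) d(2), of c] unfolding d(1)[of c, symmetric] by simp
  have "prob {\<omega> \<in> space M. obs (xx \<omega>) (length q) = q \<and> launched s \<phi> (xx \<omega>)}
     = (\<Sum>c\<in>UNIV. Z (c # q) ((Rop ^^ d) (gam f)))"
    by (subst prob_split[OF sets]) (simp only: IH)
  also have "\<dots> = Z q (\<lambda>p1 p2 l. \<Sum>c\<in>UNIV. Kc c ((Rop ^^ d) (gam f)) p1 p2 l)"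
    unfolding Z_sum Z_Cons ..
  also have "\<dots> = Z q (Rop ((Rop ^^ d) (gam f)))"
    by (simp add: Rop_def[abs_def])
  finally show ?case unfolding Suc.hyps(2)[symmetric] by simp
qed

lemma prob_launched_succ:
  assumes "length q \<le> s"
  shows "prob {\<omega> \<in> space M. obs (xx \<omega>) (length q) = q \<and> launched s (\<lambda>i x. succ_at x i (Suc s) h) (xx \<omega>)}
    = Z q ((Rop ^^ (s - length q)) (gam ((Aop ^^ h) csuc)))"
proof (rule prob_launched[OF _ _ _ assms])
  show "determined (Suc s + h + 1) (\<lambda>x. succ_at x i (Suc s) h)" for i by (rule determined_succ_at)
next
  fix i and q :: "(bool \<times> bool) list"
  assume "valid i (cfgo q)" "length q = Suc s"
  then show "prob {\<omega> \<in> space M. obs (xx \<omega>) (length q) = q \<and> succ_at (xx \<omega>) i (Suc s) h}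
      = Z q (on_emb i q ((Aop ^^ h) csuc))"
    using prob_succ_at[of i q h] by simp
qed simp

lemma prob_launched_alive:
  assumes "length q \<le> s"
  shows "prob {\<omega> \<in> space M. obs (xx \<omega>) (length q) = q \<and> launched s (\<lambda>i x. alive_at x i (Suc s) h) (xx \<omega>)}
    = Z q ((Rop ^^ (s - length q)) (gam ((Aop ^^ h) (\<lambda>_. 1))))"
proof (rule prob_launched[OF _ _ _ assms])
  show "determined (Suc s + h) (\<lambda>x. alive_at x i (Suc s) h)" for i by (rule determined_alive_at)
next
  fix i and q :: "(bool \<times> bool) list"
  assume "valid i (cfgo q)" "length q = Suc s"
  then show "prob {\<omega> \<in> space M. obs (xx \<omega>) (length q) = q \<and> alive_at (xx \<omega>) i (Suc s) h}
      = Z q (on_emb i q ((Aop ^^ h) (\<lambda>_. 1)))"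
    using prob_alive_at[of i q h] by simp
qed simp

end

section \<open>A weak law of large numbers\<close>

lemma cesaro_mean:
  fixes a :: "nat \<Rightarrow> real"
  assumes "a \<longlonglongrightarrow> L"
  shows "(\<lambda>n. (\<Sum>j<n. a j) / real n) \<longlonglongrightarrow> L"
proof (rule LIMSEQ_I)
  fix e :: real assume e: "0 < e"
  obtain n0 where n0: "\<And>n. n \<ge> n0 \<Longrightarrow> \<bar>a n - L\<bar> < e / 2"
    using LIMSEQ_D[OF assms, of "e / 2"] e by auto
  define C where "C = (\<Sum>j<n0. \<bar>a j - L\<bar>)"
  obtain n1 :: nat where n1: "2 * C / e < real n1" using reals_Archimedean2 by blast
  have "\<bar>(\<Sum>j<n. a j) / real n - L\<bar> < e" if n: "n \<ge> max (Suc n1) n0" for n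
  proof -
    have pos: "0 < real n" using n by simp
    have "(\<Sum>j<n. a j) / real n - L = (\<Sum>j<n. a j - L) / real n"
      using pos by (simp add: sum_subtractf field_simps)
    also have "\<bar>\<dots>\<bar> \<le> (\<Sum>j<n. \<bar>a j - L\<bar>) / real n"
      unfolding abs_divide using pos by (simp add: divide_right_mono sum_abs)
    also have "(\<Sum>j<n. \<bar>a j - L\<bar>) = C + (\<Sum>j\<in>{n0..<n}. \<bar>a j - L\<bar>)"
    proof -
      have S: "{..<n} = {..<n0} \<union> {n0..<n}" using n by auto
      show ?thesis unfolding C_def S by (rule sum.union_disjoint) auto
    qed
    also have "(\<Sum>j\<in>{n0..<n}. \<bar>a j - L\<bar>) \<le> (\<Sum>j\<in>{n0..<n}. e / 2)"
      using n0 by (intro sum_mono less_imp_le) auto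
    also have "(\<Sum>j\<in>{n0..<n}. e / 2) \<le> real n * (e / 2)"
      using e by (simp add: mult_right_mono)
    finally have "\<bar>(\<Sum>j<n. a j) / real n - L\<bar> \<le> (C + real n * (e / 2)) / real n"
      using pos by (simp add: divide_right_mono)
    also have "\<dots> = C / real n + e / 2" using pos by (simp add: add_divide_distrib)
    also have "C / real n < e / 2"
    proof -
      have "2 * C / e < real n" using n1 n by linarith
      then show ?thesis using e pos by (simp add: field_simps)
    qed
    finally show ?thesis by simp
  qed
  then show "\<exists>no. \<forall>n\<ge>no. norm ((\<Sum>j<n. a j) / real n - L) < e" unfolding real_norm_def by blast
qed

text \<open>Each product of two terms is assigned to its smaller index, so that expectations can be
  taken given what is known about that index.\<close>

lemma square_of_sum:
  fixes x :: "nat \<Rightarrow> real"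
  shows "(\<Sum>s<n. x s)\<^sup>2 = (\<Sum>s<n. x s * (2 * (\<Sum>r\<in>{s..<n}. x r) - x s))"
proof (induction n)
  case (Suc n)
  have "(\<Sum>s<n. x s * (2 * (\<Sum>r\<in>{s..<Suc n}. x r) - x s)) = (\<Sum>s<n. x s * (2 * (\<Sum>r\<in>{s..<n}. x r) - x s) + 2 * x n * x s)"
    by (intro sum.cong) (auto simp: algebra_simps)
  also have "\<dots> = (\<Sum>s<n. x s)\<^sup>2 + 2 * x n * (\<Sum>s<n. x s)"
    by (simp add: sum.distrib sum_distrib_left Suc)
  finally show ?case by (simp add: power2_eq_square algebra_simps)
qed simp

text \<open>Weak law of large numbers for a bounded sequence which, given the (finite-valued) information
  \<open>O (s + d)\<close> that determines \<open>X s\<close>, averages out in expectation.\<close>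

lemma (in prob_space) weak_law_cesaro:
  fixes X :: "nat \<Rightarrow> 'a \<Rightarrow> real" and Ob :: "nat \<Rightarrow> 'a \<Rightarrow> 'b"
  assumes meas: "\<And>s. random_variable borel (X s)"
    and bound: "\<And>s \<omega>. \<bar>X s \<omega>\<bar> \<le> 1"
    and fin: "\<And>t. finite (Q t)" "\<And>t \<omega>. Ob t \<omega> \<in> Q t"
    and sets: "\<And>t q. {\<omega> \<in> space M. Ob t \<omega> = q} \<in> events"
    and det: "\<And>s \<omega> \<omega>'. Ob (s + d) \<omega> = Ob (s + d) \<omega>' \<Longrightarrow> X s \<omega> = X s \<omega>'"
    and mix: "\<And>t q n. q \<in> Q t \<Longrightarrow>
      \<bar>\<Sum>r<n. expectation (\<lambda>\<omega>. indicat_real {\<omega> \<in> space M. Ob t \<omega> = q} \<omega> * X (t + r) \<omega>)\<bar>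
        \<le> real n * e n * prob {\<omega> \<in> space M. Ob t \<omega> = q}"
    and e: "e \<longlonglongrightarrow> 0" "\<And>n. 0 \<le> e n"
    and \<delta>: "0 < \<delta>"
  shows "\<forall>\<^sub>F n in sequentially. expectation (\<lambda>\<omega>. \<bar>\<Sum>s<n. X s \<omega>\<bar>) \<le> \<delta> * real n"
proof -
  let ?I = "\<lambda>t q. indicat_real {\<omega> \<in> space M. Ob t \<omega> = q}"
  have int: "integrable M f" if "random_variable borel f" "\<And>\<omega>. \<bar>f \<omega>\<bar> \<le> c" for f :: "'a \<Rightarrow> real" and c
    using that by (intro integrable_const_bound[of _ c]) auto
  have sum_bound: "\<bar>\<Sum>s\<in>A. X s \<omega>\<bar> \<le> real (card A)" for A \<omega>
  proof -
    have "\<bar>\<Sum>s\<in>A. X s \<omega>\<bar> \<le> (\<Sum>s\<in>A. 1)" by (rule order_trans[OF sum_abs sum_mono]) (rule bound)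
    then show ?thesis by simp
  qed
  have [measurable]: "X s \<in> borel_measurable M" for s by (rule meas)
  have [measurable]: "{\<omega> \<in> space M. Ob t \<omega> = q} \<in> events" for t q by (rule sets)
  \<comment> \<open>Condition on \<open>Ob (s + d)\<close>: it fixes \<open>X s\<close>, and given
    it the later terms average out by \<open>mix\<close>.\<close>
  have later: "expectation (\<lambda>\<omega>. X s \<omega> * (\<Sum>r<n. X (s + d + r) \<omega>)) \<le> real n * e n" for s n
  proof -
    let ?t = "s + d" and ?Y = "\<lambda>\<omega>. \<Sum>r<n. X (s + d + r) \<omega>"
    have Y: "\<bar>?Y \<omega>\<bar> \<le> real n" for \<omega>
    proof -
      have "\<bar>?Y \<omega>\<bar> \<le> (\<Sum>r<n. 1)" by (rule order_trans[OF sum_abs sum_mono]) (rule bound)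
      then show ?thesis by simp
    qed
    have intq: "integrable M (\<lambda>\<omega>. ?I ?t q \<omega> * (X s \<omega> * ?Y \<omega>))" for q
    proof (rule int[of _ "real n"])
      fix \<omega>
      have "\<bar>?I ?t q \<omega> * (X s \<omega> * ?Y \<omega>)\<bar> \<le> 1 * (1 * real n)"
        unfolding abs_mult using bound[of s \<omega>] Y[of \<omega>] by (intro mult_mono) (auto simp: indicator_def)
      then show "\<bar>?I ?t q \<omega> * (X s \<omega> * ?Y \<omega>)\<bar> \<le> real n" by simp
    qed measurable
    have "expectation (\<lambda>\<omega>. X s \<omega> * ?Y \<omega>) = expectation (\<lambda>\<omega>. \<Sum>q\<in>Q ?t. ?I ?t q \<omega> * (X s \<omega> * ?Y \<omega>))"
    proof (rule Bochner_Integration.integral_cong[OF refl])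
      fix \<omega> assume w: "\<omega> \<in> space M"
      have "(\<Sum>q\<in>Q ?t. ?I ?t q \<omega> * (X s \<omega> * ?Y \<omega>)) = (\<Sum>q\<in>Q ?t. if q = Ob ?t \<omega> then X s \<omega> * ?Y \<omega> else 0)"
        using w by (intro sum.cong) (auto simp: indicator_def)
      then show "X s \<omega> * ?Y \<omega> = (\<Sum>q\<in>Q ?t. ?I ?t q \<omega> * (X s \<omega> * ?Y \<omega>))"
        using fin by simp
    qed
    also have "\<dots> = (\<Sum>q\<in>Q ?t. expectation (\<lambda>\<omega>. ?I ?t q \<omega> * (X s \<omega> * ?Y \<omega>)))"
      by (rule Bochner_Integration.integral_sum) (rule intq)
    also have "\<dots> \<le> (\<Sum>q\<in>Q ?t. real n * e n * prob {\<omega> \<in> space M. Ob ?t \<omega> = q})"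
    proof (rule sum_mono)
      fix q assume q: "q \<in> Q ?t"
      show "expectation (\<lambda>\<omega>. ?I ?t q \<omega> * (X s \<omega> * ?Y \<omega>)) \<le> real n * e n * prob {\<omega> \<in> space M. Ob ?t \<omega> = q}"
      proof (cases "\<exists>\<omega>\<in>space M. Ob ?t \<omega> = q")
        case True
        then obtain \<omega>0 where w0: "Ob ?t \<omega>0 = q" by blast
        have "?I ?t q \<omega> * (X s \<omega> * ?Y \<omega>) = X s \<omega>0 * (\<Sum>r<n. ?I ?t q \<omega> * X (?t + r) \<omega>)" for \<omega>
        proof (cases "Ob ?t \<omega> = q")
          case True
          then have "X s \<omega> = X s \<omega>0" using det[of s \<omega> \<omega>0] w0 by simp
          then show ?thesis unfolding sum_distrib_left by (intro sum.cong refl) (simp only: mult.left_commute)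
        qed (simp add: indicator_def)
        then have "expectation (\<lambda>\<omega>. ?I ?t q \<omega> * (X s \<omega> * ?Y \<omega>))
            = X s \<omega>0 * expectation (\<lambda>\<omega>. \<Sum>r<n. ?I ?t q \<omega> * X (?t + r) \<omega>)" by simp
        also have "expectation (\<lambda>\<omega>. \<Sum>r<n. ?I ?t q \<omega> * X (?t + r) \<omega>)
            = (\<Sum>r<n. expectation (\<lambda>\<omega>. ?I ?t q \<omega> * X (?t + r) \<omega>))"
        proof (rule Bochner_Integration.integral_sum, rule int[of _ 1])
          fix r \<omega>
          have "\<bar>?I ?t q \<omega> * X (?t + r) \<omega>\<bar> \<le> 1 * 1"
            unfolding abs_mult using bound by (intro mult_mono) (auto simp: indicator_def)
          then show "\<bar>?I ?t q \<omega> * X (?t + r) \<omega>\<bar> \<le> 1" by simp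
        qed measurable
        also have "X s \<omega>0 * (\<Sum>r<n. expectation (\<lambda>\<omega>. ?I ?t q \<omega> * X (?t + r) \<omega>))
            \<le> \<bar>X s \<omega>0\<bar> * \<bar>\<Sum>r<n. expectation (\<lambda>\<omega>. ?I ?t q \<omega> * X (?t + r) \<omega>)\<bar>"
          unfolding abs_mult[symmetric] by (rule abs_ge_self)
        also have "\<dots> \<le> 1 * (real n * e n * prob {\<omega> \<in> space M. Ob ?t \<omega> = q})"
          using bound mix[OF q] by (intro mult_mono) auto
        finally show ?thesis by simp
      next
        case False
        then have "expectation (\<lambda>\<omega>. ?I ?t q \<omega> * (X s \<omega> * ?Y \<omega>)) = expectation (\<lambda>\<omega>. 0)"
          by (intro Bochner_Integration.integral_cong refl) (auto simp: indicator_def)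
        then show ?thesis using e(2) by simp
      qed
    qed
    also have "\<dots> = real n * e n * (\<Sum>q\<in>Q ?t. prob {\<omega> \<in> space M. Ob ?t \<omega> = q})"
      by (simp add: sum_distrib_left)
    also have "(\<Sum>q\<in>Q ?t. prob {\<omega> \<in> space M. Ob ?t \<omega> = q}) = prob (\<Union>q\<in>Q ?t. {\<omega> \<in> space M. Ob ?t \<omega> = q})"
      using fin sets by (intro finite_measure_finite_Union[symmetric]) (auto simp: disjoint_family_on_def)
    also have "(\<Union>q\<in>Q ?t. {\<omega> \<in> space M. Ob ?t \<omega> = q}) = space M" using fin by auto
    finally show ?thesis by (simp add: prob_space)
  qed
  \<comment> \<open>With this value the second moment contributes \<delta> n / 4 in
    \<open>main\<close>, next to c / 2 = \<delta> n / 2; the remaining quarter absorbs the constant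
    \<open>K\<close> for large n.\<close>
  define \<epsilon> where "\<epsilon> = \<delta>\<^sup>2 / 4"
  have \<epsilon>: "0 < \<epsilon>" using \<delta> by (simp add: \<epsilon>_def)
  obtain m0 where m0: "\<And>m. m \<ge> m0 \<Longrightarrow> e m < \<epsilon>"
    using LIMSEQ_D[OF e(1) \<epsilon>] e(2) by auto
  \<comment> \<open>Below \<open>m0\<close> the error \<open>e m\<close> need not be small; the sum
    over these finitely many indices is a constant.\<close>
  define C where "C = (\<Sum>m<m0. real m * e m)"
  have C0: "0 \<le> C" unfolding C_def using e(2) by (intro sum_nonneg) auto
  have me: "real m * e m \<le> C + \<epsilon> * real n" if "m \<le> n" for m n
  proof (cases "m < m0")
    case True
    have "real m * e m \<le> C" unfolding C_def
      using True e(2) by (intro member_le_sum[of m _ "\<lambda>m. real m * e m"]) auto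
    then show ?thesis using \<epsilon> by (smt (verit) mult_nonneg_nonneg of_nat_0_le_iff)
  next
    case False
    then have "real m * e m \<le> real n * \<epsilon>" using m0[of m] that e(2) by (intro mult_mono) auto
    then show ?thesis using C0 by (simp add: mult.commute)
  qed
  \<comment> \<open>The part 2 d bounds the products of terms less than d apart, about which
    \<open>mix\<close> says nothing.\<close>
  define K where "K = 2 * real d + 2 * C"
  have sq: "expectation (\<lambda>\<omega>. (\<Sum>s<n. X s \<omega>)\<^sup>2) \<le> real n * (K + 2 * \<epsilon> * real n)" for n
  proof -
    have term_le: "expectation (\<lambda>\<omega>. X s \<omega> * (2 * (\<Sum>r\<in>{s..<n}. X r \<omega>) - X s \<omega>)) \<le> K + 2 * \<epsilon> * real n"
      and term_int: "integrable M (\<lambda>\<omega>. X s \<omega> * (2 * (\<Sum>r\<in>{s..<n}. X r \<omega>) - X s \<omega>))" if "s < n" for s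
    proof -
      define m where "m = n - (s + d)"
      have split: "(\<Sum>r\<in>{s..<n}. X r \<omega>) = (\<Sum>r\<in>{s..<min (s + d) n}. X r \<omega>) + (\<Sum>r<m. X (s + d + r) \<omega>)" for \<omega>
      proof -
        have S: "{s..<n} = {s..<min (s + d) n} \<union> {s + d..<n}" using that by auto
        have "(\<Sum>r\<in>{s..<n}. X r \<omega>) = (\<Sum>r\<in>{s..<min (s + d) n}. X r \<omega>) + (\<Sum>r\<in>{s + d..<n}. X r \<omega>)"
          unfolding S by (rule sum.union_disjoint) auto
        also have "(\<Sum>r\<in>{s + d..<n}. X r \<omega>) = (\<Sum>r<m. X (s + d + r) \<omega>)"
          by (rule sum.reindex_bij_witness[of _ "\<lambda>r. s + d + r" "\<lambda>r. r - (s + d)"]) (auto simp: m_def)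
        finally show ?thesis .
      qed
      let ?Z = "\<lambda>\<omega>. X s \<omega> * (\<Sum>r<m. X (s + d + r) \<omega>)"
      have Zint: "integrable M ?Z"
      proof (rule int[of _ "real m"])
        fix \<omega>
        have "\<bar>\<Sum>r<m. X (s + d + r) \<omega>\<bar> \<le> (\<Sum>r<m. 1)" by (rule order_trans[OF sum_abs sum_mono]) (rule bound)
        then have "\<bar>?Z \<omega>\<bar> \<le> 1 * real m" unfolding abs_mult using bound by (intro mult_mono) auto
        then show "\<bar>?Z \<omega>\<bar> \<le> real m" by simp
      qed measurable
      show int': "integrable M (\<lambda>\<omega>. X s \<omega> * (2 * (\<Sum>r\<in>{s..<n}. X r \<omega>) - X s \<omega>))"
      proof (rule int[of _ "2 * real n + 1"])
        fix \<omega>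
        have "\<bar>2 * (\<Sum>r\<in>{s..<n}. X r \<omega>) - X s \<omega>\<bar> \<le> 2 * real n + 1"
          using sum_bound[of \<omega> "{s..<n}"] bound[of s \<omega>] by simp
        then have "\<bar>X s \<omega> * (2 * (\<Sum>r\<in>{s..<n}. X r \<omega>) - X s \<omega>)\<bar> \<le> 1 * (2 * real n + 1)"
          unfolding abs_mult using bound by (intro mult_mono) auto
        then show "\<bar>X s \<omega> * (2 * (\<Sum>r\<in>{s..<n}. X r \<omega>) - X s \<omega>)\<bar> \<le> 2 * real n + 1" by simp
      qed measurable
      have "expectation (\<lambda>\<omega>. X s \<omega> * (2 * (\<Sum>r\<in>{s..<n}. X r \<omega>) - X s \<omega>)) \<le> expectation (\<lambda>\<omega>. 2 * real d + 2 * ?Z \<omega>)"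
      proof (rule integral_mono[OF int'])
        show "integrable M (\<lambda>\<omega>. 2 * real d + 2 * ?Z \<omega>)" using Zint by simp
        fix \<omega>
        let ?S = "\<Sum>r\<in>{s..<min (s + d) n}. X r \<omega>"
        have "\<bar>?S\<bar> \<le> real (card {s..<min (s + d) n})" by (rule sum_bound)
        then have S: "\<bar>?S\<bar> \<le> real d" by simp
        have "X s \<omega> * ?S \<le> \<bar>X s \<omega>\<bar> * \<bar>?S\<bar>" unfolding abs_mult[symmetric] by (rule abs_ge_self)
        also have "\<dots> \<le> 1 * real d" using S bound by (intro mult_mono) auto
        finally have "X s \<omega> * ?S \<le> real d" by simp
        moreover have "0 \<le> X s \<omega> * X s \<omega>" by simp
        moreover have eq: "X s \<omega> * (2 * (\<Sum>r\<in>{s..<n}. X r \<omega>) - X s \<omega>) = 2 * (X s \<omega> * ?S) + 2 * ?Z \<omega> - X s \<omega> * X s \<omega>"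
          unfolding split by (simp add: algebra_simps)
        ultimately show "X s \<omega> * (2 * (\<Sum>r\<in>{s..<n}. X r \<omega>) - X s \<omega>) \<le> 2 * real d + 2 * ?Z \<omega>"
          unfolding eq by linarith
      qed
      also have "\<dots> = 2 * real d + 2 * expectation ?Z" using Zint by (simp add: prob_space)
      also have "\<dots> \<le> 2 * real d + 2 * (C + \<epsilon> * real n)"
        using later[of s m] me[of m n] by (simp add: m_def)
      finally show "expectation (\<lambda>\<omega>. X s \<omega> * (2 * (\<Sum>r\<in>{s..<n}. X r \<omega>) - X s \<omega>)) \<le> K + 2 * \<epsilon> * real n"
        by (simp add: K_def algebra_simps)
    qed
    have "expectation (\<lambda>\<omega>. (\<Sum>s<n. X s \<omega>)\<^sup>2) = (\<Sum>s<n. expectation (\<lambda>\<omega>. X s \<omega> * (2 * (\<Sum>r\<in>{s..<n}. X r \<omega>) - X s \<omega>)))"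
      unfolding square_of_sum using term_int by (intro Bochner_Integration.integral_sum) auto
    also have "\<dots> \<le> (\<Sum>s<n. K + 2 * \<epsilon> * real n)" using term_le by (intro sum_mono) auto
    finally show ?thesis by simp
  qed
  have main: "expectation (\<lambda>\<omega>. \<bar>\<Sum>s<n. X s \<omega>\<bar>) \<le> K / (2 * \<delta>) + 3 / 4 * \<delta> * real n" if n: "0 < n" for n
  proof -
    let ?S = "\<lambda>\<omega>. \<Sum>s<n. X s \<omega>"
    define c where "c = \<delta> * real n"
    have c: "0 < c" using \<delta> n by (simp add: c_def)
    \<comment> \<open>Arithmetic-geometric mean inequality at scale \<open>c\<close>, to pass from
      the second moment to the first.\<close>
    have am: "\<bar>?S \<omega>\<bar> \<le> (?S \<omega>)\<^sup>2 / (2 * c) + c / 2" for \<omega>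
    proof -
      have "0 \<le> (\<bar>?S \<omega>\<bar> - c)\<^sup>2" by simp
      then have "2 * c * \<bar>?S \<omega>\<bar> \<le> (?S \<omega>)\<^sup>2 + c\<^sup>2" by (simp add: power2_diff mult_ac)
      then show ?thesis using c by (simp add: field_simps power2_eq_square)
    qed
    have Sb: "\<bar>?S \<omega>\<bar> \<le> real n" for \<omega> using sum_bound[of \<omega> "{..<n}"] by simp
    have i1: "integrable M (\<lambda>\<omega>. \<bar>?S \<omega>\<bar>)"
      by (rule int[of _ "real n"]) (use Sb in auto)
    have i2: "integrable M (\<lambda>\<omega>. (?S \<omega>)\<^sup>2)"
    proof (rule int[of _ "(real n)\<^sup>2"])
      fix \<omega> show "\<bar>(?S \<omega>)\<^sup>2\<bar> \<le> (real n)\<^sup>2" using Sb[of \<omega>] by (simp add: abs_le_square_iff[symmetric])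
    qed measurable
    have "expectation (\<lambda>\<omega>. \<bar>?S \<omega>\<bar>) \<le> expectation (\<lambda>\<omega>. (?S \<omega>)\<^sup>2 / (2 * c) + c / 2)"
      using i1 i2 am by (intro integral_mono) auto
    also have "\<dots> = expectation (\<lambda>\<omega>. (?S \<omega>)\<^sup>2) / (2 * c) + c / 2"
      using i2 by (simp add: prob_space)
    also have "\<dots> \<le> (real n * (K + 2 * \<epsilon> * real n)) / (2 * c) + c / 2"
      using sq[of n] c by (intro add_right_mono divide_right_mono) auto
    also have "\<dots> = K / (2 * \<delta>) + 3 / 4 * \<delta> * real n"
      using \<delta> n by (simp add: c_def \<epsilon>_def field_simps power2_eq_square)
    finally show ?thesis .
  qed
  obtain n1 :: nat where n1: "2 * K / \<delta>\<^sup>2 < real n1" using reals_Archimedean2 by blast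
  have *: "K / (2 * \<delta>) + 3 / 4 * \<delta> * real n \<le> \<delta> * real n" if "n1 \<le> n" for n
  proof -
    have "2 * K / \<delta>\<^sup>2 < real n" using n1 that by linarith
    then have "2 * K < real n * \<delta>\<^sup>2" using \<delta> by (simp add: field_simps)
    then have "2 * K \<le> real n * \<delta> * \<delta>" by (simp add: power2_eq_square mult.assoc)
    then show ?thesis using \<delta> by (simp add: field_simps)
  qed
  show ?thesis unfolding eventually_sequentially
  proof (intro exI[of _ "max 1 n1"] allI impI)
    fix n assume n: "max 1 n1 \<le> n"
    then have "0 < n" and n1: "n1 \<le> n" by auto
    from order_trans[OF main[OF this(1)] *[OF n1]]
    show "expectation (\<lambda>\<omega>. \<bar>\<Sum>s<n. X s \<omega>\<bar>) \<le> \<delta> * real n" .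
  qed
qed

section \<open>Events attached to a generation slot, and measurability of the peaks\<close>

context stable_queue
begin

lemma succ_at_unique: "succ_at x i s r \<Longrightarrow> succ_at x i s r' \<Longrightarrow> r = r'"
proof (induction r arbitrary: s r')
  case 0
  then show ?case by (cases r') auto
next
  case (Suc r)
  then show ?case by (cases r') auto
qed

lemma launched_iff:
  assumes pos: "\<forall>m i. 1 \<le> x m i"
  shows "launches (st x s) (cmp x (st x s)) \<and> \<phi> (fst (st x s)) \<longleftrightarrow> (\<exists>i. gen x i = Suc s \<and> \<phi> i)"
  using launches_iff[OF pos, of s] by metis

text \<open>Packet 0 is generated at slot 0; every other slot is the successor of some \<open>s\<close>.\<close>

lemma card_gen:
  "(\<Sum>s<t. of_bool (\<exists>i. gen x i = Suc s \<and> P i)) \<le> real (card {i. P i \<and> gen x i < Suc t})"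
  "real (card {i. P i \<and> gen x i < Suc t}) \<le> (\<Sum>s<t. of_bool (\<exists>i. gen x i = Suc s \<and> P i)) + 1"
proof -
  define A where "A = {i. P i \<and> (\<exists>s<t. gen x i = Suc s)}"
  have fin: "finite {i. P i \<and> gen x i < Suc t}"
    using finite_gen_less[of x "Suc t"] by (rule rev_finite_subset) auto
  have "bij_betw (\<lambda>i. gen x i - 1) A {s. s < t \<and> (\<exists>i. gen x i = Suc s \<and> P i)}"
  proof (rule bij_betw_imageI)
    show "inj_on (\<lambda>i. gen x i - 1) A"
    proof (rule inj_onI)
      fix i j assume ij: "i \<in> A" "j \<in> A" "gen x i - 1 = gen x j - 1"
      then obtain s s' where s: "gen x i = Suc s" "gen x j = Suc s'" by (auto simp: A_def)
      then have "s = s'" using ij(3) by simp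
      then have "gen x i = gen x j" by (simp only: s)
      then show "i = j" by simp
    qed
    show "(\<lambda>i. gen x i - 1) ` A = {s. s < t \<and> (\<exists>i. gen x i = Suc s \<and> P i)}"
      by (force simp: A_def image_iff)
  qed
  then have "card A = card {s. s < t \<and> (\<exists>i. gen x i = Suc s \<and> P i)}"
    by (rule bij_betw_same_card)
  moreover have "(\<Sum>s<t. of_bool (\<exists>i. gen x i = Suc s \<and> P i)) = real (card {s. s < t \<and> (\<exists>i. gen x i = Suc s \<and> P i)})"
    by (simp add: of_bool_def sum.If_cases Int_def)
  ultimately have S: "(\<Sum>s<t. of_bool (\<exists>i. gen x i = Suc s \<and> P i)) = real (card A)" by simp
  have sub: "A \<subseteq> {i. P i \<and> gen x i < Suc t}" by (auto simp: A_def)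
  have sup: "{i. P i \<and> gen x i < Suc t} \<subseteq> insert 0 A"
  proof
    fix i assume i: "i \<in> {i. P i \<and> gen x i < Suc t}"
    show "i \<in> insert 0 A"
    proof (cases "gen x i")
      case 0
      then show ?thesis using gen_ge[of i x] by simp
    next
      case (Suc s)
      then show ?thesis using i by (auto simp: A_def)
    qed
  qed
  show "(\<Sum>s<t. of_bool (\<exists>i. gen x i = Suc s \<and> P i)) \<le> real (card {i. P i \<and> gen x i < Suc t})"
    unfolding S using card_mono[OF fin sub] by simp
  have finA: "finite A" using sub fin by (rule finite_subset)
  have "card {i. P i \<and> gen x i < Suc t} \<le> card (insert 0 A)" using finA by (intro card_mono[OF _ sup]) simp
  also have "\<dots> \<le> Suc (card A)" by (rule card_insert_le_m1) simp_all
  finally show "real (card {i. P i \<and> gen x i < Suc t}) \<le> (\<Sum>s<t. of_bool (\<exists>i. gen x i = Suc s \<and> P i)) + 1"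
    unfolding S by simp
qed

end

context queue_model
begin

lemma dep_history: "dep (Suc n) (\<lambda>x. history k prio x n)"
  unfolding dep_def
proof (intro allI impI)
  fix x y :: "server \<Rightarrow> nat \<Rightarrow> nat"
  assume eq: "\<forall>m. \<forall>i<Suc n. x m i = y m i"
  have L: "launch prio x i t f = launch prio y i t f" if "i < Suc n" for i t f
    using eq that by (simp add: launch_def)
  have "history k prio x i = history k prio y i" if "i \<le> n" for i
    using that
  proof (induction i)
    case (Suc i)
    then show ?case using L[of "Suc i"] by (simp split: prod.split)
  qed (use L[of 0] in simp)
  then show "history k prio x n = history k prio y n" by simp
qed

lemma dep_gen: "dep (Suc n) (\<lambda>x. gen x n)"
  unfolding dep_def
proof (intro allI impI)
  fix x y :: "server \<Rightarrow> nat \<Rightarrow> nat" assume "\<forall>m. \<forall>i<Suc n. x m i = y m i"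
  then have "history k prio x n = history k prio y n" using dep_history[of n, unfolded dep_def] by blast
  then show "gen x n = gen y n" by (simp add: gen_slot_def)
qed

lemma dep_rcv: "dep (Suc n) (\<lambda>x. rcv x n)"
  unfolding dep_def
proof (intro allI impI)
  fix x y :: "server \<Rightarrow> nat \<Rightarrow> nat" assume eq: "\<forall>m. \<forall>i<Suc n. x m i = y m i"
  then have "history k prio x n = history k prio y n" using dep_history[of n, unfolded dep_def] by blast
  then show "rcv x n = rcv y n" using eq by (simp add: rec_slot_def gen_slot_def server_of_def)
qed

lemma dep_comp2: "dep n f \<Longrightarrow> dep n' g \<Longrightarrow> dep (max n n') (\<lambda>x. h (f x) (g x))"
  unfolding dep_def by (metis less_max_iff_disj)

lemma pred_dep:
  assumes "dep n \<phi>"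
  shows "Measurable.pred M (\<lambda>\<omega>. \<phi> (xx \<omega>))"
  using dep_sets[OF assms] by (simp add: pred_def)

lemma pred_utd [measurable]: "Measurable.pred M (\<lambda>\<omega>. utd (xx \<omega>) i)"
proof -
  have [measurable]: "Measurable.pred M (\<lambda>\<omega>. rcv (xx \<omega>) i < rcv (xx \<omega>) j)" for j
    by (rule pred_dep[OF dep_comp2[OF dep_rcv dep_rcv]])
  show ?thesis unfolding utd_iff by measurable
qed

lemma pred_next_rcv [measurable]: "Measurable.pred M (\<lambda>\<omega>. next_rcv (xx \<omega>) i = gen (xx \<omega>) i + c)"
proof -
  have eq: "next_rcv x i = gen x i + c \<longleftrightarrow> (\<exists>j>i. rcv x j = gen x i + c) \<and> (\<forall>j>i. gen x i + c \<le> rcv x j)" for x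
    using next_rcv_ex[of i x] next_rcv_le[of i _ x] by (metis le_antisym)
  have [measurable]: "Measurable.pred M (\<lambda>\<omega>. rcv (xx \<omega>) j = gen (xx \<omega>) i + c)" for j
    by (rule pred_dep[OF dep_comp2[OF dep_rcv dep_gen, where h = "\<lambda>a b. a = b + c"]])
  have [measurable]: "Measurable.pred M (\<lambda>\<omega>. gen (xx \<omega>) i + c \<le> rcv (xx \<omega>) j)" for j
    by (rule pred_dep[OF dep_comp2[OF dep_gen dep_rcv, where h = "\<lambda>a b. a + c \<le> b"]])
  show ?thesis unfolding eq by measurable
qed

lemma uidx_0_iff: "uidx x 0 = i \<longleftrightarrow> utd x i \<and> (\<forall>j<i. \<not> utd x j)"
proof -
  have "uidx x 0 = (LEAST j. utd x j)" by (simp add: enumerate_0)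
  then show ?thesis using utd_uidx[of x 0] by (metis LeastI not_less_Least linorder_neqE_nat)
qed

text \<open>Writes the index of an up-to-date packet through countably many events about
  \<open>utd\<close>, which is how measurability of the peaks is reached.\<close>

lemma uidx_Suc_iff: "uidx x (Suc n) = i \<longleftrightarrow> (\<exists>i'<i. uidx x n = i' \<and> utd x i \<and> (\<forall>j. i' < j \<and> j < i \<longrightarrow> \<not> utd x j))"
proof -
  have L: "uidx x (Suc n) = (LEAST j. utd x j \<and> uidx x n < j)"
    using enumerate_Suc''[OF infinite_utd, of x n] by simp
  have lt: "uidx x n < uidx x (Suc n)" using strict_mono_uidx by (simp add: strict_mono_less)
  have no: "\<not> utd x j" if "uidx x n < j" "j < uidx x (Suc n)" for j
    using not_less_Least[of j "\<lambda>j. utd x j \<and> uidx x n < j"] that unfolding L by blast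
  show ?thesis
  proof
    assume "uidx x (Suc n) = i"
    then show "\<exists>i'<i. uidx x n = i' \<and> utd x i \<and> (\<forall>j. i' < j \<and> j < i \<longrightarrow> \<not> utd x j)"
      using lt no utd_uidx[of x "Suc n"] by blast
  next
    assume "\<exists>i'<i. uidx x n = i' \<and> utd x i \<and> (\<forall>j. i' < j \<and> j < i \<longrightarrow> \<not> utd x j)"
    then have i: "uidx x n < i" "utd x i" "\<And>j. uidx x n < j \<Longrightarrow> j < i \<Longrightarrow> \<not> utd x j" by blast+
    show "uidx x (Suc n) = i"
    proof (rule antisym)
      show "uidx x (Suc n) \<le> i" unfolding L using i by (intro Least_le) simp
      show "i \<le> uidx x (Suc n)" using i(3)[OF lt] utd_uidx[of x "Suc n"] by (meson not_le)
    qed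
  qed
qed

lemma pred_uidx [measurable]: "Measurable.pred M (\<lambda>\<omega>. uidx (xx \<omega>) n = i)"
proof (induction n arbitrary: i)
  case 0
  show ?case unfolding uidx_0_iff by measurable
next
  case (Suc n)
  note Suc [measurable]
  show ?case unfolding uidx_Suc_iff by measurable
qed

lemma pred_peak [measurable]: "Measurable.pred M (\<lambda>\<omega>. peak_aoi k prio (xx \<omega>) (Suc n) = h)"
proof -
  have eq: "peak_aoi k prio x (Suc n) = h \<longleftrightarrow> (\<exists>i. uidx x n = i \<and> next_rcv x i = gen x i + (h + 1))" for x
    unfolding peak_eq_iff by (simp add: add.assoc)
  show ?thesis unfolding eq by measurable
qed

text \<open>Stands for an up-to-date packet generated at slot \<open>Suc s\<close> whose cycle ends
  within \<open>H\<close> slots of its generation. The truncation makes the event known at slot s +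
  H + 1, as the weak law requires.\<close>

definition hit :: "nat \<Rightarrow> nat \<Rightarrow> (server \<Rightarrow> nat \<Rightarrow> nat) \<Rightarrow> bool" where
  "hit H s = launched s (\<lambda>i x. \<exists>h<H. succ_at x i (Suc s) h)"

definition hit1 :: "nat \<Rightarrow> nat \<Rightarrow> (server \<Rightarrow> nat \<Rightarrow> nat) \<Rightarrow> bool" where
  "hit1 h s = launched s (\<lambda>i x. succ_at x i (Suc s) h)"

text \<open>The up-to-date packets lost by the truncation are among these: no later packet is
  received within \<open>H\<close> slots. For H = 0 every generated packet qualifies.\<close>

definition late :: "nat \<Rightarrow> nat \<Rightarrow> (server \<Rightarrow> nat \<Rightarrow> nat) \<Rightarrow> bool" where
  "late H s = launched s (\<lambda>i x. alive_at x i (Suc s) H)"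

lemma determined_ex_succ: "determined (s + H) (\<lambda>x. \<exists>h<H. succ_at x i s h)"
  unfolding determined_def
proof (intro allI impI)
  fix x y assume eq: "obs x (s + H) = obs y (s + H)"
  have "succ_at x i s h = succ_at y i s h" if "h < H" for h
  proof -
    have "obs x (s + h + 1) = obs y (s + h + 1)" using obs_prefix[OF eq] that by simp
    then show ?thesis using determined_succ_at[of s h i] unfolding determined_def by blast
  qed
  then show "(\<exists>h<H. succ_at x i s h) = (\<exists>h<H. succ_at y i s h)" by blast
qed

lemma determined_hit: "determined (s + Suc H) (hit H s)"
  unfolding hit_def
proof (rule determined_launched)
  show "determined (s + Suc H) (\<lambda>x. \<exists>h<H. succ_at x i (Suc s) h)" for i
    using determined_ex_succ[of "Suc s" H i] by simp
qed simp

lemma prob_ex_succ: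
  assumes "valid i (cfgo q)"
  shows "prob {\<omega> \<in> space M. obs (xx \<omega>) (length q) = q \<and> (\<exists>h<H. succ_at (xx \<omega>) i (length q) h)} = Z q (on_emb i q (vsum H))"
proof -
  let ?E = "\<lambda>h. {\<omega> \<in> space M. obs (xx \<omega>) (length q) = q \<and> succ_at (xx \<omega>) i (length q) h}"
  have U: "{\<omega> \<in> space M. obs (xx \<omega>) (length q) = q \<and> (\<exists>h<H. succ_at (xx \<omega>) i (length q) h)} = (\<Union>h<H. ?E h)"
    by auto
  have "prob (\<Union>h<H. ?E h) = (\<Sum>h<H. prob (?E h))"
  proof (rule finite_measure_finite_Union)
    have "{\<omega> \<in> space M. obs (xx \<omega>) (length q) = q} \<inter> {\<omega> \<in> space M. succ_at (xx \<omega>) i (length q) h} \<in> events" for h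
      using obs_sets determined_sets[OF determined_succ_at] by (rule sets.Int)
    moreover have "{\<omega> \<in> space M. obs (xx \<omega>) (length q) = q} \<inter> {\<omega> \<in> space M. succ_at (xx \<omega>) i (length q) h} = ?E h" for h
      by auto
    ultimately show "?E ` {..<H} \<subseteq> events" by auto
    show "disjoint_family_on ?E {..<H}"
      using succ_at_unique by (fastforce simp: disjoint_family_on_def)
  qed simp
  also have "\<dots> = (\<Sum>h<H. Z q (on_emb i q ((Aop ^^ h) csuc)))"
    by (intro sum.cong refl prob_succ_at assms)
  also have "\<dots> = Z q (\<lambda>p1 p2 l. \<Sum>h<H. (Aop ^^ h) csuc (emb i (cfgo q) p1 p2 l))"
    by (rule Z_sum[symmetric])
  also have "\<dots> = Z q (on_emb i q (vsum H))"
    by (simp only: vsum_def)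
  finally show ?thesis by (simp only: U)
qed

lemma prob_hit:
  assumes "length q \<le> s"
  shows "prob {\<omega> \<in> space M. obs (xx \<omega>) (length q) = q \<and> hit H s (xx \<omega>)} = Z q ((Rop ^^ (s - length q)) (gam (vsum H)))"
  unfolding hit_def
proof (rule prob_launched[OF _ _ _ assms])
  show "determined (s + Suc H) (\<lambda>x. \<exists>h<H. succ_at x i (Suc s) h)" for i
    using determined_ex_succ[of "Suc s" H i] by simp
next
  fix i and q :: "(bool \<times> bool) list"
  assume "valid i (cfgo q)" "length q = Suc s"
  then show "prob {\<omega> \<in> space M. obs (xx \<omega>) (length q) = q \<and> (\<exists>h<H. succ_at (xx \<omega>) i (Suc s) h)} = Z q (on_emb i q (vsum H))"
    using prob_ex_succ[of i q H] by simp
qed simp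

lemma Z_Nil_1: "Z [] (\<lambda>_ _ _. 1) = 1"
  using obs_prob[of "[]"] by (simp add: prob_space)

lemma sets_hit [measurable]: "Measurable.pred M (\<lambda>\<omega>. hit H s (xx \<omega>))"
  using determined_sets[OF determined_hit] by (simp add: pred_def)

lemma sets_hit1 [measurable]: "Measurable.pred M (\<lambda>\<omega>. hit1 h s (xx \<omega>))"
proof -
  have "determined (s + h + 2) (hit1 h s)" unfolding hit1_def
  proof (rule determined_launched)
    show "determined (s + h + 2) (\<lambda>x. succ_at x i (Suc s) h)" for i using determined_succ_at[of "Suc s" h i] by simp
  qed simp
  from determined_sets[OF this] show ?thesis by (simp add: pred_def)
qed

lemma sets_late [measurable]: "Measurable.pred M (\<lambda>\<omega>. late H s (xx \<omega>))"
proof -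
  have "determined (s + H + 1) (late H s)" unfolding late_def
  proof (rule determined_launched)
    show "determined (s + H + 1) (\<lambda>x. alive_at x i (Suc s) H)" for i using determined_alive_at[of "Suc s" H i] by simp
  qed simp
  from determined_sets[OF this] show ?thesis by (simp add: pred_def)
qed

lemma prob_hit1: "prob {\<omega> \<in> space M. hit1 h s (xx \<omega>)} = Z [] ((Rop ^^ s) (gam ((Aop ^^ h) csuc)))"
  using prob_launched_succ[of "[]" s h] by (simp add: hit1_def)

lemma prob_late: "prob {\<omega> \<in> space M. late H s (xx \<omega>)} = Z [] ((Rop ^^ s) (gam ((Aop ^^ H) (\<lambda>_. 1))))"
  using prob_launched_alive[of "[]" s H] by (simp add: late_def)

end

lemma (in prob_space) expectation_of_bool:
  assumes "Measurable.pred M P"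
  shows "integrable M (\<lambda>\<omega>. of_bool (P \<omega>) :: real)" "expectation (\<lambda>\<omega>. of_bool (P \<omega>)) = prob {\<omega> \<in> space M. P \<omega>}"
proof -
  have S: "{\<omega> \<in> space M. P \<omega>} \<in> events" using assms by (simp add: pred_def)
  have eq: "indicat_real {\<omega> \<in> space M. P \<omega>} \<omega> = of_bool (P \<omega>)" if "\<omega> \<in> space M" for \<omega>
    using that by (simp add: indicator_def)
  have "integrable M (indicat_real {\<omega> \<in> space M. P \<omega>})"
    using S by (intro integrable_const_bound[of _ 1]) auto
  then show "integrable M (\<lambda>\<omega>. of_bool (P \<omega>) :: real)"
    by (rule Bochner_Integration.integrable_cong[THEN iffD1, rotated -1]) (simp_all add: eq)
  have "expectation (\<lambda>\<omega>. of_bool (P \<omega>)) = expectation (indicat_real {\<omega> \<in> space M. P \<omega>})"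
    by (rule Bochner_Integration.integral_cong) (simp_all add: eq)
  then show "expectation (\<lambda>\<omega>. of_bool (P \<omega>)) = prob {\<omega> \<in> space M. P \<omega>}" using S by simp
qed

lemma (in prob_space) expectation_sum_of_bool:
  assumes "\<And>s. Measurable.pred M (P s)"
  shows "integrable M (\<lambda>\<omega>. \<Sum>s\<in>A. of_bool (P s \<omega>) :: real)"
    "expectation (\<lambda>\<omega>. \<Sum>s\<in>A. of_bool (P s \<omega>)) = (\<Sum>s\<in>A. prob {\<omega> \<in> space M. P s \<omega>})"
proof -
  show "integrable M (\<lambda>\<omega>. \<Sum>s\<in>A. of_bool (P s \<omega>) :: real)"
    by (intro Bochner_Integration.integrable_sum expectation_of_bool assms)
  have "expectation (\<lambda>\<omega>. \<Sum>s\<in>A. of_bool (P s \<omega>)) = (\<Sum>s\<in>A. expectation (\<lambda>\<omega>. of_bool (P s \<omega>)) :: real)"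
    by (rule Bochner_Integration.integral_sum, rule expectation_of_bool(1), rule assms)
  then show "expectation (\<lambda>\<omega>. \<Sum>s\<in>A. of_bool (P s \<omega>)) = (\<Sum>s\<in>A. prob {\<omega> \<in> space M. P s \<omega>})"
    by (simp only: expectation_of_bool(2)[OF assms])
qed

section \<open>Long-run frequencies per slot\<close>

context stationary_queue
begin

text \<open>The long-run rate per slot of \<open>v\<close>, evaluated at the starting states of new
  packets; sigma is this functional divided by \<open>qtot p\<close>.\<close>

definition qmean :: "(ystate \<Rightarrow> real) \<Rightarrow> real" where
  "qmean v = ysum (\<lambda>y. q_init p y * v y)"

text \<open>Summing over the finitely many states makes the Cesaro error uniform in the starting
  state, hence in the observed past.\<close>

definition err :: "(ystate \<Rightarrow> real) \<Rightarrow> nat \<Rightarrow> real" where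
  "err v n = (\<Sum>w\<in>r_states. \<bar>(\<Sum>r<n. (Rr ^^ r) (at_rst (gam v)) w) / real n - qmean v\<bar>)"

lemma err_nonneg: "0 \<le> err v n"
  unfolding err_def by (intro sum_nonneg) simp

lemma err_tendsto: "err v \<longlonglongrightarrow> 0"
proof -
  have "(\<lambda>n. (\<Sum>r<n. (Rr ^^ r) (at_rst (gam v)) w) / real n) \<longlonglongrightarrow> qmean v" if "w \<in> r_states" for w
    using cesaro_Rr[OF that, of "at_rst (gam v)"] by (simp add: sum_gam[OF k_ge] qmean_def)
  then have "(\<lambda>n. \<Sum>w\<in>r_states. \<bar>(\<Sum>r<n. (Rr ^^ r) (at_rst (gam v)) w) / real n - qmean v\<bar>)
      \<longlonglongrightarrow> (\<Sum>w\<in>r_states. \<bar>qmean v - qmean v\<bar>)"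
    by (intro tendsto_sum tendsto_rabs tendsto_diff tendsto_const)
  then show ?thesis unfolding err_def[abs_def] by simp
qed

lemma err_bound:
  assumes "phases p1 p2 l"
  shows "\<bar>(\<Sum>r<n. (Rop ^^ r) (gam v) p1 p2 l) - real n * qmean v\<bar> \<le> real n * err v n"
proof (cases "n = 0")
  case False
  let ?A = "\<lambda>w. (\<Sum>r<n. (Rr ^^ r) (at_rst (gam v)) w) / real n - qmean v"
  have "\<bar>?A (rst p1 p2 l)\<bar> \<le> err v n"
    unfolding err_def using assms by (intro member_le_sum[of _ _ "\<lambda>w. \<bar>?A w\<bar>"]) (auto simp: rst_mem)
  then have "real n * \<bar>?A (rst p1 p2 l)\<bar> \<le> real n * err v n" by (intro mult_left_mono) auto
  moreover have "real n * \<bar>?A (rst p1 p2 l)\<bar> = \<bar>real n * ?A (rst p1 p2 l)\<bar>" by (simp add: abs_mult)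
  moreover have "real n * ?A (rst p1 p2 l) = (\<Sum>r<n. (Rop ^^ r) (gam v) p1 p2 l) - real n * qmean v"
    using False by (simp add: Rop_pow_Rr[OF assms] right_diff_distrib)
  ultimately show ?thesis by simp
qed simp

lemma qmean_tendsto:
  assumes "\<And>y. y \<in> set y_states \<Longrightarrow> (\<lambda>H. F H y) \<longlonglongrightarrow> v y"
  shows "(\<lambda>H. qmean (F H)) \<longlonglongrightarrow> qmean v"
  unfolding qmean_def ysum_set by (intro tendsto_sum tendsto_mult tendsto_const assms)

lemma qmean_alive_tendsto: "(\<lambda>H. qmean ((Aop ^^ H) (\<lambda>_. 1))) \<longlonglongrightarrow> 0"
  using qmean_tendsto[of "\<lambda>H. (Aop ^^ H) (\<lambda>_. 1)" "\<lambda>_. 0", OF Apow_1_tendsto] by (simp add: qmean_def ysum_set)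

end

locale dual_queue_system = queue_model k prio N \<alpha> B M T + stationary_queue k prio N \<alpha> B p
  for k prio N \<alpha> B and M :: "'w measure" and T p
begin

text \<open>The mixing estimate for the weak law: whatever was observed, the average rate from then
  on is close to \<open>qmean v\<close>.\<close>

lemma Z_cesaro:
  "\<bar>(\<Sum>r<n. Z q ((Rop ^^ r) (gam v))) - real n * qmean v * Z q (\<lambda>_ _ _. 1)\<bar> \<le> real n * err v n * Z q (\<lambda>_ _ _. 1)"
proof -
  let ?S = "\<lambda>p1 p2 l. \<Sum>r<n. (Rop ^^ r) (gam v) p1 p2 l"
  have "Z q ?S \<le> Z q (\<lambda>_ _ _. (real n * qmean v + real n * err v n) * 1)"
    using err_bound[where n = n and v = v] by (intro Z_mono) (fastforce simp: abs_le_iff)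
  moreover have "Z q (\<lambda>_ _ _. (real n * qmean v - real n * err v n) * 1) \<le> Z q ?S"
    using err_bound[where n = n and v = v] by (intro Z_mono) (fastforce simp: abs_le_iff)
  moreover have "Z q ?S = (\<Sum>r<n. Z q ((Rop ^^ r) (gam v)))" by (rule Z_sum)
  ultimately show ?thesis unfolding Z_scale by (simp add: algebra_simps abs_le_iff)
qed

lemma Z_mean: "(\<lambda>n. (\<Sum>r<n. Z [] ((Rop ^^ r) (gam v))) / real n) \<longlonglongrightarrow> qmean v"
proof -
  have "\<bar>(\<Sum>r<n. Z [] ((Rop ^^ r) (gam v))) / real n - qmean v\<bar> \<le> err v n" if "0 < n" for n
  proof -
    have "\<bar>(\<Sum>r<n. Z [] ((Rop ^^ r) (gam v))) - real n * qmean v\<bar> \<le> real n * err v n"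
      using Z_cesaro[where n = n and q = "[]" and v = v] by (simp add: Z_Nil_1)
    moreover have "\<bar>(\<Sum>r<n. Z [] ((Rop ^^ r) (gam v))) - real n * qmean v\<bar>
        = real n * \<bar>(\<Sum>r<n. Z [] ((Rop ^^ r) (gam v))) / real n - qmean v\<bar>"
    proof -
      have "(\<Sum>r<n. Z [] ((Rop ^^ r) (gam v))) - real n * qmean v
          = real n * ((\<Sum>r<n. Z [] ((Rop ^^ r) (gam v))) / real n - qmean v)"
        using that by (simp add: right_diff_distrib)
      then show ?thesis by (simp only: abs_mult abs_of_nat)
    qed
    ultimately show ?thesis using that by simp
  qed
  then have "\<forall>\<^sub>F n in sequentially. norm ((\<Sum>r<n. Z [] ((Rop ^^ r) (gam v))) / real n - qmean v) \<le> err v n"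
    unfolding eventually_sequentially real_norm_def by (intro exI[of _ 1]) auto
  from Lim_null_comparison[OF this err_tendsto] show ?thesis by (rule LIM_zero_cancel)
qed

abbreviation p_hit :: "nat \<Rightarrow> nat \<Rightarrow> real" where
  "p_hit H s \<equiv> prob {\<omega> \<in> space M. hit H s (xx \<omega>)}"

abbreviation p_hit1 :: "nat \<Rightarrow> nat \<Rightarrow> real" where
  "p_hit1 h s \<equiv> prob {\<omega> \<in> space M. hit1 h s (xx \<omega>)}"

abbreviation p_late :: "nat \<Rightarrow> nat \<Rightarrow> real" where
  "p_late H s \<equiv> prob {\<omega> \<in> space M. late H s (xx \<omega>)}"

lemma mean_hit: "(\<lambda>n. (\<Sum>s<n. p_hit H s) / real n) \<longlonglongrightarrow> qmean (vsum H)"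
  using Z_mean[of "vsum H"] prob_hit[of "[]" _ H] by simp

lemma mean_hit1: "(\<lambda>n. (\<Sum>s<n. p_hit1 h s) / real n) \<longlonglongrightarrow> qmean ((Aop ^^ h) csuc)"
  unfolding prob_hit1 by (rule Z_mean)

lemma mean_late: "(\<lambda>n. (\<Sum>s<n. p_late H s) / real n) \<longlonglongrightarrow> qmean ((Aop ^^ H) (\<lambda>_. 1))"
  unfolding prob_late by (rule Z_mean)

lemma qmean_vsum_bounds: "0 \<le> qmean (vsum H)" "qmean (vsum H) \<le> 1"
proof -
  have "(\<Sum>s<n. p_hit H s) / real n \<le> 1" for n
  proof -
    have "(\<Sum>s<n. p_hit H s) \<le> (\<Sum>s<n. 1)" by (rule sum_mono) simp
    then show ?thesis by (cases "n = 0") simp_all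
  qed
  then show "qmean (vsum H) \<le> 1" by (intro LIMSEQ_le_const2[OF mean_hit]) blast
  have "0 \<le> (\<Sum>s<n. p_hit H s) / real n" for n by (intro divide_nonneg_nonneg sum_nonneg) auto
  then show "0 \<le> qmean (vsum H)" by (intro LIMSEQ_le_const[OF mean_hit]) blast
qed

text \<open>By \<open>Z_cesaro\<close> the centred indicators average out given any past. The event
  \<open>hit H s\<close> is settled \<open>Suc H\<close> slots after \<open>s\<close>, hence the
  choice of \<open>d\<close>.\<close>

lemma hit_weak_law:
  assumes "0 < \<delta>"
  shows "\<forall>\<^sub>F n in sequentially. expectation (\<lambda>\<omega>. \<bar>\<Sum>s<n. of_bool (hit H s (xx \<omega>)) - qmean (vsum H)\<bar>) \<le> \<delta> * real n"
proof (rule weak_law_cesaro[where Ob = "\<lambda>t \<omega>. obs (xx \<omega>) t" and Q = "\<lambda>t. {q. length q = t}" and d = "Suc H"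
      and e = "err (vsum H)"])
  show "random_variable borel (\<lambda>\<omega>. of_bool (hit H s (xx \<omega>)) - qmean (vsum H))" for s by measurable
  show "\<bar>of_bool (hit H s (xx \<omega>)) - qmean (vsum H)\<bar> \<le> 1" for s \<omega>
    using qmean_vsum_bounds[of H] by (simp add: abs_le_iff)
  show "finite {q :: (bool \<times> bool) list. length q = t}" for t by (rule finite_obs)
  show "obs (xx \<omega>) t \<in> {q. length q = t}" for t \<omega> by simp
  show "{\<omega> \<in> space M. obs (xx \<omega>) t = q} \<in> events" for t q by (rule obs_sets)
  show "of_bool (hit H s (xx \<omega>)) - qmean (vsum H) = of_bool (hit H s (xx \<omega>')) - qmean (vsum H)"
    if "obs (xx \<omega>) (s + Suc H) = obs (xx \<omega>') (s + Suc H)" for s \<omega> \<omega>'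
    using determined_hit[of s H, unfolded determined_def, rule_format, OF that] by simp
  show "err (vsum H) \<longlonglongrightarrow> 0" by (rule err_tendsto)
  show "0 \<le> err (vsum H) n" for n by (rule err_nonneg)
  show "0 < \<delta>" by fact
next
  fix t q n assume "q \<in> {q :: (bool \<times> bool) list. length q = t}"
  then have q: "length q = t" by simp
  let ?O = "{\<omega> \<in> space M. obs (xx \<omega>) t = q}"
  have P: "prob ?O = Z q (\<lambda>_ _ _. 1)" using obs_prob[of q] q by simp
  have "expectation (\<lambda>\<omega>. indicat_real ?O \<omega> * (of_bool (hit H (t + r) (xx \<omega>)) - qmean (vsum H)))
      = Z q ((Rop ^^ r) (gam (vsum H))) - qmean (vsum H) * Z q (\<lambda>_ _ _. 1)" for r
  proof -
    let ?E = "{\<omega> \<in> space M. obs (xx \<omega>) t = q \<and> hit H (t + r) (xx \<omega>)}"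
    have "?O \<inter> {\<omega> \<in> space M. hit H (t + r) (xx \<omega>)} \<in> events"
      using obs_sets determined_sets[OF determined_hit] by (rule sets.Int)
    moreover have "?O \<inter> {\<omega> \<in> space M. hit H (t + r) (xx \<omega>)} = ?E" by auto
    ultimately have E: "?E \<in> events" by simp
    have "expectation (\<lambda>\<omega>. indicat_real ?O \<omega> * (of_bool (hit H (t + r) (xx \<omega>)) - qmean (vsum H)))
        = expectation (\<lambda>\<omega>. indicat_real ?E \<omega> - qmean (vsum H) * indicat_real ?O \<omega>)"
      by (rule Bochner_Integration.integral_cong) (auto simp: indicator_def)
    also have "\<dots> = expectation (indicat_real ?E) - expectation (\<lambda>\<omega>. qmean (vsum H) * indicat_real ?O \<omega>)"
      using E obs_sets[of t q]
      by (intro Bochner_Integration.integral_diff integrable_mult_right integrable_const_bound[of "indicat_real _" 1]) auto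
    also have "\<dots> = prob ?E - qmean (vsum H) * prob ?O" using E obs_sets[of t q] by simp
    also have "prob ?E = Z q ((Rop ^^ r) (gam (vsum H)))" using prob_hit[of q "t + r" H] q by simp
    finally show ?thesis by (simp only: P)
  qed
  then have "(\<Sum>r<n. expectation (\<lambda>\<omega>. indicat_real ?O \<omega> * (of_bool (hit H (t + r) (xx \<omega>)) - qmean (vsum H))))
      = (\<Sum>r<n. Z q ((Rop ^^ r) (gam (vsum H)))) - real n * qmean (vsum H) * Z q (\<lambda>_ _ _. 1)"
    by (simp add: sum_subtractf)
  then show "\<bar>\<Sum>r<n. expectation (\<lambda>\<omega>. indicat_real ?O \<omega> * (of_bool (hit H (t + r) (xx \<omega>)) - qmean (vsum H)))\<bar>
      \<le> real n * err (vsum H) n * prob ?O"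
    using Z_cesaro[where n = n and q = q and v = "vsum H"] unfolding P by (simp only:)
qed

lemma hit_iff:
  assumes pos: "\<forall>m i. 1 \<le> x m i"
  shows "hit H s x \<longleftrightarrow> (\<exists>i. gen x i = Suc s \<and> utd x i \<and> next_rcv x i < gen x i + H + 1)"
proof -
  have "(\<exists>h<H. succ_at x i (Suc s) h) \<longleftrightarrow> utd x i \<and> next_rcv x i < gen x i + H + 1" if g: "gen x i = Suc s" for i
  proof -
    have "(\<exists>h<H. succ_at x i (gen x i) h) \<longleftrightarrow> (\<exists>h<H. utd x i \<and> next_rcv x i = gen x i + h + 1)"
      by (simp only: succ_at_gen[OF pos])
    also have "\<dots> \<longleftrightarrow> utd x i \<and> next_rcv x i < gen x i + H + 1"
    proof
      assume r: "utd x i \<and> next_rcv x i < gen x i + H + 1"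
      then show "\<exists>h<H. utd x i \<and> next_rcv x i = gen x i + h + 1"
        using gen_less_next_rcv[of x i] by (intro exI[of _ "next_rcv x i - gen x i - 1"]) auto
    qed auto
    finally show ?thesis by (simp only: g)
  qed
  then show ?thesis
    unfolding hit_def launched_def launched_iff[OF pos, of s "\<lambda>i. \<exists>h<H. succ_at x i (Suc s) h"] by blast
qed

lemma hit1_iff:
  assumes pos: "\<forall>m i. 1 \<le> x m i"
  shows "hit1 h s x \<longleftrightarrow> (\<exists>i. gen x i = Suc s \<and> utd x i \<and> next_rcv x i = gen x i + h + 1)"
proof -
  have "succ_at x i (Suc s) h \<longleftrightarrow> utd x i \<and> next_rcv x i = gen x i + h + 1" if "gen x i = Suc s" for i
    using succ_at_gen[OF pos, of i h] by (simp only: that)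
  then show ?thesis
    unfolding hit1_def launched_def launched_iff[OF pos, of s "\<lambda>i. succ_at x i (Suc s) h"] by blast
qed

lemma late_iff:
  assumes pos: "\<forall>m i. 1 \<le> x m i"
  shows "late H s x \<longleftrightarrow> (\<exists>i. gen x i = Suc s \<and> gen x i + H < next_rcv x i)"
proof -
  have "alive_at x i (Suc s) H \<longleftrightarrow> gen x i + H < next_rcv x i" if "gen x i = Suc s" for i
    using alive_at_gen[OF pos, of i H] by (simp only: that)
  then show ?thesis
    unfolding late_def launched_def launched_iff[OF pos, of s "\<lambda>i. alive_at x i (Suc s) H"] by blast
qed

definition n_utd :: "(server \<Rightarrow> nat \<Rightarrow> nat) \<Rightarrow> nat \<Rightarrow> nat" where
  "n_utd x t = card (utd_before x (Suc t))"

text \<open>Hits are among the up-to-date packets, and an up-to-date packet that is no hit is late.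
  The 1 accounts for packet 0, generated at slot 0.\<close>

lemma n_utd_bounds:
  assumes pos: "\<forall>m i. 1 \<le> x m i"
  shows "(\<Sum>s<t. of_bool (hit H s x)) \<le> real (n_utd x t)"
    and "real (n_utd x t) \<le> (\<Sum>s<t. of_bool (hit H s x)) + (\<Sum>s<t. of_bool (late H s x)) + 1"
proof -
  have fin: "finite (utd_before x (Suc t))"
    unfolding utd_before_def using finite_gen_less[of x "Suc t"] by (rule rev_finite_subset) auto
  have "(\<Sum>s<t. of_bool (hit H s x)) \<le> real (card {i. (utd x i \<and> next_rcv x i < gen x i + H + 1) \<and> gen x i < Suc t})"
    unfolding hit_iff[OF pos] by (rule card_gen(1))
  also have "\<dots> \<le> real (n_utd x t)"
    unfolding n_utd_def of_nat_le_iff by (rule card_mono[OF fin]) (auto simp: utd_before_def)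
  finally show "(\<Sum>s<t. of_bool (hit H s x)) \<le> real (n_utd x t)" .
  have "real (n_utd x t) \<le> (\<Sum>s<t. of_bool (\<exists>i. gen x i = Suc s \<and> utd x i)) + 1"
    unfolding n_utd_def utd_before_def by (rule card_gen(2))
  also have "(\<Sum>s<t. of_bool (\<exists>i. gen x i = Suc s \<and> utd x i)) \<le> (\<Sum>s<t. of_bool (hit H s x) + of_bool (late H s x) :: real)"
  proof (rule sum_mono)
    fix s
    have "hit H s x \<or> late H s x" if "\<exists>i. gen x i = Suc s \<and> utd x i"
    proof -
      obtain i where i: "gen x i = Suc s" "utd x i" using \<open>\<exists>i. gen x i = Suc s \<and> utd x i\<close> by blast
      show ?thesis
      proof (cases "next_rcv x i < gen x i + H + 1")
        case True
        then show ?thesis using i hit_iff[OF pos, of H s] by blast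
      next
        case False
        then have "gen x i + H < next_rcv x i" by simp
        then show ?thesis using i(1) late_iff[OF pos, of H s] by blast
      qed
    qed
    then show "of_bool (\<exists>i. gen x i = Suc s \<and> utd x i) \<le> of_bool (hit H s x) + (of_bool (late H s x) :: real)"
      by (auto simp: of_bool_def)
  qed
  finally show "real (n_utd x t) \<le> (\<Sum>s<t. of_bool (hit H s x)) + (\<Sum>s<t. of_bool (late H s x)) + 1"
    by (simp add: sum.distrib)
qed

lemma peaks_bounds:
  assumes pos: "\<forall>m i. 1 \<le> x m i"
  shows "\<bar>(\<Sum>j<n_utd x t. of_bool (peak_aoi k prio x (Suc j) = h)) - (\<Sum>s<t. of_bool (hit1 h s x))\<bar> \<le> (1 :: real)"
proof -
  let ?P = "\<lambda>i. utd x i \<and> next_rcv x i = gen x i + h + 1"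
  have "(\<Sum>j<n_utd x t. of_bool (peak_aoi k prio x (Suc j) = h)) = real (card {j. j < n_utd x t \<and> peak_aoi k prio x (Suc j) = h})"
    by (simp add: of_bool_def sum.If_cases Int_def)
  also have "\<dots> = real (card {i. ?P i \<and> gen x i < Suc t})"
    unfolding n_utd_def count_peaks by (intro arg_cong[of _ _ "\<lambda>X. real (card X)"]) (auto simp: utd_before_def)
  finally show ?thesis
    using card_gen[where t = t and x = x and P = ?P] unfolding hit1_iff[OF pos] by simp
qed

text \<open>Combines \<open>card_gen_le\<close> with the upper bound on \<open>n_utd\<close>; the 3
  is 1 from the former and 2 * 1 from the latter.\<close>

lemma gens_bound:
  assumes pos: "\<forall>m i. 1 \<le> x m i"
  shows "(\<Sum>s<t. of_bool (late 0 s x)) \<le> 2 * (\<Sum>s<t. of_bool (hit H s x)) + 2 * (\<Sum>s<t. of_bool (late H s x)) + (3 :: real)"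
proof -
  have "(\<Sum>s<t. of_bool (late 0 s x)) \<le> real (card {i. gen x i + 0 < next_rcv x i \<and> gen x i < Suc t})"
    unfolding late_iff[OF pos] by (rule card_gen(1))
  also have "\<dots> \<le> real (card {i. gen x i < Suc t})"
    unfolding of_nat_le_iff by (rule card_mono[OF finite_gen_less]) auto
  also have "\<dots> \<le> real (2 * n_utd x t + 1)"
    unfolding of_nat_le_iff n_utd_def by (rule card_gen_le[OF pos])
  finally show ?thesis using n_utd_bounds(2)[OF pos, where t = t and H = H] by simp
qed

text \<open>Take expectations in \<open>gens_bound\<close>, divide by t, and let first t and then H
  tend to infinity. With \<open>qtot_pos\<close> this makes the denominator of the theorem
  positive.\<close>

lemma qtot_le: "qtot p \<le> 2 * qmean gsuc"
proof -
  have le: "(\<Sum>s<t. p_late 0 s) \<le> 2 * (\<Sum>s<t. p_hit H s) + 2 * (\<Sum>s<t. p_late H s) + 3" for t H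
  proof -
    have L: "expectation (\<lambda>\<omega>. \<Sum>s<t. of_bool (late H s (xx \<omega>))) = (\<Sum>s<t. p_late H s)"
      "integrable M (\<lambda>\<omega>. \<Sum>s<t. of_bool (late H s (xx \<omega>)) :: real)" for H
      by (rule expectation_sum_of_bool[OF sets_late])+
    have T: "expectation (\<lambda>\<omega>. \<Sum>s<t. of_bool (hit H s (xx \<omega>))) = (\<Sum>s<t. p_hit H s)"
      "integrable M (\<lambda>\<omega>. \<Sum>s<t. of_bool (hit H s (xx \<omega>)) :: real)" 
      by (rule expectation_sum_of_bool[OF sets_hit])+
    have "expectation (\<lambda>\<omega>. \<Sum>s<t. of_bool (late 0 s (xx \<omega>)))
        \<le> expectation (\<lambda>\<omega>. 2 * (\<Sum>s<t. of_bool (hit H s (xx \<omega>))) + 2 * (\<Sum>s<t. of_bool (late H s (xx \<omega>))) + (3 :: real))"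
    proof (rule integral_mono_AE)
      show "AE \<omega> in M. (\<Sum>s<t. of_bool (late 0 s (xx \<omega>)))
          \<le> 2 * (\<Sum>s<t. of_bool (hit H s (xx \<omega>))) + 2 * (\<Sum>s<t. of_bool (late H s (xx \<omega>))) + (3 :: real)"
        using T_pos by eventually_elim (rule gens_bound)
    qed (use L T in \<open>simp_all del: sum_of_bool_eq\<close>)
    also have "\<dots> = 2 * (\<Sum>s<t. p_hit H s) + 2 * (\<Sum>s<t. p_late H s) + 3"
      using L(2)[of H] T(2) by (simp add: prob_space L(1) T(1) del: sum_of_bool_eq)
    finally show ?thesis by (simp only: L)
  qed
  have "qmean (\<lambda>_. 1) \<le> 2 * qmean (vsum H) + 2 * qmean ((Aop ^^ H) (\<lambda>_. 1)) + 3 * 0" for H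
  proof (rule LIMSEQ_le)
    show "(\<lambda>t. (\<Sum>s<t. p_late 0 s) / real t) \<longlonglongrightarrow> qmean (\<lambda>_. 1)" using mean_late[of 0] by simp
    show "(\<lambda>t. 2 * ((\<Sum>s<t. p_hit H s) / real t) + 2 * ((\<Sum>s<t. p_late H s) / real t) + 3 * (1 / real t))
        \<longlonglongrightarrow> 2 * qmean (vsum H) + 2 * qmean ((Aop ^^ H) (\<lambda>_. 1)) + 3 * 0"
      by (intro tendsto_add tendsto_mult tendsto_const mean_hit mean_late lim_1_over_n)
    show "\<exists>N. \<forall>t\<ge>N. (\<Sum>s<t. p_late 0 s) / real t
        \<le> 2 * ((\<Sum>s<t. p_hit H s) / real t) + 2 * ((\<Sum>s<t. p_late H s) / real t) + 3 * (1 / real t)"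
    proof (intro exI allI impI)
      fix t :: nat
      have "(\<Sum>s<t. p_late 0 s) / real t \<le> (2 * (\<Sum>s<t. p_hit H s) + 2 * (\<Sum>s<t. p_late H s) + 3) / real t"
        by (rule divide_right_mono[OF le]) simp
      then show "(\<Sum>s<t. p_late 0 s) / real t
        \<le> 2 * ((\<Sum>s<t. p_hit H s) / real t) + 2 * ((\<Sum>s<t. p_late H s) / real t) + 3 * (1 / real t)"
        by (simp add: add_divide_distrib)
    qed
  qed
  then have "qmean (\<lambda>_. 1) \<le> 2 * qmean gsuc + 2 * 0"
    by (intro LIMSEQ_le_const[OF tendsto_add[OF tendsto_mult[OF tendsto_const qmean_tendsto[OF vsum_tendsto]]
            tendsto_mult[OF tendsto_const qmean_alive_tendsto]]]) auto
  then show ?thesis by (simp add: qmean_def qtot_def)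
qed

lemma qmean_gsuc_pos: "0 < qmean gsuc"
  using qtot_pos qtot_le by linarith

section \<open>From slots to cycles\<close>

abbreviation p_peak :: "nat \<Rightarrow> nat \<Rightarrow> real" where
  "p_peak h j \<equiv> prob {\<omega> \<in> space M. peak_aoi k prio (xx \<omega>) (Suc j) = h}"

text \<open>The peaks counted over \<open>J\<close> cycles and over the packets generated up to slot
  \<open>t\<close> differ by at most |J - \<open>n_utd x t\<close>| + 1, since each cycle counts 0
  or 1. The number \<open>n_utd x t\<close> is then compared with t c through hits and late
  packets.\<close>

lemma peaks_pathwise:
  assumes pos: "\<forall>m i. 1 \<le> x m i"
  shows "\<bar>(\<Sum>j<J. of_bool (peak_aoi k prio x (Suc j) = h)) - (\<Sum>s<t. of_bool (hit1 h s x))\<bar>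
    \<le> \<bar>real J - real t * c\<bar> + \<bar>\<Sum>s<t. of_bool (hit H s x) - c\<bar> + (\<Sum>s<t. of_bool (late H s x)) + (2 :: real)"
proof -
  let ?f = "\<lambda>j. of_bool (peak_aoi k prio x (Suc j) = h) :: real"
  have mono: "0 \<le> sum ?f {..<b} - sum ?f {..<a} \<and> sum ?f {..<b} - sum ?f {..<a} \<le> real b - real a" if "a \<le> b" for a b
  proof -
    have S: "{..<b} = {..<a} \<union> {a..<b}" using that by auto
    have "sum ?f {..<b} = sum ?f {..<a} + sum ?f {a..<b}" unfolding S by (rule sum.union_disjoint) auto
    moreover have "0 \<le> sum ?f {a..<b}" by (rule sum_nonneg) simp
    moreover have "sum ?f {a..<b} \<le> (\<Sum>j\<in>{a..<b}. 1)" by (rule sum_mono) simp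
    ultimately show ?thesis using that by simp
  qed
  have "\<bar>sum ?f {..<J} - sum ?f {..<n_utd x t}\<bar> \<le> \<bar>real J - real (n_utd x t)\<bar>"
    using mono[of J "n_utd x t"] mono[of "n_utd x t" J] by (cases "J \<le> n_utd x t") auto
  moreover have "(\<Sum>s<t. of_bool (hit H s x) - c) = (\<Sum>s<t. of_bool (hit H s x)) - real t * c"
    by (simp add: sum_subtractf)
  moreover have "0 \<le> (\<Sum>s<t. of_bool (late H s x) :: real)" by (rule sum_nonneg) simp
  ultimately show ?thesis
    using n_utd_bounds[OF pos, where t = t and H = H] peaks_bounds[OF pos, where t = t and h = h] by linarith
qed

lemma peaks_mean:
  "\<bar>(\<Sum>j<J. p_peak h j) - (\<Sum>s<t. p_hit1 h s)\<bar>
    \<le> \<bar>real J - real t * c\<bar> + expectation (\<lambda>\<omega>. \<bar>\<Sum>s<t. of_bool (hit H s (xx \<omega>)) - c\<bar>) + (\<Sum>s<t. p_late H s) + 2"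
proof -
  let ?D = "\<lambda>\<omega>. (\<Sum>j<J. of_bool (peak_aoi k prio (xx \<omega>) (Suc j) = h)) - (\<Sum>s<t. of_bool (hit1 h s (xx \<omega>))) :: real"
  let ?W = "\<lambda>\<omega>. \<bar>\<Sum>s<t. of_bool (hit H s (xx \<omega>)) - c\<bar>"
  let ?L = "\<lambda>\<omega>. \<Sum>s<t. of_bool (late H s (xx \<omega>)) :: real"
  have D: "integrable M ?D" "expectation ?D = (\<Sum>j<J. p_peak h j) - (\<Sum>s<t. p_hit1 h s)"
    using expectation_sum_of_bool[OF pred_peak[where h = h], where A = "{..<J}"] expectation_sum_of_bool[OF sets_hit1[where h = h], where A = "{..<t}"]
    by (simp_all del: sum_of_bool_eq)
  have W: "integrable M ?W"
    by (intro integrable_abs Bochner_Integration.integrable_sum Bochner_Integration.integrable_diff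
        expectation_of_bool(1)[OF sets_hit] integrable_const)
  have L: "integrable M ?L" "expectation ?L = (\<Sum>s<t. p_late H s)"
    by (rule expectation_sum_of_bool[OF sets_late])+
  have "\<bar>expectation ?D\<bar> \<le> expectation (\<lambda>\<omega>. \<bar>?D \<omega>\<bar>)" by (rule integral_abs_bound)
  also have "\<dots> \<le> expectation (\<lambda>\<omega>. \<bar>real J - real t * c\<bar> + ?W \<omega> + ?L \<omega> + 2)"
  proof (rule integral_mono_AE)
    show "integrable M (\<lambda>\<omega>. \<bar>?D \<omega>\<bar>)" using D(1) by (rule integrable_abs)
    show "integrable M (\<lambda>\<omega>. \<bar>real J - real t * c\<bar> + ?W \<omega> + ?L \<omega> + 2)"
      by (intro Bochner_Integration.integrable_add W L integrable_const)
    show "AE \<omega> in M. \<bar>?D \<omega>\<bar> \<le> \<bar>real J - real t * c\<bar> + ?W \<omega> + ?L \<omega> + 2"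
      using T_pos by eventually_elim (rule peaks_pathwise)
  qed
  also have "\<dots> = \<bar>real J - real t * c\<bar> + expectation ?W + expectation ?L + 2"
    using W L(1) by (simp add: prob_space del: sum_of_bool_eq)
  finally show ?thesis by (simp only: D L)
qed

text \<open>Count the peaks equal to \<open>h\<close> in the first J cycles, J the integer part of d
  t. The expected number is d t L + o(t), as the probabilities converge; the packets generated up to
  slot t give t times the right-hand side, up to o(t). By the weak law the two counts differ by o(t)
  in mean.\<close>

lemma peak_limit:
  assumes "(\<lambda>n. peak_aoi_prob M k prio T h n) \<longlonglongrightarrow> L"
  shows "qmean gsuc * L = qmean ((Aop ^^ h) csuc)"
proof -
  define d where "d = qmean gsuc"
  have d: "0 < d" unfolding d_def by (rule qmean_gsuc_pos)
  define J where "J t = nat \<lfloor>d * real t\<rfloor>" for t :: nat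
  have J: "real (J t) \<le> d * real t" "d * real t \<le> real (J t) + 1" for t
    using d by (simp_all add: J_def)
  have Jt: "(\<lambda>t. real (J t) / real t) \<longlonglongrightarrow> d"
  proof -
    have "\<bar>real (J t) / real t - d\<bar> \<le> 1 / real t" if "0 < t" for t
    proof -
      have "real (J t) / real t \<le> d" using J(1)[of t] that by (simp add: divide_le_eq)
      moreover have "d \<le> (real (J t) + 1) / real t" using J(2)[of t] that by (simp add: le_divide_eq)
      ultimately show ?thesis by (simp add: add_divide_distrib abs_le_iff)
    qed
    then have "\<forall>\<^sub>F t in sequentially. norm (real (J t) / real t - d) \<le> 1 / real t"
      unfolding eventually_sequentially real_norm_def by (intro exI[of _ 1]) auto
    from Lim_null_comparison[OF this lim_1_over_n] show ?thesis by (rule LIM_zero_cancel)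
  qed
  have "filterlim J at_top sequentially"
  proof (rule filterlim_at_top[THEN iffD2], rule allI)
    fix m :: nat
    obtain t0 :: nat where t0: "(real m + 1) / d < real t0" using reals_Archimedean2 by blast
    have "m \<le> J t" if "t0 \<le> t" for t
    proof -
      have "(real m + 1) / d < real t" using t0 that by linarith
      then have "real m + 1 < d * real t" using d by (simp add: divide_less_eq mult.commute)
      then show ?thesis using J(2)[of t] by linarith
    qed
    then show "\<forall>\<^sub>F t in sequentially. m \<le> J t" unfolding eventually_sequentially by blast
  qed
  \<comment> \<open>Cycle numbers start at 1, hence the shift by \<open>Suc\<close>.\<close>
  have "p_peak h = (\<lambda>j. peak_aoi_prob M k prio T h (Suc j))"
    by (simp add: peak_aoi_prob_def xx_def)
  then have "p_peak h \<longlonglongrightarrow> L" using LIMSEQ_Suc[OF assms] by simp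
  from filterlim_compose[OF cesaro_mean[OF this] \<open>filterlim J at_top sequentially\<close>]
  have "(\<lambda>t. (\<Sum>j<J t. p_peak h j) / real (J t) * (real (J t) / real t)) \<longlonglongrightarrow> L * d"
    by (rule tendsto_mult[OF _ Jt])
  moreover have "(\<Sum>j<J t. p_peak h j) / real (J t) * (real (J t) / real t) = (\<Sum>j<J t. p_peak h j) / real t" for t
    by (cases "J t = 0") simp_all
  ultimately have peaks: "(\<lambda>t. (\<Sum>j<J t. p_peak h j) / real t) \<longlonglongrightarrow> L * d" by (simp only:)
  let ?v = "qmean ((Aop ^^ h) csuc)"
  \<comment> \<open>First t tends to infinity with H and \<delta> fixed, later \<delta> to 0 and H
    to infinity. The weak law gives the rate \<open>qmean (vsum H)\<close> instead of d, which costs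
    the first term.\<close>
  have eps: "\<bar>L * d - ?v\<bar> \<le> \<bar>d - qmean (vsum H)\<bar> + qmean ((Aop ^^ H) (\<lambda>_. 1)) + \<delta>" if \<delta>: "0 < \<delta>" for H \<delta>
  proof -
    let ?c = "qmean (vsum H)"
    have "\<bar>L * d - ?v\<bar> \<le> \<bar>d - ?c\<bar> + \<delta> + qmean ((Aop ^^ H) (\<lambda>_. 1)) + 3 * 0"
    proof (rule tendsto_le)
      show "((\<lambda>t. \<bar>(\<Sum>j<J t. p_peak h j) / real t - (\<Sum>s<t. p_hit1 h s) / real t\<bar>)) \<longlonglongrightarrow> \<bar>L * d - ?v\<bar>"
        by (intro tendsto_rabs tendsto_diff peaks mean_hit1)
      show "(\<lambda>t. \<bar>d - ?c\<bar> + \<delta> + (\<Sum>s<t. p_late H s) / real t + 3 * (1 / real t))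
          \<longlonglongrightarrow> \<bar>d - ?c\<bar> + \<delta> + qmean ((Aop ^^ H) (\<lambda>_. 1)) + 3 * 0"
        by (intro tendsto_add tendsto_mult tendsto_const mean_late lim_1_over_n)
      show "\<forall>\<^sub>F t in sequentially. \<bar>(\<Sum>j<J t. p_peak h j) / real t - (\<Sum>s<t. p_hit1 h s) / real t\<bar>
          \<le> \<bar>d - ?c\<bar> + \<delta> + (\<Sum>s<t. p_late H s) / real t + 3 * (1 / real t)"
        using hit_weak_law[OF \<delta>, of H] eventually_gt_at_top[of 0]
      proof eventually_elim
        case (elim t)
        have "\<bar>real (J t) - real t * ?c\<bar> \<le> \<bar>real (J t) - d * real t\<bar> + \<bar>real t * (d - ?c)\<bar>"
          by (simp add: algebra_simps)
        also have "\<dots> \<le> 1 + real t * \<bar>d - ?c\<bar>"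
          using J[of t] by (simp add: abs_mult abs_le_iff)
        \<comment> \<open>The 3 is 2 from \<open>peaks_mean\<close> and 1 from rounding d t.\<close>
        finally have "\<bar>(\<Sum>j<J t. p_peak h j) - (\<Sum>s<t. p_hit1 h s)\<bar>
            \<le> real t * \<bar>d - ?c\<bar> + \<delta> * real t + (\<Sum>s<t. p_late H s) + 3"
          using peaks_mean[of h "J t" t ?c H] elim(1) by linarith
        then have "\<bar>(\<Sum>j<J t. p_peak h j) - (\<Sum>s<t. p_hit1 h s)\<bar> / real t
            \<le> (real t * \<bar>d - ?c\<bar> + \<delta> * real t + (\<Sum>s<t. p_late H s) + 3) / real t"
          by (rule divide_right_mono) simp
        also have "\<dots> = \<bar>d - ?c\<bar> + \<delta> + (\<Sum>s<t. p_late H s) / real t + 3 * (1 / real t)"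
          using elim(2) by (simp add: add_divide_distrib)
        finally show ?case by (simp add: diff_divide_distrib[symmetric])
      qed
    qed simp
    then show ?thesis by simp
  qed
  have "\<bar>L * d - ?v\<bar> \<le> \<bar>d - qmean (vsum H)\<bar> + qmean ((Aop ^^ H) (\<lambda>_. 1))" for H
    by (rule field_le_epsilon, rule eps)
  moreover have "(\<lambda>H. \<bar>d - qmean (vsum H)\<bar> + qmean ((Aop ^^ H) (\<lambda>_. 1))) \<longlonglongrightarrow> \<bar>d - d\<bar> + 0"
    unfolding d_def by (intro tendsto_add tendsto_rabs tendsto_diff tendsto_const qmean_alive_tendsto qmean_tendsto vsum_tendsto)
  ultimately have "\<bar>L * d - ?v\<bar> \<le> \<bar>d - d\<bar> + 0" by (intro LIMSEQ_le_const) auto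
  then show ?thesis by (simp add: d_def mult.commute)
qed

end

theorem mainTheorem2:
  fixes M :: "'w measure"
    and T :: "server \<Rightarrow> nat \<Rightarrow> 'w \<Rightarrow> nat"
    and k :: nat
    and prio :: server
    and N :: "server \<Rightarrow> nat"
    and \<alpha> :: "server \<Rightarrow> real vec"
    and B :: "server \<Rightarrow> real mat"
    and p :: "rstate pmf"
  assumes "prob_space M"
    and "1 \<le> k"
    and "\<And>m. dph_params (N m) (\<alpha> m) (B m)"
    and "\<And>m n. dph_distributed M (T m n) (N m) (\<alpha> m) (B m)"
    and "prob_space.indep_vars M (\<lambda>_. count_space UNIV) (\<lambda>(m, n). T m n) UNIV"
    and "dual_queue.stationary k prio N \<alpha> B p"
    and "\<And>p'. dual_queue.stationary k prio N \<alpha> B p' \<Longrightarrow> p' = p"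
    and "\<And>h. convergent (peak_aoi_prob M k prio T h)"
  shows "let A = dual_queue.A_mat k prio N \<alpha> B;
             I = 1\<^sub>m (dual_queue.y_dim k N);
             \<sigma> = dual_queue.sigma k prio N \<alpha> B p;
             c = dual_queue.c_succ k prio N \<alpha> B;
             d = scalar_prod \<sigma> ((A * the (mat_inverse (I - A))) *\<^sub>v c)
         in invertible_mat (I - A) \<and> d \<noteq> 0 \<and>
            (\<forall>h\<ge>1. lim (peak_aoi_prob M k prio T h) = scalar_prod \<sigma> ((A ^\<^sub>m h) *\<^sub>v c) / d)"
proof -
  interpret dual_queue_system k prio N \<alpha> B M T p
    using assms
    by (intro dual_queue_system.intro queue_model.intro stationary_queue.intro stable_queue.intro
        queue_model_axioms.intro stationary_queue_axioms.intro)
  \<comment> \<open>Both products with sigma carry the factor 1 / \<open>qtot p\<close>, which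
    cancels in the quotient.\<close>
  have d: "scalar_prod (sigma p) ((A_mat * the (mat_inverse (1\<^sub>m y_dim - A_mat))) *\<^sub>v c_succ) = qmean gsuc / qtot p"
    by (simp only: denominator qmean_def)
  have "lim (peak_aoi_prob M k prio T h) = scalar_prod (sigma p) ((A_mat ^\<^sub>m h) *\<^sub>v c_succ) / (qmean gsuc / qtot p)" for h
  proof -
    have "peak_aoi_prob M k prio T h \<longlonglongrightarrow> lim (peak_aoi_prob M k prio T h)"
      using assms(8) by (simp add: convergent_LIMSEQ_iff)
    from peak_limit[OF this] show ?thesis
      using qmean_gsuc_pos qtot_pos by (simp add: numerator qmean_def field_simps)
  qed
  then show ?thesis
    unfolding Let_def d using invertible_IA qmean_gsuc_pos qtot_pos by simp
qed

end
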